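(* Let $N\ge1$, let $\Gamma_N=(\gamma_N^2(i,j))_{i,j=1,\dots,N}$ be a symmetric matrix with nonnegative entries, and put $\gamma_{\max}^2=\max_{i,j}\gamma_N^2(i,j)$. Let $X_N$ be a GUE matrix with variance profile $\Gamma_N$, let $Y_N$ be a deterministic $N\times N$ Hermitian matrix (not necessarily diagonal), and $H_N=X_N+Y_N$. Let $Z_N=U_{N,k}\Theta_kU_{N,k}^*$ be a deterministic Hermitian matrix of rank $k$, where $\Theta_k$ is a $k\times k$ real diagonal matrix with nonzero diagonal entries and $U_{N,k}$ is an $N\times k$ matrix with orthonormal columns. For $\Lambda\in\mathrm D_N(\mathbb C)^+$ let $\Omega_{H_N}^\square(\Lambda)=\Lambda-\mathcal R_N\big(G_{H_N}^\square(\Lambda)\big)$, and for $\lambda\in\mathbb C^+$ define $$\beta_k(\lambda)=\mathbb I_k-U_{N,k}^*(\lambda\mathbb I_N-X_N-Y_N)^{-1}U_{N,k}\Theta_k,\qquad \tilde\beta_k^\square(\lambda)=\mathbb I_k-U_{N,k}^*\big(\Omega_{H_N}^\square(\lambda\mathbb I_N)-Y_N\big)^{-1}U_{N,k}\Theta_k .$$ Let $0<\delta<1$. Then for any $\lambda$ with $\operatorname{Im}\lambda\ge\gamma_{\max}\big(\frac{2}{N(1-\delta)}\big)^{1/5}$, $\tilde\beta_k^\square(\lambda)$ is a deterministic equivalent of $\beta_k(\lambda)$, in the sense that for any $d>0$, $$\mathbb P\big(\|\beta_k(\lambda)-\tilde\beta_k^\square(\lambda)\|\ge\|\Theta_k\|\,\bar\varepsilon_N(d)\big)\le4k^2N^{-d},$$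 where $$\bar\varepsilon_N(d)=\sqrt2\,k\,\gamma_{\max}\frac{\sqrt{d\log N}}{|\operatorname{Im}\lambda|^2}N^{-1/2}+\frac{2\gamma_{\max}^3}{N(\operatorname{Im}\lambda)^4}+\Big(1+\frac{\gamma_{\max}^2}{\delta|\operatorname{Im}\lambda|^2}\Big)\frac{2\gamma_{\max}^5}{N(\operatorname{Im}\lambda)^6}.$$
   Context: $\mathbb C^+$ is the open upper half plane; $\|\cdot\|$ is the operator norm; $\mathbb I_n$ is the $n\times n$ identity. A GUE matrix of size $N$ with variance profile $\Gamma_N=(\gamma_N^2(i,j))$ (with $\gamma_N(i,j)\ge 0$) is the Hermitian random matrix $X_N=\big(\gamma_N(i,j)x_{i,j}/\sqrt N\big)_{i,j}$, where $x_{j,i}=\overline{x_{i,j}}$, the variables $(x_{i,j})_{i\ge j}$ are independent, $x_{i,i}$ is a centered real Gaussian of variance $1$, and for $i\ne j$ $x_{i,j}$ is a centered complex Gaussian of variance $1$ (real and imaginary parts independent, each of variance $1/2$). $\mathrm D_N(\mathbb C)^+$ (resp. $\mathrm D_N(\mathbb C)^-$) is the set of $N\times N$ complex diagonal matrices all of whose diagonal entries have positive (resp. negative) imaginary part; $\Delta(A)$ is the diagonal matrix with the same diagonal entries as $A$; for a diagonal matrix $\Lambda$, $\mathcal R_N(\Lambda)=\mathrm{diag}_{i}\big(\sum_{j=1}^N\frac{\gamma_N^2(i,j)}{N}\Lambda(j,j)\big)$. $G_{H_N}^\square:\mathrm D_N(\mathbb C)^+\to\mathrm D_N(\mathbb C)^-$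 is the unique function, analytic in each variable, satisfying $G_{H_N}^\square(\Lambda)=\Delta\big[(\Lambda-\mathcal R_N(G_{H_N}^\square(\Lambda))-Y_N)^{-1}\big]$ for all $\Lambda\in \mathrm D_N(\mathbb C)^+$ (such a function exists and is unique).
   Formalization: The variance profile is assumed not identically zero (gamma_max > 0) and k is at least 1; for the zero profile both sides of the event vanish, so its probability is 1 and the bound 4k^2 N^{-d} fails for N >= 2 and large d; for k = 0 it would read 1 <= 0. *)

theory Defs
  imports "HOL-Probability.Probability" "HOL-Complex_Analysis.Complex_Analysis"
begin

text \<open>
  Conventions: an \<open>N \<times> k\<close> matrix has type \<open>complex^'k^'n\<close> with \<open>N = CARD('n)\<close> and
  \<open>k = CARD('k)\<close>. A variance profile \<open>\<Gamma> :: real^'n^'n\<close> stores the \<^emph>\<open>squared\<close> entries: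
  \<open>\<Gamma> $ i $ j\<close> is \<open>\<gamma>\<^sup>2(i,j)\<close>.
\<close>

definition adj_mat :: "complex^'n^'m \<Rightarrow> complex^'m^'n"
  where "adj_mat A = (\<chi> i j. cnj (A $ j $ i))"

definition hermitian_mat :: "complex^'n^'n \<Rightarrow> bool"
  where "hermitian_mat A \<longleftrightarrow> adj_mat A = A"

text \<open>The norm on \<open>complex^'n\<close> is the Euclidean one, so this is the usual operator norm.\<close>

definition op_norm :: "complex^'n^'m \<Rightarrow> real"
  where "op_norm A = onorm (\<lambda>v. A *v v)"

definition diagonal_matrix :: "complex^'n^'n \<Rightarrow> bool"
  where "diagonal_matrix A \<longleftrightarrow> (\<forall>i j. i \<noteq> j \<longrightarrow> A $ i $ j = 0)"

definition diag_mat :: "complex^'n \<Rightarrow> complex^'n^'n"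
  where "diag_mat v = (\<chi> i j. if i = j then v $ i else 0)"

definition diag_part :: "complex^'n^'n \<Rightarrow> complex^'n^'n"
  where "diag_part A = diag_mat (\<chi> i. A $ i $ i)"

definition diag_upper :: "(complex^'n^'n) set"
  where "diag_upper = {\<Lambda>. diagonal_matrix \<Lambda> \<and> (\<forall>i. Im (\<Lambda> $ i $ i) > 0)}"

definition diag_lower :: "(complex^'n^'n) set"
  where "diag_lower = {\<Lambda>. diagonal_matrix \<Lambda> \<and> (\<forall>i. Im (\<Lambda> $ i $ i) < 0)}"

definition gamma_max :: "real^'n^'n \<Rightarrow> real"
  where "gamma_max \<Gamma> = sqrt (Max {\<Gamma> $ i $ j | i j. True})"

text \<open>
  The index type carries a linear order only to express that the family
  \<open>(x i j)\<close>, \<open>i \<ge> j\<close>, is independent. Taking \<open>i = j\<close> in the conjugate symmetry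
  makes the diagonal variables real, so their law is that of their real parts. In
  \<open>normal_density \<mu> \<sigma>\<close> the parameter \<open>\<sigma>\<close> is the standard deviation, so
  variance \<open>1/2\<close> appears as \<open>sqrt (1/2)\<close>.
\<close>

definition gue_entries :: "'w measure \<Rightarrow> ('n::{finite,linorder} \<Rightarrow> 'n \<Rightarrow> 'w \<Rightarrow> complex) \<Rightarrow> bool"
  where "gue_entries M x \<longleftrightarrow>
    (\<forall>i j. \<forall>\<omega>\<in>space M. x j i \<omega> = cnj (x i j \<omega>)) \<and>
    prob_space.indep_vars M (\<lambda>_. borel) (\<lambda>(i, j). x i j) {(i, j). i \<ge> j} \<and>
    (\<forall>i. distributed M lborel (\<lambda>\<omega>. Re (x i i \<omega>)) (normal_density 0 1)) \<and>
    (\<forall>i j. i \<noteq> j \<longrightarrow>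
       prob_space.indep_var M borel (\<lambda>\<omega>. Re (x i j \<omega>)) borel (\<lambda>\<omega>. Im (x i j \<omega>)) \<and>
       distributed M lborel (\<lambda>\<omega>. Re (x i j \<omega>)) (normal_density 0 (sqrt (1/2))) \<and>
       distributed M lborel (\<lambda>\<omega>. Im (x i j \<omega>)) (normal_density 0 (sqrt (1/2))))"

definition gue_variance_profile ::
    "'w measure \<Rightarrow> ((real, 'n::{finite,linorder}) vec, 'n) vec \<Rightarrow>
     ('w \<Rightarrow> ((complex, 'n) vec, 'n) vec) \<Rightarrow> bool"
  where "gue_variance_profile M \<Gamma> X \<longleftrightarrow>
    (\<exists>x. gue_entries M x \<and>
         (\<forall>\<omega>\<in>space M. \<forall>i j.
            X \<omega> $ i $ j =
              complex_of_real (sqrt (\<Gamma> $ i $ j)) * x i j \<omega>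
                / complex_of_real (sqrt (real CARD('n)))))"

definition R_map :: "real^'n^'n \<Rightarrow> complex^'n^'n \<Rightarrow> complex^'n^'n"
  where "R_map \<Gamma> \<Lambda> =
    diag_mat (\<chi> i. \<Sum>j\<in>UNIV. complex_of_real (\<Gamma> $ i $ j / real CARD('n)) * \<Lambda> $ j $ j)"

definition Omega_box ::
    "real^'n^'n \<Rightarrow> (complex^'n^'n \<Rightarrow> complex^'n^'n) \<Rightarrow> complex^'n^'n \<Rightarrow> complex^'n^'n"
  where "Omega_box \<Gamma> G \<Lambda> = \<Lambda> - R_map \<Gamma> (G \<Lambda>)"

text \<open>
  The conditions characterising \<open>G\<close> (uniquely on \<open>diag_upper\<close>). Analyticity in each
  variable: the \<open>i\<close>-th diagonal entry of the argument varies over the upper half plane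
  while the other diagonal entries are kept fixed.
\<close>

definition is_G_box ::
    "real^'n^'n \<Rightarrow> complex^'n^'n \<Rightarrow> (complex^'n^'n \<Rightarrow> complex^'n^'n) \<Rightarrow> bool"
  where "is_G_box \<Gamma> Y G \<longleftrightarrow>
    G \<in> diag_upper \<rightarrow> diag_lower \<and>
    (\<forall>v i j. (\<forall>l. Im (v $ l) > 0) \<longrightarrow>
       (\<lambda>z. G (diag_mat (\<chi> l. if l = i then z else v $ l)) $ j $ j)
         analytic_on {z. Im z > 0}) \<and>
    (\<forall>\<Lambda>\<in>diag_upper. G \<Lambda> = diag_part (matrix_inv (Omega_box \<Gamma> G \<Lambda> - Y)))"

definition beta_k ::
    "complex^'n^'n \<Rightarrow> complex^'n^'n \<Rightarrow> complex^'k^'n \<Rightarrow> complex^'k^'k \<Rightarrow> complex \<Rightarrow> complex^'k^'k"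
  where "beta_k X Y U \<Theta> z =
    mat 1 - adj_mat U ** matrix_inv (mat z - X - Y) ** U ** \<Theta>"

definition beta_box_k ::
    "real^'n^'n \<Rightarrow> (complex^'n^'n \<Rightarrow> complex^'n^'n) \<Rightarrow> complex^'n^'n \<Rightarrow>
     complex^'k^'n \<Rightarrow> complex^'k^'k \<Rightarrow> complex \<Rightarrow> complex^'k^'k"
  where "beta_box_k \<Gamma> G Y U \<Theta> z =
    mat 1 - adj_mat U ** matrix_inv (Omega_box \<Gamma> G (mat z) - Y) ** U ** \<Theta>"

definition eps_bar :: "nat \<Rightarrow> nat \<Rightarrow> real \<Rightarrow> real \<Rightarrow> complex \<Rightarrow> real \<Rightarrow> real"
  where "eps_bar N k g \<delta> z d =
    sqrt 2 * real k * g * (sqrt (d * ln (real N)) / \<bar>Im z\<bar>^2) * real N powr (-1/2)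
    + 2 * g^3 / (real N * (Im z)^4)
    + (1 + g^2 / (\<delta> * \<bar>Im z\<bar>^2)) * (2 * g^5 / (real N * (Im z)^6))"

end

theory Submission
  imports Defs
begin

text \<open>
  Write the resolvent as a function \<open>R\<close> of a standard Gaussian vector. For a fixed matrix \<open>B\<close>
  the complex function \<open>f = tr (B R)\<close> has gradient of Hilbert--Schmidt norm at most
  \<open>L = \<gamma> \<parallel>B\<parallel> / (sqrt N \<eta>\<^sup>2)\<close>, where \<open>\<eta>\<close> is the imaginary part of the spectral parameter. The
  Gaussian covariance identity bounds the even moments of \<open>|f - E f|\<close> by those of a real Gaussian
  of variance \<open>L\<^sup>2\<close>, hence \<open>E cosh (a |f - E f|) \<le> exp (a\<^sup>2 L\<^sup>2 / 2)\<close>; treating the complex modulus at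
  once, rather than real and imaginary parts separately, is what gives the constant \<open>sqrt 2\<close> in the
  first term of \<open>eps_bar\<close>.

  By Gaussian integration by parts \<open>E R\<close> solves the matrix Dyson equation up to an error
  controlled by the variance of weighted traces of \<open>R\<close>. The diagonal of the inverse obtained from
  \<open>E R\<close> is then an exact solution at a slightly shifted spectral parameter. A contraction estimate
  in a metric weighted by the imaginary parts shows that solutions are unique and Lipschitz in the
  spectral parameter, so only the fixed-point equation for \<open>G\<close> is needed, not its analyticity.
\<close>

text \<open>The scales in \<open>eps_bar\<close> have separate origins. An entry of the compressed
  resolvent is a trace against a rank-one matrix of Hilbert--Schmidt norm one, so it fluctuates on
  the scale \<open>\<gamma> / (sqrt N * \<eta>^2)\<close>; a union bound over \<open>k^2\<close>
  entries gives the first term. The error in the equation for the mean is a covariance of the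
  resolvent with the weighted diagonal sums \<open>\<rho> i\<close>. These are traces against
  diagonal matrices of Hilbert--Schmidt norm at most \<open>\<gamma>^2 / sqrt N\<close>, hence have
  standard deviation at most \<open>\<gamma>^3 / (N * \<eta>^2)\<close>. To keep this order
  \<open>1/N\<close>, the error matrix is estimated as a quadratic form: summing bounds on its
  entries would cost powers of \<open>N\<close>.

  The lower bound on the imaginary part ensures that the shift of the spectral parameter, at most
  \<open>\<gamma>^5 / (N * \<eta>^4)\<close>, is at most \<open>(1 - \<delta>) * \<eta>\<close>. The
  shifted parameter then keeps imaginary part at least \<open>\<delta> * \<eta>\<close>, and
  \<open>\<delta>\<close> enters the result through the Lipschitz constant
  \<open>1 / (\<eta> * (\<delta> * \<eta>))\<close>.

  The argument yields half of the last two terms of \<open>eps_bar\<close> and half of the stated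
  probability; both factors of two are given away at the end.\<close>

subsection \<open>Differentiation under the integral sign\<close>

lemma has_vector_derivative_at_iff_quotient:
  fixes f :: "real \<Rightarrow> 'b::real_normed_vector"
  shows "(f has_vector_derivative d) (at x) \<longleftrightarrow> ((\<lambda>y. (f y - f x) /\<^sub>R (y - x)) \<longlongrightarrow> d) (at x)"
proof -
  have *: "norm (f y - f x - (y - x) *\<^sub>R d) / norm (y - x) = norm ((f y - f x) /\<^sub>R (y - x) - d)"
    if "y \<noteq> x" for y
  proof -
    have "(f y - f x) /\<^sub>R (y - x) - d = (f y - f x - (y - x) *\<^sub>R d) /\<^sub>R (y - x)"
      using that by (simp add: scaleR_diff_right)
    then show ?thesis by (simp add: divide_inverse mult.commute)
  qed
  have "(f has_vector_derivative d) (at x) \<longleftrightarrow>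
     ((\<lambda>y. norm (f y - f x - (y - x) *\<^sub>R d) / norm (y - x)) \<longlongrightarrow> 0) (at x)"
    by (simp add: has_vector_derivative_def has_derivative_iff_norm bounded_linear_scaleR_left)
  also have "\<dots> \<longleftrightarrow> ((\<lambda>y. norm ((f y - f x) /\<^sub>R (y - x) - d)) \<longlongrightarrow> 0) (at x)"
    using * by (intro filterlim_cong refl eventually_at_topological[THEN iffD2]) auto
  also have "\<dots> \<longleftrightarrow> ((\<lambda>y. (f y - f x) /\<^sub>R (y - x)) \<longlongrightarrow> d) (at x)"
    by (subst Lim_null) (simp add: tendsto_norm_zero_iff)
  finally show ?thesis .
qed

text \<open>Dominated convergence for difference quotients along an arbitrary sequence; the mean
  value inequality bounds them by \<open>K\<close>. Measurability of the derivative comes for free,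
  since it is a pointwise limit of the quotients.\<close>

lemma has_vector_derivative_integral:
  fixes f :: "real \<Rightarrow> 'a \<Rightarrow> 'b::{banach,second_countable_topology}"
  assumes r: "r > 0"
    and der: "\<And>t x. \<bar>t - t0\<bar> < r \<Longrightarrow> x \<in> space M \<Longrightarrow> ((\<lambda>t. f t x) has_vector_derivative f' t x) (at t)"
    and bnd: "\<And>t x. \<bar>t - t0\<bar> < r \<Longrightarrow> x \<in> space M \<Longrightarrow> norm (f' t x) \<le> K x"
    and K: "integrable M K"
    and f: "\<And>t. \<bar>t - t0\<bar> < r \<Longrightarrow> integrable M (f t)"
  shows "((\<lambda>t. \<integral>x. f t x \<partial>M) has_vector_derivative (\<integral>x. f' t0 x \<partial>M)) (at t0)" (is ?A)
    and "integrable M (f' t0)" (is ?B)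
proof -
  have main: "integrable M (f' t0) \<and>
      (\<lambda>n. ((\<integral>x. f (s n) x \<partial>M) - (\<integral>x. f t0 x \<partial>M)) /\<^sub>R (s n - t0)) \<longlonglongrightarrow> (\<integral>x. f' t0 x \<partial>M)"
    if s: "\<And>n. s n \<noteq> t0" "\<And>n. \<bar>s n - t0\<bar> < r" "s \<longlonglongrightarrow> t0" for s
  proof -
    define q where "q n x = (f (s n) x - f t0 x) /\<^sub>R (s n - t0)" for n x
    have int: "integrable M (f (s n))" "integrable M (f t0)" for n
      using f[of "s n"] f[of t0] s(2) r by auto
    have qm: "q n \<in> borel_measurable M" for n
      unfolding q_def using int(1)[of n] int(2) by (intro borel_measurable_scaleR borel_measurable_diff) auto
    have lim: "(\<lambda>n. q n x) \<longlonglongrightarrow> f' t0 x" if "x \<in> space M" for x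
      using der[of t0 x] that r s
      unfolding has_vector_derivative_at_iff_quotient q_def tendsto_at_iff_sequentially comp_def
      by auto
    have f'm: "f' t0 \<in> borel_measurable M"
      by (rule borel_measurable_LIMSEQ_metric[OF qm lim])
    have qb: "norm (q n x) \<le> K x" if x: "x \<in> space M" for n x
    proof -
      have "norm (f (s n) x - f t0 x) \<le> K x * norm (s n - t0)"
      proof (rule differentiable_bound[where S = "ball t0 r" and f' = "\<lambda>t h. h *\<^sub>R f' t x"])
        show "((\<lambda>t. f t x) has_derivative (\<lambda>h. h *\<^sub>R f' t x)) (at t within ball t0 r)"
          if "t \<in> ball t0 r" for t
          using der[of t x] x that
          by (auto simp: has_vector_derivative_def dist_real_def abs_minus_commute
              intro: has_derivative_at_withinI)
        show "onorm (\<lambda>h. h *\<^sub>R f' t x) \<le> K x" if "t \<in> ball t0 r" for t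
          using bnd[of t x] x that
          by (intro onorm_le) (auto simp: dist_real_def abs_minus_commute mult.commute intro!: mult_left_mono)
      qed (use s(2)[of n] r in \<open>auto simp: dist_real_def abs_minus_commute\<close>)
      then show ?thesis
        unfolding q_def using s(1)[of n]
        by (simp add: divide_simps abs_mult mult.commute)
    qed
    have 1: "integrable M (f' t0)"
      by (rule integrable_dominated_convergence[where s = q and w = K])
        (use f'm qm K lim qb in auto)
    have "(\<lambda>n. \<integral>x. q n x \<partial>M) \<longlonglongrightarrow> (\<integral>x. f' t0 x \<partial>M)"
      by (rule integral_dominated_convergence[where s = q and w = K])
        (use f'm qm K lim qb in auto)
    moreover have "(\<integral>x. q n x \<partial>M) = ((\<integral>x. f (s n) x \<partial>M) - (\<integral>x. f t0 x \<partial>M)) /\<^sub>R (s n - t0)" for n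
      unfolding q_def using int(1)[of n] int(2) by simp
    ultimately show ?thesis using 1 by simp
  qed
  \<comment> \<open>Integrability needs just one admissible sequence; the offset 2 keeps the
    distance to \<open>t0\<close> strictly below \<open>r\<close> already at
    \<open>n = 0\<close>.\<close>
  have "(\<lambda>n. t0 + r / real (n + 2)) \<longlonglongrightarrow> t0"
    using tendsto_add[OF tendsto_const LIMSEQ_ignore_initial_segment[OF lim_const_over_n, of r 2], of t0]
    by simp
  moreover have "t0 + r / real (n + 2) \<noteq> t0" "\<bar>t0 + r / real (n + 2) - t0\<bar> < r" for n
    using r by (auto simp: divide_less_eq)
  ultimately show ?B using main[of "\<lambda>n. t0 + r / real (n + 2)"] by blast
  show ?A
    unfolding has_vector_derivative_at_iff_quotient tendsto_at_iff_sequentially comp_def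
  proof (intro allI impI)
    fix s :: "nat \<Rightarrow> real" assume s: "\<forall>n. s n \<in> UNIV - {t0}" "s \<longlonglongrightarrow> t0"
    then obtain n0 where n0: "\<And>n. n \<ge> n0 \<Longrightarrow> \<bar>s n - t0\<bar> < r"
      using r unfolding lim_sequentially dist_real_def by blast
    show "(\<lambda>n. ((\<integral>x. f (s n) x \<partial>M) - (\<integral>x. f t0 x \<partial>M)) /\<^sub>R (s n - t0)) \<longlonglongrightarrow> (\<integral>x. f' t0 x \<partial>M)"
      by (rule LIMSEQ_offset[where k = n0], rule main[THEN conjunct2])
        (use s n0 LIMSEQ_ignore_initial_segment[OF s(2), of n0] in auto)
  qed
qed

subsection \<open>The standard Gaussian measure on a Euclidean space\<close>

definition gauss_dens :: "'a::euclidean_space \<Rightarrow> real"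
  where "gauss_dens x = exp (- (norm x)\<^sup>2 / 2) / sqrt (2 * pi) ^ DIM('a)"

definition std_gauss :: "'a::euclidean_space measure"
  where "std_gauss = density lborel (\<lambda>x. ennreal (gauss_dens x))"

lemma gauss_dens_pos: "gauss_dens x > 0"
  by (simp add: gauss_dens_def)

lemma gauss_dens_measurable [measurable]: "gauss_dens \<in> borel_measurable borel"
  unfolding gauss_dens_def by measurable

lemma sets_std_gauss [measurable_cong, simp]: "sets std_gauss = sets borel"
  by (simp add: std_gauss_def)

lemma space_std_gauss [simp]: "space std_gauss = UNIV"
  by (simp add: std_gauss_def)

lemma gauss_dens_prod:
  "gauss_dens (x :: 'a::euclidean_space) = (\<Prod>b\<in>Basis. std_normal_density (x \<bullet> b))"
proof -
  have "(\<Sum>b\<in>Basis. - (x \<bullet> b)\<^sup>2 / 2) = - (norm x)\<^sup>2 / 2"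
    unfolding power2_norm_eq_inner euclidean_inner[of x x]
    by (simp add: sum_negf sum_divide_distrib power2_eq_square)
  then show ?thesis
    by (simp add: gauss_dens_def std_normal_density_def prod_dividef exp_sum[symmetric] prod_constant)
qed

text \<open>Independence of the coordinates. Taking \<open>UNIV\<close> in every coordinate gives
  total mass one; taking intervals gives the values on boxes, which determine the measure.\<close>

lemma emeasure_std_gauss_inter:
  assumes A: "\<And>b. b \<in> Basis \<Longrightarrow> A b \<in> sets borel"
  shows "emeasure std_gauss {x :: 'a::euclidean_space. \<forall>b\<in>Basis. x \<bullet> b \<in> A b} =
    (\<Prod>b\<in>Basis. \<integral>\<^sup>+t. ennreal (std_normal_density t) * indicator (A b) t \<partial>lborel)"
proof -
  have "{x :: 'a \<in> space borel. \<forall>b\<in>Basis. x \<bullet> b \<in> A b} \<in> sets borel"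
    using A by (intro sets.sets_Collect_finite_All) (auto intro!: measurable_sets_borel[where f = "\<lambda>x. x \<bullet> _", unfolded vimage_def])
  then have "{x :: 'a. \<forall>b\<in>Basis. x \<bullet> b \<in> A b} \<in> sets borel" by simp
  then have "emeasure std_gauss {x :: 'a. \<forall>b\<in>Basis. x \<bullet> b \<in> A b} =
      (\<integral>\<^sup>+x. ennreal (gauss_dens x) * indicator {x. \<forall>b\<in>Basis. x \<bullet> b \<in> A b} x \<partial>lborel)"
    unfolding std_gauss_def by (subst emeasure_density) auto
  also have "\<dots> = (\<integral>\<^sup>+x. (\<Prod>b\<in>Basis. ennreal (std_normal_density (x \<bullet> b)) * indicator (A b) (x \<bullet> b)) \<partial>(lborel :: 'a measure))"
  proof (intro nn_integral_cong)
    fix x :: 'a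
    have "(indicator {x. \<forall>b\<in>Basis. x \<bullet> b \<in> A b} x :: ennreal) = (\<Prod>b\<in>Basis. indicator (A b) (x \<bullet> b))"
      by (auto simp: indicator_def prod_zero_iff)
    then show "ennreal (gauss_dens x) * indicator {x. \<forall>b\<in>Basis. x \<bullet> b \<in> A b} x =
        (\<Prod>b\<in>Basis. ennreal (std_normal_density (x \<bullet> b)) * indicator (A b) (x \<bullet> b))"
      by (simp add: gauss_dens_prod prod_ennreal prod.distrib)
  qed
  also have "\<dots> = (\<Prod>b\<in>Basis. \<integral>\<^sup>+t. ennreal (std_normal_density t) * indicator (A b) t \<partial>lborel)"
    using A by (intro nn_integral_lborel_prod) auto
  finally show ?thesis .
qed

lemma prob_space_std_gauss: "prob_space (std_gauss :: 'a::euclidean_space measure)"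
proof
  have "(\<integral>\<^sup>+t. ennreal (std_normal_density t) \<partial>lborel) = 1"
    using prob_space.emeasure_space_1[OF prob_space_normal_density, of 1 0]
    by (simp add: emeasure_density)
  then show "emeasure (std_gauss :: 'a measure) (space std_gauss) = 1"
    using emeasure_std_gauss_inter[where A = "\<lambda>_ :: 'a. UNIV"] by simp
qed

interpretation std_gauss: prob_space "std_gauss :: 'a::euclidean_space measure"
  by (rule prob_space_std_gauss)

interpretation std_gauss_pair: pair_prob_space
  "std_gauss :: 'a::euclidean_space measure" "std_gauss :: 'b::euclidean_space measure" ..

lemma gauss_dens_shift:
  assumes "b \<in> Basis"
  shows "gauss_dens (x - t *\<^sub>R b) = gauss_dens x * exp (t * (x \<bullet> b) - t\<^sup>2 / 2)"
proof -
  have "(norm (x - t *\<^sub>R b))\<^sup>2 = (norm x)\<^sup>2 - 2 * t * (x \<bullet> b) + t\<^sup>2"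
    using assms unfolding power2_norm_eq_inner
    by (simp add: inner_diff_left inner_diff_right inner_commute inner_same_Basis power2_eq_square)
  then show ?thesis
    by (simp add: gauss_dens_def exp_add[symmetric] diff_divide_distrib add_divide_distrib)
qed

text \<open>Cameron--Martin formula in a coordinate direction: Lebesgue measure is translation
  invariant, so only the density changes, by an exponential weight.\<close>

lemma std_gauss_shift:
  fixes h :: "'a::euclidean_space \<Rightarrow> 'b::{banach,second_countable_topology}"
  assumes b: "b \<in> Basis" and [measurable]: "h \<in> borel_measurable borel"
  shows "(\<integral>x. h (x + t *\<^sub>R b) \<partial>std_gauss) = (\<integral>x. exp (t * (x \<bullet> b) - t\<^sup>2 / 2) *\<^sub>R h x \<partial>std_gauss)"
    and "integrable std_gauss (\<lambda>x. h (x + t *\<^sub>R b)) \<longleftrightarrow>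
      integrable std_gauss (\<lambda>x. exp (t * (x \<bullet> b) - t\<^sup>2 / 2) *\<^sub>R h x)"
proof -
  have nn: "AE x in lborel. 0 \<le> gauss_dens x" by (auto intro: less_imp_le gauss_dens_pos)
  have 1: "lborel = distr lborel borel ((+) (t *\<^sub>R b))"
    by (rule lborel_distr_plus[symmetric])
  have eq: "(gauss_dens (x + t *\<^sub>R b) * exp (t * ((x + t *\<^sub>R b) \<bullet> b) - t\<^sup>2 / 2)) = gauss_dens x" for x
    using gauss_dens_shift[OF b, of "x + t *\<^sub>R b" t] by simp
  show "(\<integral>x. h (x + t *\<^sub>R b) \<partial>std_gauss) = (\<integral>x. exp (t * (x \<bullet> b) - t\<^sup>2 / 2) *\<^sub>R h x \<partial>std_gauss)"
    unfolding std_gauss_def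
    using nn
    apply (subst (1 2) integral_density; (measurable; fail)?)
    apply simp
    apply (subst (2) 1)
    apply (subst integral_distr)
    apply (simp_all only: add.commute[of "t *\<^sub>R b"] scaleR_scaleR eq)
    apply simp_all
    done
  show "integrable std_gauss (\<lambda>x. h (x + t *\<^sub>R b)) \<longleftrightarrow>
      integrable std_gauss (\<lambda>x. exp (t * (x \<bullet> b) - t\<^sup>2 / 2) *\<^sub>R h x)"
    unfolding std_gauss_def
    using nn
    apply (subst (1 2) integrable_density; (measurable; fail)?)
    apply simp
    apply (subst (2) 1)
    apply (subst integrable_distr_eq)
    apply (simp_all only: add.commute[of "t *\<^sub>R b"] scaleR_scaleR eq)
    apply simp_all
    done
qed

text \<open>For the constant function 1, the shift formula is already the integrability of the
  exponential weight.\<close>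

lemma integrable_std_gauss_exp:
  assumes "b \<in> Basis"
  shows "integrable std_gauss (\<lambda>x :: 'a::euclidean_space. exp (t * (x \<bullet> b)))"
proof -
  have "integrable std_gauss (\<lambda>x::'a. exp (t * (x \<bullet> b) - t\<^sup>2 / 2) *\<^sub>R (1::real))"
    using std_gauss_shift(2)[OF assms, of "\<lambda>_. 1 :: real" t] by simp
  then have "integrable std_gauss (\<lambda>x::'a. exp (t\<^sup>2 / 2) * (exp (t * (x \<bullet> b) - t\<^sup>2 / 2)))"
    by (intro integrable_mult_right) simp
  then show ?thesis by (simp add: exp_add[symmetric])
qed

lemma integrable_std_gauss_exp_abs:
  assumes "b \<in> Basis"
  shows "integrable std_gauss (\<lambda>x :: 'a::euclidean_space. exp (t * \<bar>x \<bullet> b\<bar>))"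
proof (rule Bochner_Integration.integrable_bound)
  have "exp (t * \<bar>s\<bar>) \<le> exp (t * s) + exp (- t * s)" for s
    by (auto simp: abs_if)
  then show "AE x :: 'a in std_gauss. norm (exp (t * \<bar>x \<bullet> b\<bar>)) \<le> norm (exp (t * (x \<bullet> b)) + exp (- t * (x \<bullet> b)))"
    by (auto intro!: AE_I2 order_trans[OF _ abs_ge_self] simp: add_nonneg_nonneg)
  show "integrable std_gauss (\<lambda>x :: 'a. exp (t * (x \<bullet> b)) + exp (- t * (x \<bullet> b)))"
    by (intro Bochner_Integration.integrable_add integrable_std_gauss_exp assms)
qed auto

lemma integrable_std_gauss_inner:
  assumes "b \<in> Basis"
  shows "integrable std_gauss (\<lambda>x :: 'a::euclidean_space. \<bar>x \<bullet> b\<bar>)"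
  by (rule Bochner_Integration.integrable_bound[OF integrable_std_gauss_exp_abs[OF assms, of 1]])
    (auto intro!: AE_I2 order_trans[OF _ exp_ge_add_one_self])

lemma integrable_std_gauss_norm: "integrable std_gauss (\<lambda>x :: 'a::euclidean_space. norm x)"
  by (rule Bochner_Integration.integrable_bound[where f = "\<lambda>x. \<Sum>b\<in>Basis. \<bar>x \<bullet> b\<bar>"])
    (auto intro!: integrable_std_gauss_inner norm_le_l1 order_trans[OF _ abs_ge_self])

text \<open>The derivative at \<open>t = 0\<close> of the mean of
  \<open>h (x + t *\<^sub>R b)\<close> is computed twice: under the integral sign, and after the
  shift formula has moved \<open>t\<close> into the weight.\<close>

lemma std_gauss_stein:
  fixes h :: "'a::euclidean_space \<Rightarrow> 'b::{banach,second_countable_topology}"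
  assumes b: "b \<in> Basis"
    and der: "\<And>x. (h has_derivative h' x) (at x)"
    and C: "\<And>x. norm (h x) \<le> C" and K: "\<And>x. norm (h' x b) \<le> K"
  shows "(\<integral>x. (x \<bullet> b) *\<^sub>R h x \<partial>std_gauss) = (\<integral>x. h' x b \<partial>std_gauss)"
proof -
  have cont: "continuous_on UNIV h"
    using der by (auto intro!: continuous_at_imp_continuous_on has_derivative_continuous)
  then have [measurable]: "h \<in> borel_measurable borel"
    by (rule borel_measurable_continuous_onI)
  have C0: "0 \<le> C" using C[of 0] norm_ge_zero order_trans by blast
  have bdd: "integrable std_gauss (\<lambda>x. h (x + t *\<^sub>R b))" for t
    by (rule std_gauss.integrable_const_bound[where B = C]) (use C in auto)
  have 1: "((\<lambda>t. \<integral>x. h (x + t *\<^sub>R b) \<partial>std_gauss) has_vector_derivative (\<integral>x. h' (x + 0 *\<^sub>R b) b \<partial>std_gauss)) (at 0)"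
  proof (rule has_vector_derivative_integral(1)[where r = 1 and K = "\<lambda>_. K" and f' = "\<lambda>t x. h' (x + t *\<^sub>R b) b"])
    fix t x
    have "((\<lambda>t. h (x + t *\<^sub>R b)) has_derivative (\<lambda>s. h' (x + t *\<^sub>R b) (s *\<^sub>R b))) (at t)"
      by (rule has_derivative_compose[OF _ der, of _ "\<lambda>s. s *\<^sub>R b"]) (auto intro!: derivative_eq_intros)
    then show "((\<lambda>t. h (x + t *\<^sub>R b)) has_vector_derivative h' (x + t *\<^sub>R b) b) (at t)"
      unfolding has_vector_derivative_def
      by (simp add: linear_scale[OF has_derivative_linear[OF der]])
  qed (use K bdd in auto)
  \<comment> \<open>For \<open>t\<close> of modulus below 1, the weight and the factor
    \<open>x \<bullet> b - t\<close> are each bounded by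
    \<open>exp \<bar>x \<bullet> b\<bar>\<close>.\<close>
  have bd: "norm ((exp (t * (x \<bullet> b) - t\<^sup>2 / 2) * (x \<bullet> b - t)) *\<^sub>R h x) \<le> C * exp (2 * \<bar>x \<bullet> b\<bar>)"
    if t: "\<bar>t\<bar> < 1" for t x
  proof -
    have "t * (x \<bullet> b) \<le> \<bar>t\<bar> * \<bar>x \<bullet> b\<bar>" using abs_ge_self[of "t * (x \<bullet> b)"] by (simp add: abs_mult)
    also have "\<dots> \<le> 1 * \<bar>x \<bullet> b\<bar>" using t by (intro mult_right_mono) auto
    finally have "exp (t * (x \<bullet> b) - t\<^sup>2 / 2) \<le> exp \<bar>x \<bullet> b\<bar>"
      using zero_le_power2[of t] by (simp only: exp_le_cancel_iff)
    moreover have "\<bar>x \<bullet> b - t\<bar> \<le> exp \<bar>x \<bullet> b\<bar>"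
      using t exp_ge_add_one_self[of "\<bar>x \<bullet> b\<bar>"] by linarith
    ultimately have "exp (t * (x \<bullet> b) - t\<^sup>2 / 2) * \<bar>x \<bullet> b - t\<bar> \<le> exp \<bar>x \<bullet> b\<bar> * exp \<bar>x \<bullet> b\<bar>"
      by (intro mult_mono) auto
    also have "\<dots> = exp (2 * \<bar>x \<bullet> b\<bar>)" by (simp add: exp_add[symmetric])
    finally have "exp (t * (x \<bullet> b) - t\<^sup>2 / 2) * \<bar>x \<bullet> b - t\<bar> * norm (h x) \<le> exp (2 * \<bar>x \<bullet> b\<bar>) * C"
      using C by (intro mult_mono) auto
    then show ?thesis by (simp add: abs_mult mult.commute)
  qed
  have 2: "((\<lambda>t. \<integral>x. exp (t * (x \<bullet> b) - t\<^sup>2 / 2) *\<^sub>R h x \<partial>std_gauss) has_vector_derivative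
      (\<integral>x. (exp (0 * (x \<bullet> b) - 0\<^sup>2 / 2) * (x \<bullet> b - 0)) *\<^sub>R h x \<partial>std_gauss)) (at 0)"
  proof (rule has_vector_derivative_integral(1)[where r = 1 and K = "\<lambda>x. C * exp (2 * \<bar>x \<bullet> b\<bar>)"
        and f' = "\<lambda>t x. (exp (t * (x \<bullet> b) - t\<^sup>2 / 2) * (x \<bullet> b - t)) *\<^sub>R h x"])
    fix t x
    show "((\<lambda>t. exp (t * (x \<bullet> b) - t\<^sup>2 / 2) *\<^sub>R h x) has_vector_derivative
        (exp (t * (x \<bullet> b) - t\<^sup>2 / 2) * (x \<bullet> b - t)) *\<^sub>R h x) (at t)"
      by (auto intro!: derivative_eq_intros simp: has_real_derivative_iff_has_vector_derivative[symmetric])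
  next
    show "integrable std_gauss (\<lambda>x. C * exp (2 * \<bar>x \<bullet> b\<bar>))"
      by (intro integrable_mult_right integrable_std_gauss_exp_abs b)
    show "integrable std_gauss (\<lambda>x. exp (t * (x \<bullet> b) - t\<^sup>2 / 2) *\<^sub>R h x)" for t
      using bdd std_gauss_shift(2)[OF b, of h t] by simp
  qed (use bd in auto)
  have "(\<integral>x. h' x b \<partial>std_gauss) = (\<integral>x. (x \<bullet> b) *\<^sub>R h x \<partial>std_gauss)"
    using vector_derivative_unique_at[OF 1 2[folded std_gauss_shift(1)[OF b, of h, simplified]]]
    by simp
  then show ?thesis ..
qed

subsection \<open>Rotation invariance\<close>

lemma shear_lborel:
  "distr (lborel :: ('a::euclidean_space \<times> 'a) measure) borel (\<lambda>(x, y). (x + c *\<^sub>R y, y)) = lborel" (is ?A)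
  "distr (lborel :: ('a::euclidean_space \<times> 'a) measure) borel (\<lambda>(x, y). (x, y + c *\<^sub>R x)) = lborel" (is ?B)
proof -
  have tr: "(\<integral>\<^sup>+x. f (x + a) \<partial>lborel) = (\<integral>\<^sup>+x. f x \<partial>lborel)"
    if [measurable]: "f \<in> borel_measurable borel" for f :: "'a \<Rightarrow> ennreal" and a
    by (subst (2) lborel_distr_plus[of a, symmetric]) (simp add: nn_integral_distr add.commute)
  have m1: "(\<lambda>(x, y). (x + c *\<^sub>R y, y)) \<in> borel \<rightarrow>\<^sub>M (borel :: ('a \<times> 'a) measure)"
    by (intro borel_measurable_continuous_onI) (auto intro!: continuous_intros simp: split_beta)
  have m2: "(\<lambda>(x, y). (x, y + c *\<^sub>R x)) \<in> borel \<rightarrow>\<^sub>M (borel :: ('a \<times> 'a) measure)"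
    by (intro borel_measurable_continuous_onI) (auto intro!: continuous_intros simp: split_beta)
  show ?A
  proof (rule measure_eqI)
    fix S :: "('a \<times> 'a) set" assume "S \<in> sets (distr lborel borel (\<lambda>(x, y). (x + c *\<^sub>R y, y)))"
    then have S: "S \<in> sets borel" by simp
    have Sm [measurable]: "(indicator S :: 'a \<times> 'a \<Rightarrow> ennreal) \<in> borel_measurable (borel \<Otimes>\<^sub>M borel)"
      using S by (simp add: borel_prod)
    have "emeasure (distr lborel borel (\<lambda>(x, y). (x + c *\<^sub>R y, y))) S =
      (\<integral>\<^sup>+p. indicator S (fst p + c *\<^sub>R snd p, snd p) \<partial>(lborel \<Otimes>\<^sub>M lborel))"
      using S m1 by (subst nn_integral_indicator[symmetric], simp, subst nn_integral_distr)
        (auto simp: split_beta lborel_prod)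
    also have "\<dots> = (\<integral>\<^sup>+y. \<integral>\<^sup>+x. indicator S (x + c *\<^sub>R y, y) \<partial>lborel \<partial>lborel)"
      by (subst lborel_pair.nn_integral_snd[symmetric]) auto
    also have "\<dots> = (\<integral>\<^sup>+y. \<integral>\<^sup>+x. indicator S (x, y) \<partial>lborel \<partial>lborel)"
      by (subst tr) auto
    also have "\<dots> = (\<integral>\<^sup>+p. indicator S p \<partial>(lborel \<Otimes>\<^sub>M lborel))"
      by (subst lborel_pair.nn_integral_snd[symmetric]) auto
    also have "\<dots> = emeasure lborel S" using S by (simp add: lborel_prod)
    finally show "emeasure (distr lborel borel (\<lambda>(x, y). (x + c *\<^sub>R y, y))) S = emeasure lborel S" .
  qed simp
  show ?B
  proof (rule measure_eqI)
    fix S :: "('a \<times> 'a) set" assume "S \<in> sets (distr lborel borel (\<lambda>(x, y). (x, y + c *\<^sub>R x)))"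
    then have S: "S \<in> sets borel" by simp
    have Sm [measurable]: "(indicator S :: 'a \<times> 'a \<Rightarrow> ennreal) \<in> borel_measurable (borel \<Otimes>\<^sub>M borel)"
      using S by (simp add: borel_prod)
    have "emeasure (distr lborel borel (\<lambda>(x, y). (x, y + c *\<^sub>R x))) S =
      (\<integral>\<^sup>+p. indicator S (fst p, snd p + c *\<^sub>R fst p) \<partial>(lborel \<Otimes>\<^sub>M lborel))"
      using S m2 by (subst nn_integral_indicator[symmetric], simp, subst nn_integral_distr)
        (auto simp: split_beta lborel_prod)
    also have "\<dots> = (\<integral>\<^sup>+x. \<integral>\<^sup>+y. indicator S (x, y + c *\<^sub>R x) \<partial>lborel \<partial>lborel)"
      by (subst lborel.nn_integral_fst[symmetric]) auto
    also have "\<dots> = (\<integral>\<^sup>+x. \<integral>\<^sup>+y. indicator S (x, y) \<partial>lborel \<partial>lborel)"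
      by (subst tr) auto
    also have "\<dots> = (\<integral>\<^sup>+p. indicator S p \<partial>(lborel \<Otimes>\<^sub>M lborel))"
      by (subst lborel.nn_integral_fst[symmetric]) auto
    also have "\<dots> = emeasure lborel S" using S by (simp add: lborel_prod)
    finally show "emeasure (distr lborel borel (\<lambda>(x, y). (x, y + c *\<^sub>R x))) S = emeasure lborel S" .
  qed simp
qed

text \<open>A planar rotation with \<open>s \<noteq> 0\<close> is a product of three shears, each of which is a translation on fibres.\<close>

lemma rotation_lborel:
  assumes cs: "c\<^sup>2 + s\<^sup>2 = 1" "s \<noteq> 0"
  shows "distr (lborel :: ('a::euclidean_space \<times> 'a) measure) borel
     (\<lambda>(x, y). (c *\<^sub>R x + s *\<^sub>R y, - s *\<^sub>R x + c *\<^sub>R y)) = lborel"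
proof -
  \<comment> \<open>The tangent of half the rotation angle.\<close>
  define k where "k = (1 - c) / s"
  have ks: "1 - k * s = c" "k + c * k = s"
    using cs by (auto simp: k_def field_simps power2_eq_square)
  let ?f = "\<lambda>(x, y). (x + k *\<^sub>R y, y) :: 'a \<times> 'a" and ?g = "\<lambda>(x, y). (x, y + (- s) *\<^sub>R x) :: 'a \<times> 'a"
  have m: "?f \<in> borel \<rightarrow>\<^sub>M borel" "?g \<in> borel \<rightarrow>\<^sub>M borel"
    by (intro borel_measurable_continuous_onI; auto intro!: continuous_intros simp: split_beta)+
  have "(\<lambda>(x, y). (c *\<^sub>R x + s *\<^sub>R y, - s *\<^sub>R x + c *\<^sub>R y)) = ?f \<circ> (?g \<circ> ?f)"
  proof (intro ext, clarsimp, safe)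
    fix x y :: 'a
    have "x + k *\<^sub>R y + k *\<^sub>R (y - s *\<^sub>R (x + k *\<^sub>R y)) = (1 - k * s) *\<^sub>R x + (k + (1 - k * s) * k) *\<^sub>R y"
      by (simp add: algebra_simps) (simp add: scaleR_add_left[symmetric] mult_2_right[symmetric] del: mult_2_right)
    then show "c *\<^sub>R x + s *\<^sub>R y = x + k *\<^sub>R y + k *\<^sub>R (y - s *\<^sub>R (x + k *\<^sub>R y))"
      by (simp only: ks)
    have "y - s *\<^sub>R (x + k *\<^sub>R y) = (1 - k * s) *\<^sub>R y - s *\<^sub>R x"
      by (simp add: algebra_simps)
    then show "c *\<^sub>R y - s *\<^sub>R x = y - s *\<^sub>R (x + k *\<^sub>R y)" by (simp only: ks)
  qed
  then have "distr lborel borel (\<lambda>(x, y). (c *\<^sub>R x + s *\<^sub>R y, - s *\<^sub>R x + c *\<^sub>R y)) =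
      distr (distr (distr lborel borel ?f) borel ?g) borel ?f"
    using m by (simp add: distr_distr o_assoc)
  also have "\<dots> = lborel"
    by (simp only: shear_lborel)
  finally show ?thesis .
qed

lemma std_gauss_pair_density:
  "(std_gauss :: 'a::euclidean_space measure) \<Otimes>\<^sub>M (std_gauss :: 'a measure) =
    density lborel (\<lambda>p. ennreal (gauss_dens (fst p) * gauss_dens (snd p)))"
proof -
  have "(std_gauss :: 'a measure) \<Otimes>\<^sub>M (std_gauss :: 'a measure) =
    density (lborel \<Otimes>\<^sub>M lborel) (\<lambda>(x, y). ennreal (gauss_dens x) * ennreal (gauss_dens y))"
    unfolding std_gauss_def
  proof (rule pair_measure_density)
    show "sigma_finite_measure (density lborel (\<lambda>x::'a. ennreal (gauss_dens x)))"
      using prob_space_std_gauss unfolding std_gauss_def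
      by (intro finite_measure.axioms(1) prob_space.axioms(1))
  qed (auto intro: sigma_finite_lborel)
  then show ?thesis
    by (simp add: lborel_prod split_beta' ennreal_mult[OF less_imp_le[OF gauss_dens_pos] less_imp_le[OF gauss_dens_pos]])
qed

text \<open>The joint density depends only on the sum of the two squared norms, which a rotation
  preserves, and Lebesgue measure is rotation invariant.\<close>

lemma std_gauss_rotation:
  assumes cs: "c\<^sup>2 + s\<^sup>2 = 1" "s \<noteq> 0"
    and f [measurable]: "f \<in> borel_measurable (borel \<Otimes>\<^sub>M borel)"
  shows "(\<integral>p. f (c *\<^sub>R fst p + s *\<^sub>R snd p, - s *\<^sub>R fst p + c *\<^sub>R snd p) \<partial>(std_gauss \<Otimes>\<^sub>M std_gauss)) =
    (\<integral>p. (f :: 'a::euclidean_space \<times> 'a \<Rightarrow> 'b::{banach,second_countable_topology}) p \<partial>(std_gauss \<Otimes>\<^sub>M std_gauss))"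
proof -
  let ?R = "\<lambda>(x :: 'a, y). (c *\<^sub>R x + s *\<^sub>R y, - s *\<^sub>R x + c *\<^sub>R y)"
  let ?d = "\<lambda>p :: 'a \<times> 'a. gauss_dens (fst p) * gauss_dens (snd p)"
  have Rm [measurable]: "?R \<in> borel \<rightarrow>\<^sub>M borel"
    by (intro borel_measurable_continuous_onI) (auto intro!: continuous_intros simp: split_beta)
  have [measurable]: "f \<in> borel_measurable borel" using f by (simp add: borel_prod)
  have dm [measurable]: "?d \<in> borel_measurable borel"
    unfolding borel_prod[symmetric] by measurable
  have inv: "?d (?R p) = ?d p" for p
  proof (cases p)
    case (Pair x y)
    have "(norm (c *\<^sub>R x + s *\<^sub>R y))\<^sup>2 + (norm (- s *\<^sub>R x + c *\<^sub>R y))\<^sup>2 = (c\<^sup>2 + s\<^sup>2) * ((norm x)\<^sup>2 + (norm y)\<^sup>2)"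
      unfolding power2_norm_eq_inner
      by (simp add: inner_add_left inner_add_right inner_diff_left inner_diff_right inner_commute power2_eq_square algebra_simps)
    then show ?thesis using cs(1)
      by (simp add: Pair gauss_dens_def exp_add[symmetric] add_divide_distrib[symmetric])
  qed
  have nn: "AE p in lborel. 0 \<le> ?d p" by (auto intro!: mult_nonneg_nonneg less_imp_le[OF gauss_dens_pos])
  have "(\<integral>p. f p \<partial>(std_gauss \<Otimes>\<^sub>M std_gauss)) = (\<integral>p. ?d p *\<^sub>R f p \<partial>distr lborel borel ?R)"
    unfolding std_gauss_pair_density rotation_lborel[OF cs] using nn
    by (subst integral_density) auto
  also have "\<dots> = (\<integral>p. ?d (?R p) *\<^sub>R f (?R p) \<partial>lborel)"
    using Rm by (intro integral_distr) measurable
  also have "\<dots> = (\<integral>p. f (?R p) \<partial>(std_gauss \<Otimes>\<^sub>M std_gauss))"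
    unfolding std_gauss_pair_density inv using nn measurable_compose[OF Rm \<open>f \<in> borel_measurable borel\<close>]
    by (subst integral_density) simp_all
  finally show ?thesis by (simp add: split_beta)
qed

subsection \<open>Concentration of measure\<close>

lemma measure_std_gauss_UNIV [simp]: "measure std_gauss UNIV = 1"
  using std_gauss.prob_space by simp

text \<open>A directional derivative is a pointwise limit of continuous difference quotients, so it
  is Borel without any continuity of \<open>f'\<close>.\<close>

lemma borel_measurable_has_derivative:
  fixes f :: "'a::euclidean_space \<Rightarrow> 'b::real_normed_vector"
  assumes der: "\<And>x. (f has_derivative f' x) (at x)"
  shows "f \<in> borel_measurable borel" "(\<lambda>x. f' x v) \<in> borel_measurable borel"
proof -
  have "continuous_on UNIV f"
    using der by (auto intro!: continuous_at_imp_continuous_on has_derivative_continuous)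
  then show [measurable]: "f \<in> borel_measurable borel"
    by (rule borel_measurable_continuous_onI)
  show "(\<lambda>x. f' x v) \<in> borel_measurable borel"
  proof (rule borel_measurable_LIMSEQ_metric)
    fix x
    have "((\<lambda>t. f (x + t *\<^sub>R v)) has_derivative (\<lambda>s. f' (x + 0 *\<^sub>R v) (s *\<^sub>R v))) (at 0)"
      by (rule has_derivative_compose[OF _ der, of _ "\<lambda>s. s *\<^sub>R v"]) (auto intro!: derivative_eq_intros)
    then have "((\<lambda>t. f (x + t *\<^sub>R v)) has_vector_derivative f' x v) (at 0)"
      unfolding has_vector_derivative_def
      by (simp add: linear_scale[OF has_derivative_linear[OF der]])
    then have lim: "((\<lambda>t. (f (x + t *\<^sub>R v) - f x) /\<^sub>R t) \<longlongrightarrow> f' x v) (at 0)"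
      by (simp add: has_vector_derivative_at_iff_quotient)
    have "filterlim (\<lambda>n. inverse (real (Suc n))) (at 0) sequentially"
      unfolding filterlim_at using LIMSEQ_inverse_real_of_nat by auto
    from filterlim_compose[OF lim this]
    show "(\<lambda>n. (f (x + inverse (real (Suc n)) *\<^sub>R v) - f x) /\<^sub>R inverse (real (Suc n))) \<longlonglongrightarrow> f' x v" .
  next
    fix n
    have "continuous_on UNIV (\<lambda>x. (f (x + inverse (real (Suc n)) *\<^sub>R v) - f x) /\<^sub>R inverse (real (Suc n)))"
      by (intro continuous_intros continuous_on_compose2[OF \<open>continuous_on UNIV f\<close>]) auto
    then show "(\<lambda>x. (f (x + inverse (real (Suc n)) *\<^sub>R v) - f x) /\<^sub>R inverse (real (Suc n))) \<in> borel_measurable borel"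
      by (rule borel_measurable_continuous_onI)
  qed
qed

lemma std_gauss_pair_fst:
  fixes g :: "'a::euclidean_space \<Rightarrow> 'b::{banach,second_countable_topology}"
  assumes [measurable]: "g \<in> borel_measurable borel"
  shows "(\<integral>p. g (fst p) \<partial>(std_gauss \<Otimes>\<^sub>M (std_gauss :: 'c::euclidean_space measure))) = (\<integral>x. g x \<partial>std_gauss)"
    and "integrable std_gauss g \<Longrightarrow> integrable (std_gauss \<Otimes>\<^sub>M (std_gauss :: 'c::euclidean_space measure)) (\<lambda>p. g (fst p))"
proof -
  have d: "distr (std_gauss \<Otimes>\<^sub>M (std_gauss :: 'c measure)) std_gauss fst = (std_gauss :: 'a measure)"
    by (rule std_gauss.distr_pair_fst)
  show "(\<integral>p. g (fst p) \<partial>(std_gauss \<Otimes>\<^sub>M (std_gauss :: 'c measure))) = (\<integral>x. g x \<partial>std_gauss)"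
    by (subst (2) d[symmetric], subst integral_distr) auto
  show "integrable (std_gauss \<Otimes>\<^sub>M (std_gauss :: 'c measure)) (\<lambda>p. g (fst p))" if "integrable std_gauss g"
    by (rule integrable_distr[of fst _ std_gauss]) (use that d in auto)
qed

lemma sum_mult_le_sqrt:
  fixes a b :: "'i \<Rightarrow> real"
  assumes "(\<Sum>i\<in>I. (a i)\<^sup>2) \<le> A\<^sup>2" "(\<Sum>i\<in>I. (b i)\<^sup>2) \<le> B\<^sup>2" "0 \<le> A" "0 \<le> B"
  shows "(\<Sum>i\<in>I. a i * b i) \<le> A * B"
proof -
  have "(\<Sum>i\<in>I. a i * b i)\<^sup>2 \<le> (\<Sum>i\<in>I. (a i)\<^sup>2) * (\<Sum>i\<in>I. (b i)\<^sup>2)"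
    by (rule Cauchy_Schwarz_ineq_sum)
  also have "\<dots> \<le> A\<^sup>2 * B\<^sup>2" using assms by (intro mult_mono) (auto intro: sum_nonneg)
  finally have "(\<Sum>i\<in>I. a i * b i)\<^sup>2 \<le> (A * B)\<^sup>2" by (simp add: power_mult_distrib)
  then show ?thesis by (rule power2_le_imp_le[OF _ mult_nonneg_nonneg[OF assms(3,4)]])
qed

text \<open>
  The path \<open>\<theta> \<mapsto> sin \<theta> x + cos \<theta> y\<close> joins an independent copy \<open>y\<close> to \<open>x\<close>; its velocity is
  independent of its position, so Stein's identity in the velocity variable turns
  the moment of order \<open>2m + 2\<close> into products of first derivatives only.
\<close>

lemma std_gauss_moment_step:
  fixes f :: "'a::euclidean_space \<Rightarrow> complex"
  assumes der: "\<And>x. (f has_derivative f' x) (at x)"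
    and C: "\<And>x. norm (f x) \<le> C"
    and L: "0 \<le> L" "\<And>x. (\<Sum>b\<in>Basis. (norm (f' x b))\<^sup>2) \<le> L\<^sup>2"
    and mean: "(\<integral>x. f x \<partial>std_gauss) = 0"
  shows "(\<integral>x. norm (f x) ^ (2 * m + 2) \<partial>std_gauss)
    \<le> (2 * real m + 1) * L\<^sup>2 * (\<integral>x. norm (f x) ^ (2 * m) \<partial>std_gauss)"
proof -
  \<comment> \<open>Chosen so that \<open>f x * h x\<close> is
    \<open>norm (f x) ^ (2 * m + 2)\<close>, the integrand of the moment to be bounded.\<close>
  define h where "h x = cnj (f x) ^ (m + 1) * f x ^ m" for x
  \<comment> \<open>At \<open>m = 0\<close> the truncated exponent \<open>m - 1\<close> is harmless
    because its factor \<open>of_nat m\<close> vanishes.\<close>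
  define h' where "h' x v = of_nat (m + 1) * cnj (f x) ^ m * cnj (f' x v) * f x ^ m
      + cnj (f x) ^ (m + 1) * (of_nat m * f x ^ (m - 1) * f' x v)" for x v
  have C0: "0 \<le> C" using C[of 0] norm_ge_zero order_trans by blast
  note lin = has_derivative_linear[OF der]
  have fm [measurable]: "f \<in> borel_measurable borel" "(\<lambda>x. f' x v) \<in> borel_measurable borel" for v
    using borel_measurable_has_derivative[OF der] by auto
  have cnj_m [measurable]: "cnj \<in> borel_measurable borel"
    by (intro borel_measurable_continuous_onI continuous_intros)
  have hm [measurable]: "h \<in> borel_measurable borel" unfolding h_def by measurable
  have hder: "(h has_derivative h' x) (at x)" for x
    unfolding h_def[abs_def]
    by (rule has_derivative_eq_rhs, (rule derivative_intros der)+)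
      (auto simp: h'_def fun_eq_iff algebra_simps)
  have normh: "norm (h x) = norm (f x) ^ (2 * m + 1)" for x
    by (simp add: h_def norm_mult norm_power power_add[symmetric] mult_2)
  have hC: "norm (h x) \<le> C ^ (2 * m + 1)" for x
    unfolding normh by (intro power_mono C) auto
  \<comment> \<open>The product rule meets \<open>m + 1\<close> conjugated and \<open>m\<close>
    plain factors, which makes \<open>2 * m + 1\<close>.\<close>
  have h'b: "norm (h' x v) \<le> (2 * real m + 1) * norm (f x) ^ (2 * m) * norm (f' x v)" for x v
  proof -
    have "norm (h' x v) \<le> norm (of_nat (m + 1) * cnj (f x) ^ m * cnj (f' x v) * f x ^ m)
        + norm (cnj (f x) ^ (m + 1) * (of_nat m * f x ^ (m - 1) * f' x v))"
      unfolding h'_def by (rule norm_triangle_ineq)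
    also have "\<dots> = (2 * real m + 1) * norm (f x) ^ (2 * m) * norm (f' x v)"
    proof -
      have 1: "norm (of_nat (m + 1) :: complex) = real m + 1"
        by (subst norm_of_nat) simp
      have 2: "norm (f x) ^ m * norm (f x) ^ m = norm (f x) ^ (2 * m)"
        by (simp add: mult_2 power_add)
      have 3: "norm (f x) ^ (m + 1) * (real m * norm (f x) ^ (m - 1)) = real m * norm (f x) ^ (2 * m)"
        by (cases m) (simp_all add: mult_2 power_add)
      have "norm (of_nat (m + 1) * cnj (f x) ^ m * cnj (f' x v) * f x ^ m)
        = (real m + 1) * (norm (f x) ^ m * norm (f x) ^ m) * norm (f' x v)"
        by (simp only: norm_mult norm_power complex_mod_cnj 1 mult_ac)
      moreover have "norm (cnj (f x) ^ (m + 1) * (of_nat m * f x ^ (m - 1) * f' x v))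
        = norm (f x) ^ (m + 1) * (real m * norm (f x) ^ (m - 1)) * norm (f' x v)"
        by (simp only: norm_mult norm_power complex_mod_cnj norm_of_nat mult.assoc)
      ultimately show ?thesis
        unfolding 2 3 by (simp add: algebra_simps)
    qed
    finally show ?thesis .
  qed
  have f'L: "norm (f' x v) \<le> L * norm v" for x v
  proof -
    have "f' x v = f' x (\<Sum>b\<in>Basis. (v \<bullet> b) *\<^sub>R b)"
      by (simp only: euclidean_representation)
    also have "\<dots> = (\<Sum>b\<in>Basis. (v \<bullet> b) *\<^sub>R f' x b)"
      by (simp only: linear_sum[OF lin] linear_scale[OF lin])
    also have "norm \<dots> \<le> (\<Sum>b\<in>Basis. \<bar>v \<bullet> b\<bar> * norm (f' x b))"
      by (rule order_trans[OF norm_sum]) simp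
    also have "\<dots> \<le> norm v * L"
      using L by (intro sum_mult_le_sqrt)
       (auto simp: power2_norm_eq_inner euclidean_inner[of v v] power2_eq_square[symmetric])
    finally show ?thesis by (simp add: mult.commute)
  qed
  have f'bL: "norm (f' x b) \<le> L" if "b \<in> Basis" for x b
    using f'L[of x b] that by simp
  define K where "K = (2 * real m + 1) * L\<^sup>2 * (\<integral>x. norm (f x) ^ (2 * m) \<partial>std_gauss)"
  let ?P = "(std_gauss :: 'a measure) \<Otimes>\<^sub>M (std_gauss :: 'a measure)"
  \<comment> \<open>At \<open>pi / 2\<close> this is the mean of \<open>f * h\<close>, the wanted
    moment; at 0 it factorises by independence and vanishes because \<open>f\<close> is
    centred.\<close>
  define \<Phi> where "\<Phi> \<theta> = (\<integral>p. f (sin \<theta> *\<^sub>R fst p + cos \<theta> *\<^sub>R snd p) * h (fst p) \<partial>?P)" for \<theta>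
  define D where "D \<theta> p = f' (sin \<theta> *\<^sub>R fst p + cos \<theta> *\<^sub>R snd p) (cos \<theta> *\<^sub>R fst p - sin \<theta> *\<^sub>R snd p) * h (fst p)"
    for \<theta> :: real and p :: "'a \<times> 'a"
  have intN: "integrable ?P (\<lambda>p. norm (fst p))" "integrable ?P (\<lambda>p. norm (snd p))"
  proof -
    show "integrable ?P (\<lambda>p. norm (fst p))"
      by (rule std_gauss_pair_fst(2)) (auto intro: integrable_std_gauss_norm)
    then have "integrable ?P (\<lambda>(x, y). norm (fst (y, x)))"
      by (rule std_gauss_pair.integrable_product_swap)
    then show "integrable ?P (\<lambda>p. norm (snd p))" by (simp add: split_beta')
  qed
  have \<Phi>der: "(\<Phi> has_vector_derivative (\<integral>p. D \<theta> p \<partial>?P)) (at \<theta>)" for \<theta>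
    unfolding \<Phi>_def
  proof (rule has_vector_derivative_integral(1)[where r = 1
        and K = "\<lambda>p. L * (norm (fst p) + norm (snd p)) * C ^ (2 * m + 1)"])
    fix t :: real and p :: "'a \<times> 'a"
    let ?z = "\<lambda>t. sin t *\<^sub>R fst p + cos t *\<^sub>R snd p"
    have "((\<lambda>t. f (?z t)) has_derivative (\<lambda>s. f' (?z t) (s *\<^sub>R (cos t *\<^sub>R fst p - sin t *\<^sub>R snd p)))) (at t)"
      by (rule has_derivative_compose[OF _ der, of ?z])
        (auto intro!: derivative_eq_intros simp: algebra_simps)
    then have "((\<lambda>t. f (?z t)) has_vector_derivative f' (?z t) (cos t *\<^sub>R fst p - sin t *\<^sub>R snd p)) (at t)"
      unfolding has_vector_derivative_def by (simp add: linear_scale[OF lin])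
    then show "((\<lambda>t. f (?z t) * h (fst p)) has_vector_derivative D t p) (at t)"
      unfolding D_def by (rule has_vector_derivative_mult_left)
    have "norm (cos t *\<^sub>R fst p - sin t *\<^sub>R snd p) \<le> norm (cos t *\<^sub>R fst p) + norm (sin t *\<^sub>R snd p)"
      by (rule norm_triangle_ineq4)
    also have "\<dots> \<le> 1 * norm (fst p) + 1 * norm (snd p)"
      unfolding norm_scaleR by (intro add_mono mult_right_mono) auto
    finally show "norm (D t p) \<le> L * (norm (fst p) + norm (snd p)) * C ^ (2 * m + 1)"
      unfolding D_def norm_mult using L(1) C0
      by (intro mult_mono hC order_trans[OF f'L] mult_left_mono) auto
  next
    show "integrable ?P (\<lambda>p. L * (norm (fst p) + norm (snd p)) * C ^ (2 * m + 1))"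
      using intN by auto
    show "integrable ?P (\<lambda>p. f (sin t *\<^sub>R fst p + cos t *\<^sub>R snd p) * h (fst p))" for t
      using C hC C0
      by (intro std_gauss_pair.P.integrable_const_bound[where B = "C * C ^ (2 * m + 1)"])
        (auto simp: norm_mult intro!: mult_mono AE_I2)
  qed simp
  \<comment> \<open>On the open interval \<open>cos \<theta>\<close> is nonzero, as the rotation
    formula demands, and positive, which settles the signs.\<close>
  have Dbound: "norm (\<integral>p. D \<theta> p \<partial>?P) \<le> cos \<theta> * K" if \<theta>: "0 < \<theta>" "\<theta> < pi / 2" for \<theta>
  proof -
    have cos: "0 < cos \<theta>" using \<theta> by (intro cos_gt_zero) auto
    \<comment> \<open>In the rotated coordinates \<open>p\<close> consists of the position and minus
      the velocity of the path; \<open>w\<close> recovers the original first variable from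
      them.\<close>
    define w where "w p = sin \<theta> *\<^sub>R fst p - cos \<theta> *\<^sub>R snd p" for p :: "'a \<times> 'a"
    define \<Psi> where "\<Psi> p = f' (fst p) (- snd p) * h (w p)" for p :: "'a \<times> 'a"
    have \<Psi>_sum: "\<Psi> p = - (\<Sum>b\<in>Basis. f' (fst p) b * ((snd p \<bullet> b) *\<^sub>R h (w p)))" for p
    proof -
      have "f' (fst p) (snd p) = f' (fst p) (\<Sum>b\<in>Basis. (snd p \<bullet> b) *\<^sub>R b)"
        by (simp only: euclidean_representation)
      also have "\<dots> = (\<Sum>b\<in>Basis. (snd p \<bullet> b) *\<^sub>R f' (fst p) b)"
        by (simp only: linear_sum[OF lin] linear_scale[OF lin])
      finally show ?thesis
        by (simp add: \<Psi>_def linear_neg[OF lin] sum_distrib_right)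
    qed
    have wm [measurable]: "w \<in> borel_measurable (borel \<Otimes>\<^sub>M borel)"
      unfolding w_def[abs_def] by measurable
    have \<Psi>m [measurable]: "\<Psi> \<in> borel_measurable (borel \<Otimes>\<^sub>M borel)"
      unfolding \<Psi>_sum[abs_def] by measurable
    have int\<Psi>: "integrable ?P \<Psi>"
    proof (rule Bochner_Integration.integrable_bound)
      show "integrable ?P (\<lambda>p. L * norm (snd p) * C ^ (2 * m + 1))" using intN by auto
      have "norm (\<Psi> p) \<le> L * norm (snd p) * C ^ (2 * m + 1)" for p
        unfolding \<Psi>_def norm_mult using L(1) C0 f'L[of "fst p" "- snd p"]
        by (intro mult_mono hC) auto
      then show "AE p in ?P. norm (\<Psi> p) \<le> norm (L * norm (snd p) * C ^ (2 * m + 1))"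
        using L(1) C0 by (intro AE_I2) (simp add: abs_mult)
    qed simp
    have rot: "D \<theta> p = \<Psi> (sin \<theta> *\<^sub>R fst p + cos \<theta> *\<^sub>R snd p, - cos \<theta> *\<^sub>R fst p + sin \<theta> *\<^sub>R snd p)" for p
    proof -
      have "b *\<^sub>R (b *\<^sub>R x + c *\<^sub>R y) - c *\<^sub>R (- c *\<^sub>R x + b *\<^sub>R y) = (b * b + c * c) *\<^sub>R x"
        for b c :: real and x y :: 'a
        by (simp add: algebra_simps)
      moreover have "sin \<theta> * sin \<theta> + cos \<theta> * cos \<theta> = 1"
        by (simp only: power2_eq_square[symmetric] sin_cos_squared_add)
      ultimately have "w (sin \<theta> *\<^sub>R fst p + cos \<theta> *\<^sub>R snd p, - cos \<theta> *\<^sub>R fst p + sin \<theta> *\<^sub>R snd p) = fst p"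
        by (simp only: w_def fst_conv snd_conv scaleR_one)
      then show ?thesis by (simp add: D_def \<Psi>_def)
    qed
    \<comment> \<open>With the position fixed, \<open>y\<close> enters only through
      \<open>w\<close>, with coefficient \<open>- cos \<theta>\<close>; this is the source of the
      factor \<open>cos \<theta>\<close> in the bound.\<close>
    have stein: "(\<integral>y. (y \<bullet> b) *\<^sub>R h (w (x, y)) \<partial>std_gauss) = (\<integral>y. - cos \<theta> *\<^sub>R h' (w (x, y)) b \<partial>std_gauss)"
      and h'int: "integrable std_gauss (\<lambda>y. h' (w (x, y)) b)"
      and hint: "integrable std_gauss (\<lambda>y. (y \<bullet> b) *\<^sub>R h (w (x, y)))"
      if b: "b \<in> Basis" for x b
    proof -
      have bd: "norm (h' z b) \<le> (2 * real m + 1) * C ^ (2 * m) * L" for z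
        by (rule order_trans[OF h'b]) (auto intro!: mult_mono power_mono C f'bL b L C0)
      show "(\<integral>y. (y \<bullet> b) *\<^sub>R h (w (x, y)) \<partial>std_gauss) = (\<integral>y. - cos \<theta> *\<^sub>R h' (w (x, y)) b \<partial>std_gauss)"
      proof (rule std_gauss_stein[OF b, where h' = "\<lambda>y v. - cos \<theta> *\<^sub>R h' (w (x, y)) v"])
        fix y
        have "((\<lambda>y. h (w (x, y))) has_derivative (\<lambda>v. h' (w (x, y)) (- cos \<theta> *\<^sub>R v))) (at y)"
          unfolding w_def by (rule has_derivative_compose[OF _ hder]) (auto intro!: derivative_eq_intros)
        then show "((\<lambda>y. h (w (x, y))) has_derivative (\<lambda>v. - cos \<theta> *\<^sub>R h' (w (x, y)) v)) (at y)"
          by (simp add: linear_scale[OF has_derivative_linear[OF hder]] linear_neg[OF has_derivative_linear[OF hder]])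
        show "norm (- cos \<theta> *\<^sub>R h' (w (x, y)) b) \<le> 1 * ((2 * real m + 1) * C ^ (2 * m) * L)"
          unfolding norm_scaleR by (intro mult_mono bd) auto
      qed (rule hC)
      show "integrable std_gauss (\<lambda>y. h' (w (x, y)) b)"
      proof (rule std_gauss.integrable_const_bound[OF AE_I2[OF bd]])
        show "(\<lambda>y. h' (w (x, y)) b) \<in> borel_measurable std_gauss"
          unfolding h'_def by measurable
      qed
      show "integrable std_gauss (\<lambda>y. (y \<bullet> b) *\<^sub>R h (w (x, y)))"
      proof (rule Bochner_Integration.integrable_bound)
        show "integrable std_gauss (\<lambda>y. \<bar>y \<bullet> b\<bar> * C ^ (2 * m + 1))"
          by (intro integrable_mult_left integrable_std_gauss_inner b)
      qed (auto intro!: mult_left_mono hC order_trans[OF hC] simp: abs_mult C0)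
    qed
    \<comment> \<open>Cauchy--Schwarz for gradients at two different points, which works because
      \<open>L\<close> is uniform.\<close>
    have bnd1: "(\<Sum>b\<in>Basis. norm (f' x b) * norm (h' z b)) \<le> (2 * real m + 1) * L\<^sup>2 * norm (f z) ^ (2 * m)" for x z
    proof -
      have "(\<Sum>b\<in>Basis. norm (f' x b) * norm (h' z b))
          \<le> (\<Sum>b\<in>Basis. norm (f' x b) * ((2 * real m + 1) * norm (f z) ^ (2 * m) * norm (f' z b)))"
        by (intro sum_mono mult_left_mono h'b) auto
      also have "\<dots> = (2 * real m + 1) * norm (f z) ^ (2 * m) * (\<Sum>b\<in>Basis. norm (f' x b) * norm (f' z b))"
        unfolding sum_distrib_left by (intro sum.cong refl) (simp only: mult_ac)
      also have "\<dots> \<le> (2 * real m + 1) * norm (f z) ^ (2 * m) * (L * L)"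
        using L by (intro mult_left_mono sum_mult_le_sqrt) auto
      finally show ?thesis by (simp add: power2_eq_square algebra_simps)
    qed
    have fz_int: "integrable ?P (\<lambda>p. norm (f (w p)) ^ (2 * m))"
      by (rule std_gauss_pair.P.integrable_const_bound[where B = "C ^ (2 * m)"])
        (auto intro!: power_mono C)
    have "(\<integral>p. D \<theta> p \<partial>?P) = (\<integral>p. \<Psi> p \<partial>?P)"
      unfolding rot using cos \<Psi>m by (intro std_gauss_rotation) auto
    also have "\<dots> = (\<integral>x. \<integral>y. \<Psi> (x, y) \<partial>std_gauss \<partial>std_gauss)"
      using std_gauss_pair.integral_fst'[OF int\<Psi>] by simp
    also have "\<dots> = (\<integral>x. \<integral>y. cos \<theta> *\<^sub>R (\<Sum>b\<in>Basis. f' x b * h' (w (x, y)) b) \<partial>std_gauss \<partial>std_gauss)"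
    proof (rule Bochner_Integration.integral_cong[OF refl])
      fix x
      have "(\<integral>y. \<Psi> (x, y) \<partial>std_gauss) = - (\<integral>y. (\<Sum>b\<in>Basis. f' x b * ((y \<bullet> b) *\<^sub>R h (w (x, y)))) \<partial>std_gauss)"
        by (simp only: \<Psi>_sum fst_conv snd_conv Bochner_Integration.integral_minus)
      also have "(\<integral>y. (\<Sum>b\<in>Basis. f' x b * ((y \<bullet> b) *\<^sub>R h (w (x, y)))) \<partial>std_gauss)
          = (\<Sum>b\<in>Basis. \<integral>y. f' x b * ((y \<bullet> b) *\<^sub>R h (w (x, y))) \<partial>std_gauss)"
        by (rule Bochner_Integration.integral_sum) (intro integrable_mult_right hint)
      also have "\<dots> = (\<Sum>b\<in>Basis. - (\<integral>y. cos \<theta> *\<^sub>R (f' x b * h' (w (x, y)) b) \<partial>std_gauss))"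
      proof (intro sum.cong refl)
        fix b :: 'a assume b: "b \<in> Basis"
        have "(\<integral>y. f' x b * ((y \<bullet> b) *\<^sub>R h (w (x, y))) \<partial>std_gauss)
            = f' x b * (\<integral>y. (y \<bullet> b) *\<^sub>R h (w (x, y)) \<partial>std_gauss)"
          by (rule integral_mult_right_zero)
        also have "\<dots> = - (cos \<theta> *\<^sub>R (f' x b * (\<integral>y. h' (w (x, y)) b \<partial>std_gauss)))"
          unfolding stein[OF b] by simp
        also have "\<dots> = - (\<integral>y. cos \<theta> *\<^sub>R (f' x b * h' (w (x, y)) b) \<partial>std_gauss)"
          by simp
        finally show "(\<integral>y. f' x b * ((y \<bullet> b) *\<^sub>R h (w (x, y))) \<partial>std_gauss)
            = - (\<integral>y. cos \<theta> *\<^sub>R (f' x b * h' (w (x, y)) b) \<partial>std_gauss)" .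
      qed
      also have "- \<dots> = (\<Sum>b\<in>Basis. \<integral>y. cos \<theta> *\<^sub>R (f' x b * h' (w (x, y)) b) \<partial>std_gauss)"
        by (simp only: sum_negf minus_minus)
      also have "\<dots> = (\<integral>y. (\<Sum>b\<in>Basis. cos \<theta> *\<^sub>R (f' x b * h' (w (x, y)) b)) \<partial>std_gauss)"
        by (rule Bochner_Integration.integral_sum[symmetric])
          (intro integrable_scaleR_right integrable_mult_right h'int)
      also have "\<dots> = (\<integral>y. cos \<theta> *\<^sub>R (\<Sum>b\<in>Basis. f' x b * h' (w (x, y)) b) \<partial>std_gauss)"
        by (simp only: scaleR_sum_right)
      finally show "(\<integral>y. \<Psi> (x, y) \<partial>std_gauss) = (\<integral>y. cos \<theta> *\<^sub>R (\<Sum>b\<in>Basis. f' x b * h' (w (x, y)) b) \<partial>std_gauss)" .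
    qed
    also have "norm \<dots> \<le> (\<integral>x. \<integral>y. cos \<theta> * ((2 * real m + 1) * L\<^sup>2 * norm (f (w (x, y))) ^ (2 * m)) \<partial>std_gauss \<partial>std_gauss)"
    proof (rule order_trans[OF integral_norm_bound], rule integral_mono')
      let ?g = "\<lambda>p. cos \<theta> * ((2 * real m + 1) * L\<^sup>2 * norm (f (w p)) ^ (2 * m))"
      have "integrable ?P ?g" using fz_int by auto
      from std_gauss_pair.integrable_fst'[OF this]
      show "integrable std_gauss (\<lambda>x. \<integral>y. ?g (x, y) \<partial>std_gauss)" .
      fix x
      show "0 \<le> (\<integral>y. ?g (x, y) \<partial>std_gauss)"
        using cos by (intro integral_nonneg_AE AE_I2) auto
      show "norm (\<integral>y. cos \<theta> *\<^sub>R (\<Sum>b\<in>Basis. f' x b * h' (w (x, y)) b) \<partial>std_gauss) \<le> (\<integral>y. ?g (x, y) \<partial>std_gauss)"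
      proof (rule order_trans[OF integral_norm_bound], rule integral_mono')
        show "integrable std_gauss (\<lambda>y. ?g (x, y))"
          by (rule std_gauss.integrable_const_bound[where B = "cos \<theta> * ((2 * real m + 1) * L\<^sup>2 * C ^ (2 * m))"])
            (use cos in \<open>auto intro!: mult_left_mono power_mono C\<close>)
        fix y
        show "0 \<le> ?g (x, y)" using cos by auto
        have "norm (cos \<theta> *\<^sub>R (\<Sum>b\<in>Basis. f' x b * h' (w (x, y)) b))
            \<le> cos \<theta> * (\<Sum>b\<in>Basis. norm (f' x b) * norm (h' (w (x, y)) b))"
          using cos by (auto intro!: mult_left_mono order_trans[OF norm_sum] simp: norm_mult)
        also have "\<dots> \<le> ?g (x, y)" using cos by (intro mult_left_mono bnd1) auto
        finally show "norm (cos \<theta> *\<^sub>R (\<Sum>b\<in>Basis. f' x b * h' (w (x, y)) b)) \<le> ?g (x, y)" .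
      qed
    qed
    also have "\<dots> = cos \<theta> * (2 * real m + 1) * L\<^sup>2 * (\<integral>p. norm (f (w p)) ^ (2 * m) \<partial>?P)"
      using std_gauss_pair.integral_fst'[OF fz_int] by (simp add: mult.assoc)
    \<comment> \<open>\<open>w\<close> is the first component of another rotation, so it is again
      standard Gaussian.\<close>
    also have "(\<integral>p. norm (f (w p)) ^ (2 * m) \<partial>?P) = (\<integral>p. norm (f (fst p)) ^ (2 * m) \<partial>?P)"
      using std_gauss_rotation[of "sin \<theta>" "- cos \<theta>" "\<lambda>p. norm (f (fst p)) ^ (2 * m)"] cos
      by (simp add: w_def)
    also have "\<dots> = (\<integral>x. norm (f x) ^ (2 * m) \<partial>std_gauss)"
      by (rule std_gauss_pair_fst) simp
    finally show ?thesis by (simp add: K_def mult.assoc)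
  qed
  \<comment> \<open>Comparison with \<open>K * sin \<theta>\<close>: the integral of the cosine over
    the quarter circle is 1, so no constant is lost.\<close>
  have "norm (\<Phi> (pi / 2) - \<Phi> 0) \<le> K * sin (pi / 2) - K * sin 0"
  proof (rule differentiable_bound_general[where f' = "\<lambda>\<theta>. \<integral>p. D \<theta> p \<partial>?P" and \<phi> = "\<lambda>\<theta>. K * sin \<theta>" and \<phi>' = "\<lambda>\<theta>. cos \<theta> * K"])
    show "continuous_on {0..pi / 2} \<Phi>"
      using \<Phi>der by (meson continuous_on_vector_derivative has_vector_derivative_at_within)
    show "((\<lambda>\<theta>. K * sin \<theta>) has_vector_derivative cos \<theta> * K) (at \<theta>)" for \<theta>
      unfolding has_real_derivative_iff_has_vector_derivative[symmetric]
      by (auto intro!: derivative_eq_intros)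
  qed (auto intro!: continuous_intros \<Phi>der Dbound)
  moreover have "\<Phi> 0 = 0"
  proof -
    have "integrable ?P (\<lambda>(x, y). f y * h x)"
      using C hC C0
      by (intro std_gauss_pair.P.integrable_const_bound[where B = "C * C ^ (2 * m + 1)"])
        (auto simp: norm_mult split_beta intro!: mult_mono AE_I2)
    from std_gauss_pair.integral_fst[OF this]
    have "\<Phi> 0 = (\<integral>x. \<integral>y. f y * h x \<partial>std_gauss \<partial>std_gauss)"
      by (simp add: \<Phi>_def split_beta')
    then show ?thesis by (simp add: mean)
  qed
  moreover have "\<Phi> (pi / 2) = complex_of_real (\<integral>x. norm (f x) ^ (2 * m + 2) \<partial>std_gauss)"
  proof -
    have eq: "f x * h x = complex_of_real (norm (f x) ^ (2 * m + 2))" for x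
    proof -
      have "f x * h x = (f x * cnj (f x)) ^ (m + 1)"
        by (simp add: h_def power_mult_distrib algebra_simps)
      also have "\<dots> = complex_of_real (((norm (f x))\<^sup>2) ^ (m + 1))"
        by (simp only: complex_norm_square[symmetric] of_real_power)
      also have "((norm (f x))\<^sup>2) ^ (m + 1) = norm (f x) ^ (2 * m + 2)"
        unfolding power_mult[symmetric] by simp
      finally show ?thesis .
    qed
    have "\<Phi> (pi / 2) = (\<integral>p. f (fst p) * h (fst p) \<partial>?P)" by (simp add: \<Phi>_def)
    also have "\<dots> = (\<integral>x. f x * h x \<partial>std_gauss)"
      by (rule std_gauss_pair_fst) simp
    finally show ?thesis by (simp only: eq integral_complex_of_real)
  qed
  ultimately have "\<bar>\<integral>x. norm (f x) ^ (2 * m + 2) \<partial>std_gauss\<bar> \<le> K"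
    by (simp only: diff_zero norm_of_real sin_pi_half sin_zero mult_1_right mult_zero_right)
  then show ?thesis unfolding K_def by linarith
qed

text \<open>Iterating the recursion from the zeroth moment produces the product of the odd numbers
  below \<open>2 * m\<close> times \<open>L ^ (2 * m)\<close>, the exact moment of a real Gaussian
  of variance \<open>L\<^sup>2\<close>.\<close>

lemma std_gauss_moments:
  fixes f :: "'a::euclidean_space \<Rightarrow> complex"
  assumes der: "\<And>x. (f has_derivative f' x) (at x)"
    and C: "\<And>x. norm (f x) \<le> C"
    and L: "0 \<le> L" "\<And>x. (\<Sum>b\<in>Basis. (norm (f' x b))\<^sup>2) \<le> L\<^sup>2"
    and mean: "(\<integral>x. f x \<partial>std_gauss) = 0"
  shows "(\<integral>x. norm (f x) ^ (2 * m) \<partial>std_gauss) \<le> fact (2 * m) * (L\<^sup>2 / 2) ^ m / fact m"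
proof (induction m)
  case 0
  then show ?case by (simp add: lebesgue_integral_const)
next
  case (Suc m)
  have "(\<integral>x. norm (f x) ^ (2 * Suc m) \<partial>std_gauss)
      \<le> (2 * real m + 1) * L\<^sup>2 * (\<integral>x. norm (f x) ^ (2 * m) \<partial>std_gauss)"
    using std_gauss_moment_step[OF assms] by simp
  also have "\<dots> \<le> (2 * real m + 1) * L\<^sup>2 * (fact (2 * m) * (L\<^sup>2 / 2) ^ m / fact m)"
    by (intro mult_left_mono Suc.IH) auto
  also have "\<dots> = fact (2 * Suc m) * (L\<^sup>2 / 2) ^ Suc m / fact (Suc m)"
  proof -
    have "(fact (2 * Suc m) :: real) = (2 * real m + 2) * (2 * real m + 1) * fact (2 * m)"
      by (simp add: algebra_simps)
    moreover have "(fact (Suc m) :: real) = (real m + 1) * fact m" by (simp add: algebra_simps)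
    moreover have "real m + 1 \<noteq> 0" by linarith
    ultimately show ?thesis by (simp add: divide_simps)
  qed
  finally show ?case .
qed

lemma std_gauss_concentration:
  fixes f :: "'a::euclidean_space \<Rightarrow> complex"
  assumes der: "\<And>x. (f has_derivative f' x) (at x)"
    and C: "\<And>x. norm (f x) \<le> C"
    and L: "0 < L" "\<And>x. (\<Sum>b\<in>Basis. (norm (f' x b))\<^sup>2) \<le> L\<^sup>2"
  shows "(\<integral>x. (norm (f x - (\<integral>y. f y \<partial>std_gauss)))\<^sup>2 \<partial>std_gauss) \<le> L\<^sup>2" (is ?A)
    and "0 \<le> s \<Longrightarrow> measure std_gauss {x. norm (f x - (\<integral>y. f y \<partial>std_gauss)) \<ge> s}
      \<le> 2 * exp (- s\<^sup>2 / (2 * L\<^sup>2))" (is "_ \<Longrightarrow> ?B")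
proof -
  have [measurable]: "f \<in> borel_measurable borel"
    using borel_measurable_has_derivative[OF der] by auto
  have intf: "integrable std_gauss f"
    by (rule std_gauss.integrable_const_bound[where B = C]) (use C in auto)
  define F where "F x = f x - (\<integral>y. f y \<partial>std_gauss)" for x
  have [measurable]: "F \<in> borel_measurable borel" unfolding F_def by measurable
  have derF: "(F has_derivative f' x) (at x)" for x
    using has_derivative_diff[OF der has_derivative_const] by (simp add: F_def[abs_def])
  define CF where "CF = C + norm (\<integral>y. f y \<partial>std_gauss)"
  have CF: "norm (F x) \<le> CF" for x
    unfolding F_def CF_def by (rule order_trans[OF norm_triangle_ineq4 add_right_mono[OF C]])
  have meanF: "(\<integral>x. F x \<partial>std_gauss) = 0"
    unfolding F_def using intf by (simp add: Bochner_Integration.integral_diff lebesgue_integral_const)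
  note mom = std_gauss_moments[OF derF CF less_imp_le[OF L(1)] L(2) meanF]
  \<comment> \<open>The second moment is the Gaussian Poincare inequality.\<close>
  show ?A using mom[of 1] unfolding F_def by simp
  show ?B if s: "0 \<le> s"
  proof -
    \<comment> \<open>The minimiser of \<open>a\<^sup>2 * L\<^sup>2 / 2 - a * s\<close>, the
      exponent in the Chernoff bound.\<close>
    define a where "a = s / L\<^sup>2"
    have a: "0 \<le> a" using s by (simp add: a_def)
    \<comment> \<open>The hyperbolic cosine has only even powers, so even moments of the modulus
      suffice.\<close>
    have cosh_sums: "(\<lambda>m. (a * r) ^ (2 * m) / fact (2 * m)) sums cosh (a * r)" for r :: real
      using cosh_converges[of "a * r"]
      by (subst (asm) sums_mono_reindex[of "\<lambda>m. 2 * m", symmetric])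
        (auto simp: strict_mono_def divide_inverse mult.commute image_iff elim!: evenE)
    define g where "g m x = (a * norm (F x)) ^ (2 * m) / fact (2 * m)" for m x
    have gint: "integrable std_gauss (g m)" for m
      unfolding g_def using a
      by (intro std_gauss.integrable_const_bound[where B = "(a * CF) ^ (2 * m) / fact (2 * m)"])
        (auto intro!: AE_I2 divide_right_mono power_mono mult_left_mono CF simp: abs_mult power_abs)
    have gval: "(\<integral>x. g m x \<partial>std_gauss) \<le> (a\<^sup>2 * L\<^sup>2 / 2) ^ m / fact m" for m
    proof -
      have "(\<integral>x. g m x \<partial>std_gauss) = a ^ (2 * m) / fact (2 * m) * (\<integral>x. norm (F x) ^ (2 * m) \<partial>std_gauss)"
        by (simp add: g_def power_mult_distrib)
      also have "\<dots> \<le> a ^ (2 * m) / fact (2 * m) * (fact (2 * m) * (L\<^sup>2 / 2) ^ m / fact m)"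
        using a by (intro mult_left_mono mom) auto
      also have "\<dots> = (a\<^sup>2 * L\<^sup>2 / 2) ^ m / fact m"
        by (simp add: power_mult power_mult_distrib power_divide)
      finally show ?thesis .
    qed
    have gnn: "0 \<le> g m x" for m x using a by (simp add: g_def)
    have "(\<lambda>m. t ^ m / fact m) sums exp t" for t :: real
      using exp_converges[of t] by (simp add: divide_inverse mult.commute)
    note exp_sums = this[of "a\<^sup>2 * L\<^sup>2 / 2"]
    have gsum: "summable (\<lambda>m. \<integral>x. g m x \<partial>std_gauss)"
      using gval gnn by (intro summable_comparison_test_ev[OF _ sums_summable[OF exp_sums]] always_eventually allI)
        (auto simp: integral_nonneg_AE)
    have cosh_eq: "cosh (a * norm (F x)) = (\<Sum>m. g m x)" for x
      using cosh_sums[of "norm (F x)"] by (simp add: g_def sums_iff)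
    have gs: "summable (\<lambda>m. norm (g m x))" for x
      using cosh_sums[of "norm (F x)"] gnn by (simp add: g_def sums_iff)
    have gns: "summable (\<lambda>m. \<integral>x. norm (g m x) \<partial>std_gauss)"
      using gsum gnn by simp
    have "(\<integral>x. cosh (a * norm (F x)) \<partial>std_gauss) = (\<Sum>m. \<integral>x. g m x \<partial>std_gauss)"
      unfolding cosh_eq by (intro integral_suminf gint AE_I2 gs gns)
    also have "\<dots> \<le> (\<Sum>m. (a\<^sup>2 * L\<^sup>2 / 2) ^ m / fact m)"
      by (intro suminf_le gval gsum sums_summable[OF exp_sums])
    also have "\<dots> = exp (a\<^sup>2 * L\<^sup>2 / 2)" using exp_sums by (simp add: sums_iff)
    finally have E: "(\<integral>x. cosh (a * norm (F x)) \<partial>std_gauss) \<le> exp (a\<^sup>2 * L\<^sup>2 / 2)" .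
    have cosh_int: "integrable std_gauss (\<lambda>x. cosh (a * norm (F x)))"
      unfolding cosh_eq by (intro integrable_suminf gint AE_I2 gs gns)
    have "measure std_gauss {x. norm (F x) \<ge> s} \<le> measure std_gauss {x \<in> space std_gauss. cosh (a * norm (F x)) \<ge> cosh (a * s)}"
    proof (rule std_gauss.finite_measure_mono)
      show "{x. s \<le> norm (F x)} \<subseteq> {x \<in> space std_gauss. cosh (a * s) \<le> cosh (a * norm (F x))}"
        using a s by (auto intro!: cosh_real_nonneg_le_iff[THEN iffD2] mult_left_mono)
      show "{x \<in> space std_gauss. cosh (a * s) \<le> cosh (a * norm (F x))} \<in> sets std_gauss"
        using borel_measurable_integrable[OF cosh_int] by measurable
    qed
    also have "\<dots> \<le> (\<integral>x. cosh (a * norm (F x)) \<partial>std_gauss) / cosh (a * s)"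
      by (rule integral_Markov_inequality_measure[OF cosh_int sets.empty_sets]) (auto simp: cosh_real_pos less_imp_le)
    \<comment> \<open>Replacing the hyperbolic cosine by half an exponential is where the factor 2
      of the tail bound arises.\<close>
    also have "\<dots> \<le> exp (a\<^sup>2 * L\<^sup>2 / 2) / (exp (a * s) / 2)"
    proof (rule frac_le)
      show "exp (a * s) / 2 \<le> cosh (a * s)" by (simp add: cosh_field_def)
    qed (use E in auto)
    also have "\<dots> = 2 * exp (a\<^sup>2 * L\<^sup>2 / 2 - a * s)" by (simp add: exp_diff)
    also have "a\<^sup>2 * L\<^sup>2 / 2 - a * s = - s\<^sup>2 / (2 * L\<^sup>2)"
      using L(1) by (simp add: a_def power2_eq_square field_simps)
    finally show ?thesis unfolding F_def .
  qed
qed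

subsection \<open>Operator norm of complex matrices\<close>

text \<open>The sesquilinear product, conjugate linear on the left. The real inner product of the
  type is just its real part, whereas invertibility below is read off the imaginary part.\<close>

definition cdot :: "complex^'n \<Rightarrow> complex^'n \<Rightarrow> complex"
  where "cdot x y = (\<Sum>i\<in>UNIV. cnj (x $ i) * y $ i)"

lemma norm_vec_power2: "(norm (x :: 'a::real_normed_vector^'n))\<^sup>2 = (\<Sum>i\<in>UNIV. (norm (x $ i))\<^sup>2)"
  by (simp add: norm_vec_def L2_set_def sum_nonneg)

text \<open>For matrices, \<open>norm\<close> is thus the Hilbert--Schmidt norm, which measures
  gradients; \<open>op_norm\<close> measures resolvents.\<close>

lemma norm_mat_power2: "(norm (A :: 'a::real_normed_vector^'n^'m))\<^sup>2 = (\<Sum>i\<in>UNIV. \<Sum>j\<in>UNIV. (norm (A $ i $ j))\<^sup>2)"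
  by (simp add: norm_vec_power2)

lemma cdot_self: "cdot x x = complex_of_real ((norm x)\<^sup>2)"
  unfolding norm_vec_power2 cdot_def of_real_sum
  by (intro sum.cong refl) (simp only: complex_norm_square mult.commute)

lemma cdot_commute: "cdot y x = cnj (cdot x y)"
  by (simp add: cdot_def mult.commute)

lemma norm_cdot_le: "norm (cdot x y) \<le> norm x * norm y"
proof -
  have "norm (cdot x y) \<le> (\<Sum>i\<in>UNIV. norm (x $ i) * norm (y $ i))"
    unfolding cdot_def by (rule order_trans[OF norm_sum]) (simp add: norm_mult)
  also have "\<dots> \<le> norm x * norm y"
    by (intro sum_mult_le_sqrt) (simp_all add: norm_vec_power2)
  finally show ?thesis .
qed

lemma cdot_diff_right: "cdot x (y - z) = cdot x y - cdot x z"
  by (simp add: cdot_def algebra_simps sum_subtractf)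

lemma cdot_axis: "cdot (axis i 1) y = y $ i"
proof -
  have "cdot (axis i 1) y = (\<Sum>k\<in>UNIV. if k = i then y $ k else 0)"
    unfolding cdot_def by (intro sum.cong refl) (auto simp: axis_def)
  then show ?thesis by simp
qed

lemma mat_axis: "(A *v axis j 1) $ i = (A :: complex^'n^'m) $ i $ j"
proof -
  have "(A *v axis j 1) $ i = (\<Sum>k\<in>UNIV. if k = j then A $ i $ k else 0)"
    unfolding matrix_vector_mult_def vec_lambda_beta by (intro sum.cong refl) (auto simp: axis_def)
  then show ?thesis by simp
qed

lemma norm_axis_one: "norm (axis i (1 :: complex) :: complex^'n) = 1"
proof -
  have "(norm (axis i (1 :: complex) :: complex^'n))\<^sup>2 = (\<Sum>k\<in>UNIV. if k = i then 1 else 0)"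
    unfolding norm_vec_power2 by (intro sum.cong refl) (auto simp: axis_def)
  then show ?thesis by (simp add: power2_eq_1_iff)
qed

lemma cdot_adj: "cdot x (A *v y) = cdot (adj_mat A *v x) y"
proof -
  have "cdot x (A *v y) = (\<Sum>i\<in>UNIV. \<Sum>j\<in>UNIV. cnj (x $ i) * (A $ i $ j * y $ j))"
    by (simp add: cdot_def matrix_vector_mult_def sum_distrib_left)
  also have "\<dots> = (\<Sum>j\<in>UNIV. \<Sum>i\<in>UNIV. cnj (x $ i) * (A $ i $ j * y $ j))"
    by (rule sum.swap)
  also have "\<dots> = cdot (adj_mat A *v x) y"
    by (simp add: cdot_def matrix_vector_mult_def adj_mat_def sum_distrib_right sum_distrib_left mult_ac)
  finally show ?thesis .
qed

lemma adj_adj [simp]: "adj_mat (adj_mat A) = A"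
  by (simp add: adj_mat_def vec_eq_iff)

lemma adj_mul: "adj_mat (A ** B) = adj_mat B ** adj_mat A"
  by (simp add: adj_mat_def matrix_matrix_mult_def vec_eq_iff mult.commute)

lemma norm_adj [simp]: "norm (adj_mat A) = norm A"
proof -
  have "(norm (adj_mat A))\<^sup>2 = (norm A)\<^sup>2"
    unfolding norm_mat_power2 by (subst sum.swap) (simp add: adj_mat_def)
  then show ?thesis by simp
qed

lemma linear_mv: "linear (\<lambda>v. (A :: complex^'n^'m) *v v)"
  by (rule linearI) (simp_all add: matrix_vector_mult_def vec_eq_iff algebra_simps sum.distrib scaleR_sum_right)

lemma bounded_linear_mv: "bounded_linear (\<lambda>v. (A :: complex^'n^'m) *v v)"
  by (simp add: linear_linear linear_mv linear_conv_bounded_linear[symmetric])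

lemma op_norm_mv: "norm (A *v x) \<le> op_norm A * norm x"
  unfolding op_norm_def by (rule onorm[OF bounded_linear_mv])

lemma op_norm_nonneg: "0 \<le> op_norm A"
  unfolding op_norm_def by (rule onorm_pos_le[OF bounded_linear_mv])

lemma op_norm_leI: "(\<And>x. norm (A *v x) \<le> c * norm x) \<Longrightarrow> op_norm A \<le> c"
  unfolding op_norm_def by (rule onorm_le)

lemma op_norm_mul: "op_norm (A ** B) \<le> op_norm A * op_norm B"
proof (rule op_norm_leI)
  fix x
  have "norm (A ** B *v x) \<le> op_norm A * norm (B *v x)"
    by (simp only: matrix_vector_mul_assoc[symmetric] op_norm_mv)
  also have "\<dots> \<le> op_norm A * (op_norm B * norm x)"
    by (intro mult_left_mono op_norm_mv op_norm_nonneg)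
  finally show "norm (A ** B *v x) \<le> op_norm A * op_norm B * norm x" by (simp add: mult.assoc)
qed

lemma op_norm_add: "op_norm (A + B) \<le> op_norm A + op_norm B"
proof (rule op_norm_leI)
  fix x
  have "norm ((A + B) *v x) \<le> norm (A *v x) + norm (B *v x)"
    by (simp only: matrix_vector_mult_add_rdistrib norm_triangle_ineq)
  also have "\<dots> \<le> op_norm A * norm x + op_norm B * norm x"
    by (intro add_mono op_norm_mv)
  finally show "norm ((A + B) *v x) \<le> (op_norm A + op_norm B) * norm x"
    by (simp add: algebra_simps)
qed

lemma op_norm_adj: "op_norm (adj_mat A) \<le> op_norm A"
proof (rule op_norm_leI)
  fix x
  let ?y = "adj_mat A *v x"
  have "(norm ?y)\<^sup>2 = norm (cdot ?y ?y)" by (simp only: cdot_self norm_of_real) simp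
  also have "cdot ?y ?y = cdot x (A *v ?y)" by (rule cdot_adj[symmetric])
  also have "norm \<dots> \<le> norm x * (op_norm A * norm ?y)"
    by (rule order_trans[OF norm_cdot_le]) (intro mult_left_mono op_norm_mv norm_ge_zero)
  finally have "norm ?y * norm ?y \<le> (op_norm A * norm x) * norm ?y"
    by (simp add: power2_eq_square mult_ac)
  then show "norm ?y \<le> op_norm A * norm x"
    using op_norm_nonneg[of A] by (cases "norm ?y = 0") (auto simp: mult_le_cancel_right)
qed

lemma op_norm_le_norm: "op_norm A \<le> norm A"
proof (rule op_norm_leI)
  fix x
  have "norm ((A *v x) $ i) \<le> norm (A $ i) * norm x" for i
    using norm_cdot_le[of "\<chi> j. cnj (A $ i $ j)" x]
    by (simp add: cdot_def matrix_vector_mult_def norm_vec_def)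
  then have "(norm (A *v x))\<^sup>2 \<le> (\<Sum>i\<in>UNIV. (norm (A $ i) * norm x)\<^sup>2)"
    unfolding norm_vec_power2[of "A *v x"] by (intro sum_mono power_mono) auto
  also have "\<dots> = (norm A * norm x)\<^sup>2"
    by (simp add: power_mult_distrib sum_distrib_right norm_vec_power2[of A])
  finally show "norm (A *v x) \<le> norm A * norm x"
    by (rule power2_le_imp_le) auto
qed

lemma norm_mat_columns: "(norm (A :: complex^'n^'m))\<^sup>2 = (\<Sum>j\<in>UNIV. (norm (A *v axis j 1))\<^sup>2)"
  unfolding norm_mat_power2 by (subst sum.swap) (simp add: norm_vec_power2 mat_axis)

text \<open>The columns of the product are the images under \<open>A\<close> of the columns of
  \<open>B\<close>.\<close>

lemma norm_mul_left: "norm (A ** B) \<le> op_norm A * norm B"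
proof -
  have "(norm (A ** B))\<^sup>2 \<le> (\<Sum>j\<in>UNIV. (op_norm A * norm (B *v axis j 1))\<^sup>2)"
    unfolding norm_mat_columns[of "A ** B"] matrix_vector_mul_assoc[symmetric]
    by (intro sum_mono power_mono op_norm_mv) auto
  also have "\<dots> = (op_norm A * norm B)\<^sup>2"
    by (simp add: norm_mat_columns[of B] power_mult_distrib sum_distrib_left)
  finally show ?thesis
    by (rule power2_le_imp_le) (simp add: op_norm_nonneg)
qed

lemma norm_mul_right: "norm (A ** B) \<le> norm A * op_norm B"
proof -
  have "norm (A ** B) = norm (adj_mat B ** adj_mat A)"
    by (metis adj_mul norm_adj)
  also have "\<dots> \<le> op_norm (adj_mat B) * norm A"
    by (rule order_trans[OF norm_mul_left]) simp
  also have "\<dots> \<le> op_norm B * norm A" by (intro mult_right_mono op_norm_adj) auto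
  finally show ?thesis by (simp add: mult.commute)
qed

lemma norm_entry_le_op_norm: "norm (A $ i $ j) \<le> op_norm (A :: complex^'n^'m)"
proof -
  have "norm (A $ i $ j) \<le> norm (A *v axis j 1)"
    unfolding mat_axis[symmetric] by (rule Finite_Cartesian_Product.norm_nth_le)
  also have "\<dots> \<le> op_norm A" using op_norm_mv[of A "axis j 1"] by (simp add: norm_axis_one)
  finally show ?thesis .
qed

lemma diag_mat_mv: "(diag_mat v *v x) $ i = v $ i * x $ i"
proof -
  have "(diag_mat v *v x) $ i = (\<Sum>j\<in>UNIV. if j = i then v $ i * x $ i else 0)"
    unfolding matrix_vector_mult_def diag_mat_def vec_lambda_beta by (intro sum.cong refl) auto
  then show ?thesis by simp
qed

lemma op_norm_diag_mat:
  fixes v :: "complex^'n"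
  assumes "\<And>i. norm (v $ i) \<le> c"
  shows "op_norm (diag_mat v) \<le> c"
proof (rule op_norm_leI)
  fix x
  have "0 \<le> c" using assms norm_ge_zero order_trans by blast
  have "(norm (diag_mat v *v x))\<^sup>2 \<le> (\<Sum>i\<in>UNIV. (c * norm (x $ i))\<^sup>2)"
    unfolding norm_vec_power2[of "diag_mat v *v x"] diag_mat_mv norm_mult
    by (intro sum_mono power_mono mult_right_mono assms) auto
  also have "\<dots> = (c * norm x)\<^sup>2"
    by (simp add: power_mult_distrib sum_distrib_left norm_vec_power2[of x])
  finally show "norm (diag_mat v *v x) \<le> c * norm x"
    by (rule power2_le_imp_le) (use \<open>0 \<le> c\<close> in auto)
qed

lemma op_norm_mul3_le:
  assumes "op_norm A \<le> a" "op_norm B \<le> b" "op_norm C \<le> c"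
  shows "op_norm (A ** B ** C) \<le> a * b * c"
proof -
  have "op_norm (A ** B ** C) \<le> op_norm A * op_norm B * op_norm C"
    by (rule order_trans[OF op_norm_mul]) (intro mult_right_mono op_norm_mul op_norm_nonneg)
  also have "\<dots> \<le> a * b * c"
    using assms order_trans[OF op_norm_nonneg assms(1)] order_trans[OF op_norm_nonneg assms(2)]
    by (intro mult_mono) (auto intro!: mult_nonneg_nonneg op_norm_nonneg)
  finally show ?thesis .
qed

lemma op_norm_isometry:
  fixes U :: "complex^'k^'n"
  assumes "adj_mat U ** U = mat 1"
  shows "op_norm U \<le> 1"
proof (rule op_norm_leI)
  fix x
  have "cdot (U *v x) (U *v x) = cdot x x"
    by (metis assms cdot_adj adj_adj matrix_vector_mul_assoc matrix_vector_mul_lid)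
  then have "(norm (U *v x))\<^sup>2 = (norm x)\<^sup>2"
    unfolding cdot_self by (simp only: of_real_eq_iff)
  then show "norm (U *v x) \<le> 1 * norm x" by simp
qed

lemma op_norm_compress:
  fixes U :: "complex^'k^'n"
  assumes "adj_mat U ** U = mat 1"
  shows "op_norm (adj_mat U ** A ** U) \<le> op_norm A"
  using op_norm_mul3_le[OF order_trans[OF op_norm_adj op_norm_isometry[OF assms]] order_refl op_norm_isometry[OF assms], of A]
  by simp

lemma op_norm_uminus: "op_norm (- A) = op_norm A"
proof -
  have "(- A) *v v = - (A *v v)" for v
    by (simp add: matrix_vector_mult_def vec_eq_iff sum_negf)
  then show ?thesis unfolding op_norm_def onorm_def by simp
qed

text \<open>The operator norm is 1-Lipschitz for the Hilbert--Schmidt norm. Continuity later makes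
  the deviation event closed.\<close>

lemma continuous_on_op_norm: "continuous_on S (op_norm :: complex^'n^'m \<Rightarrow> real)"
proof (rule continuous_onI)
  fix A :: "complex^'n^'m" and e :: real assume "0 < e"
  have "op_norm B \<le> op_norm C + norm (B - C)" for B C :: "complex^'n^'m"
    using op_norm_add[of C "B - C"] op_norm_le_norm[of "B - C"] by simp
  from this[of _ A] this[of A] have "dist (op_norm B) (op_norm A) \<le> dist B A" for B
    by (smt (verit) dist_norm norm_minus_commute real_norm_def)
  then show "\<exists>d>0. \<forall>B\<in>S. dist B A < d \<longrightarrow> dist (op_norm B) (op_norm A) \<le> e"
    using \<open>0 < e\<close> by (meson less_imp_le order_trans)
qed

lemma op_norm_cdotI:
  assumes "0 \<le> c" "\<And>u v. norm (cdot u (A *v v)) \<le> c * norm u * norm v"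
  shows "op_norm A \<le> c"
proof (rule op_norm_leI)
  fix x
  let ?y = "A *v x"
  have "(norm ?y)\<^sup>2 = norm (cdot ?y ?y)" by (simp only: cdot_self norm_of_real) simp
  also have "\<dots> \<le> c * norm ?y * norm x" by (rule assms(2))
  finally have "norm ?y * norm ?y \<le> (c * norm x) * norm ?y"
    by (simp add: power2_eq_square mult_ac)
  then show "norm ?y \<le> c * norm x"
    using assms(1) by (cases "norm ?y = 0") (auto simp: mult_le_cancel_right)
qed

subsection \<open>Matrices with positive definite imaginary part\<close>

text \<open>Says that the Hermitian matrix \<open>(A - adj_mat A) / (2 * \<i>)\<close> is at least
  \<open>m\<close>.\<close>

definition dissipative :: "real \<Rightarrow> complex^'n^'n \<Rightarrow> bool"
  where "dissipative m A \<longleftrightarrow> (\<forall>x. m * (norm x)\<^sup>2 \<le> Im (cdot x (A *v x)))"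

lemma hermitian_cdot_real: "hermitian_mat Y \<Longrightarrow> Im (cdot x (Y *v x)) = 0"
  using cdot_adj[of x Y x] cdot_commute[of "Y *v x" x]
  by (simp add: hermitian_mat_def complex_eq_iff)

lemma Im_cdot_diag_minus_hermitian:
  assumes "hermitian_mat Y"
  shows "Im (cdot x ((diag_mat w - Y) *v x)) = (\<Sum>j\<in>UNIV. Im (w $ j) * (norm (x $ j))\<^sup>2)"
proof -
  have "Im (cdot x ((diag_mat w - Y) *v x)) = Im (cdot x (diag_mat w *v x))"
    using assms by (simp add: matrix_vector_mult_diff_rdistrib cdot_diff_right hermitian_cdot_real)
  also have "\<dots> = (\<Sum>j\<in>UNIV. Im (w $ j) * (norm (x $ j))\<^sup>2)"
    unfolding cdot_def diag_mat_mv Im_sum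
    by (intro sum.cong refl) (simp add: cmod_power2, simp add: power2_eq_square algebra_simps)
  finally show ?thesis .
qed

lemma dissipative_diag_minus_hermitian:
  fixes w :: "complex^'n"
  assumes "hermitian_mat Y" "\<And>i. m \<le> Im (w $ i)"
  shows "dissipative m (diag_mat w - Y)"
  unfolding dissipative_def Im_cdot_diag_minus_hermitian[OF assms(1)] norm_vec_power2 sum_distrib_left
  using assms(2) by (auto intro!: sum_mono mult_right_mono)

lemma matrix_inv_props:
  assumes "invertible (A :: complex^'n^'n)"
  shows "A ** matrix_inv A = mat 1" "matrix_inv A ** A = mat 1"
  using assms unfolding invertible_def matrix_inv_def by (metis (mono_tags, lifting) someI_ex)+

text \<open>By Cauchy--Schwarz the imaginary part of the quadratic form gives
  \<open>m * norm x \<le> norm (A *v x)\<close>: injectivity, hence invertibility in finite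
  dimension, and the norm bound on the inverse.\<close>

lemma dissipative_inverse:
  assumes A: "dissipative m A" and m: "0 < m"
  shows "A ** matrix_inv A = mat 1" "matrix_inv A ** A = mat 1" "op_norm (matrix_inv A) \<le> 1 / m"
proof -
  have low: "m * norm x \<le> norm (A *v x)" for x
  proof -
    have "m * (norm x)\<^sup>2 \<le> Im (cdot x (A *v x))" using A by (simp add: dissipative_def)
    also have "\<dots> \<le> norm x * norm (A *v x)"
      using abs_Im_le_cmod[of "cdot x (A *v x)"] norm_cdot_le[of x "A *v x"] by linarith
    finally have "norm x * (m * norm x) \<le> norm x * norm (A *v x)"
      by (simp add: power2_eq_square mult_ac)
    then show ?thesis by (cases "norm x = 0") (auto simp: mult_le_cancel_left)
  qed
  have "A *v x = 0 \<Longrightarrow> x = 0" for x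
    using low[of x] m by (simp add: mult_le_0_iff)
  then have "invertible A"
    unfolding invertible_left_inverse using matrix_left_invertible_ker[of A] by blast
  from matrix_inv_props[OF this]
  show 1: "A ** matrix_inv A = mat 1" and "matrix_inv A ** A = mat 1" by auto
  show "op_norm (matrix_inv A) \<le> 1 / m"
  proof (rule op_norm_leI)
    fix x
    have "A *v (matrix_inv A *v x) = x" by (simp add: matrix_vector_mul_assoc 1)
    then show "norm (matrix_inv A *v x) \<le> 1 / m * norm x"
      using low[of "matrix_inv A *v x"] m by (simp add: field_simps)
  qed
qed

lemma matrix_mult_diff_distribs:
  fixes A :: "complex^'n^'m"
  shows "A ** (B - C) = A ** B - A ** C" "(A - D) ** B = A ** B - D ** B"
  by (simp_all add: matrix_matrix_mult_def vec_eq_iff algebra_simps sum_subtractf)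

lemma matrix_inv_diff:
  fixes A B :: "complex^'n^'n"
  assumes "matrix_inv A ** A = mat 1" "B ** matrix_inv B = mat 1"
  shows "matrix_inv A - matrix_inv B = matrix_inv A ** (B - A) ** matrix_inv B"
proof -
  have "matrix_inv A ** (B - A) ** matrix_inv B =
      matrix_inv A ** (B ** matrix_inv B) - (matrix_inv A ** A) ** matrix_inv B"
    by (simp add: matrix_mul_assoc matrix_mult_diff_distribs)
  then show ?thesis using assms by simp
qed

text \<open>Ward identity: with \<open>M\<close> the inverse, \<open>- Im M\<close> equals both
  \<open>M (Im A) M*\<close> and \<open>M* (Im A) M\<close>, and \<open>Im A\<close> is diagonal
  because \<open>Y\<close> is Hermitian. The stability estimate uses the row form for one solution
  and the column form for the other.\<close>

lemma Im_matrix_inv_diag: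
  fixes w :: "complex^'n"
  assumes Y: "hermitian_mat Y" and A: "A = diag_mat w - Y" and m: "0 < m" "\<And>i. m \<le> Im (w $ i)"
  shows "- Im (matrix_inv A $ i $ i) = (\<Sum>j\<in>UNIV. Im (w $ j) * (norm (matrix_inv A $ i $ j))\<^sup>2)" (is ?R)
    and "- Im (matrix_inv A $ i $ i) = (\<Sum>j\<in>UNIV. Im (w $ j) * (norm (matrix_inv A $ j $ i))\<^sup>2)" (is ?C)
    and "Im (matrix_inv A $ i $ i) < 0"
proof -
  note inv = dissipative_inverse[OF dissipative_diag_minus_hermitian[OF Y m(2)] m(1), folded A]
  let ?M = "matrix_inv A"
  let ?y = "?M *v axis i 1" and ?x = "adj_mat ?M *v axis i 1"
  have "cdot ?y (A *v ?y) = cnj (?M $ i $ i)"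
    by (simp add: matrix_vector_mul_assoc matrix_mul_assoc inv cdot_commute[of "?M *v _"] cdot_axis mat_axis)
  then have "Im (cdot ?y ((diag_mat w - Y) *v ?y)) = - Im (?M $ i $ i)" by (simp add: A[symmetric])
  then show C: ?C
    unfolding Im_cdot_diag_minus_hermitian[OF Y] by (simp add: mat_axis)
  have "cdot ?x (A *v ?x) = cdot (axis i 1) (?M *v (A *v ?x))" by (simp add: cdot_adj)
  also have "\<dots> = cnj (?M $ i $ i)"
    by (simp add: matrix_vector_mul_assoc matrix_mul_assoc inv cdot_axis mat_axis adj_mat_def)
  finally have "Im (cdot ?x ((diag_mat w - Y) *v ?x)) = - Im (?M $ i $ i)" by (simp add: A[symmetric])
  then show ?R
    unfolding Im_cdot_diag_minus_hermitian[OF Y] by (simp add: mat_axis adj_mat_def)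
  have "?y \<noteq> 0"
  proof
    assume "?y = 0"
    then have "A *v ?y = 0" by simp
    then have "axis i (1 :: complex) = (0 :: complex^'n)"
      by (simp add: matrix_vector_mul_assoc inv)
    then show False using norm_axis_one[of i] by (metis norm_zero zero_neq_one)
  qed
  then obtain j where j: "?M $ j $ i \<noteq> 0" by (auto simp: vec_eq_iff mat_axis)
  have pos: "0 < Im (w $ j)" for j using m less_le_trans by blast
  have "0 < (\<Sum>j\<in>UNIV. Im (w $ j) * (norm (?M $ j $ i))\<^sup>2)"
    by (rule sum_pos2[of _ j]) (use pos j in \<open>auto intro!: mult_nonneg_nonneg less_imp_le[OF pos]\<close>)
  then show "Im (?M $ i $ i) < 0" using C by linarith
qed

subsection \<open>Stability of the matrix Dyson equation\<close>

text \<open>A vector \<open>g\<close> solves the Dyson equation at \<open>\<Lambda>\<close> when it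
  is the diagonal of the inverse of this matrix. The factor \<open>1/N\<close> of the variance
  profile is absorbed in \<open>S\<close>.\<close>

definition dyson :: "real^'n^'n \<Rightarrow> complex^'n^'n \<Rightarrow> complex^'n \<Rightarrow> complex^'n \<Rightarrow> complex^'n^'n"
  where "dyson S Y \<Lambda> g = diag_mat (\<chi> i. \<Lambda> $ i - (\<Sum>j\<in>UNIV. complex_of_real (S $ i $ j) * g $ j)) - Y"

lemma Im_dyson_shift:
  fixes \<Lambda> g :: "complex^'n"
  shows "Im ((\<chi> i. \<Lambda> $ i - (\<Sum>j\<in>UNIV. complex_of_real (S $ i $ j) * g $ j)) $ k)
    = Im (\<Lambda> $ k) + (\<Sum>j\<in>UNIV. S $ k $ j * (- Im (g $ j)))"
  by (simp add: sum_negf)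

text \<open>The self-energy of a \<open>g\<close> with nonpositive imaginary parts can only increase
  the imaginary part of the spectral parameter.\<close>

lemma dissipative_dyson:
  fixes \<Lambda> g :: "complex^'n" and S :: "real^'n^'n"
  assumes "hermitian_mat Y" "\<And>i j. 0 \<le> S $ i $ j" "\<And>i. Im (g $ i) \<le> 0" "\<And>i. m \<le> Im (\<Lambda> $ i)"
  shows "dissipative m (dyson S Y \<Lambda> g)"
  unfolding dyson_def
proof (rule dissipative_diag_minus_hermitian[OF assms(1)])
  fix i
  have "0 \<le> (\<Sum>j\<in>UNIV. S $ i $ j * (- Im (g $ j)))"
    using assms(2,3) by (intro sum_nonneg mult_nonneg_nonneg) auto
  then show "m \<le> Im ((\<chi> i. \<Lambda> $ i - (\<Sum>j\<in>UNIV. complex_of_real (S $ i $ j) * g $ j)) $ i)"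
    unfolding Im_dyson_shift using assms(4)[of i] by linarith
qed

lemma Im_dyson_inv_diag:
  fixes \<Lambda> g :: "complex^'n" and S :: "real^'n^'n"
  assumes Y: "hermitian_mat Y" and S: "\<And>i j. 0 \<le> S $ i $ j" and g: "\<And>i. Im (g $ i) \<le> 0"
    and m: "0 < m" "\<And>i. m \<le> Im (\<Lambda> $ i)"
  shows "Im (matrix_inv (dyson S Y \<Lambda> g) $ i $ i) < 0"
proof (rule Im_matrix_inv_diag(3)[OF Y dyson_def m(1)])
  fix k
  have "0 \<le> (\<Sum>j\<in>UNIV. S $ k $ j * (- Im (g $ j)))"
    using S g by (intro sum_nonneg mult_nonneg_nonneg) auto
  then show "m \<le> Im ((\<chi> i. \<Lambda> $ i - (\<Sum>j\<in>UNIV. complex_of_real (S $ i $ j) * g $ j)) $ k)"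
    unfolding Im_dyson_shift using m(2)[of k] by linarith
qed

lemma sqrt_mult_add_le:
  fixes a b c d :: real
  assumes "0 \<le> a" "0 \<le> b" "0 \<le> c" "0 \<le> d"
  shows "sqrt (a * b) + sqrt (c * d) \<le> sqrt ((a + c) * (b + d))"
proof (rule real_le_rsqrt)
  have "2 * (sqrt (a * d) * sqrt (c * b)) \<le> (sqrt (a * d))\<^sup>2 + (sqrt (c * b))\<^sup>2"
    using sum_squares_bound[of "sqrt (a * d)" "sqrt (c * b)"] by simp
  then have "2 * (sqrt (a * b) * sqrt (c * d)) \<le> a * d + c * b"
    using assms by (simp add: real_sqrt_mult[symmetric] mult_ac)
  then show "(sqrt (a * b) + sqrt (c * d))\<^sup>2 \<le> (a + c) * (b + d)"
    using assms by (simp add: power2_sum algebra_simps)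
qed

lemma sum_sqrt_mult_le:
  fixes a b :: "'i \<Rightarrow> real"
  assumes "\<And>i. i \<in> I \<Longrightarrow> 0 \<le> a i" "\<And>i. i \<in> I \<Longrightarrow> 0 \<le> b i"
  shows "(\<Sum>i\<in>I. sqrt (a i * b i)) \<le> sqrt ((\<Sum>i\<in>I. a i) * (\<Sum>i\<in>I. b i))"
proof -
  have "(\<Sum>i\<in>I. sqrt (a i) * sqrt (b i)) \<le> sqrt (\<Sum>i\<in>I. a i) * sqrt (\<Sum>i\<in>I. b i)"
    using assms by (intro sum_mult_le_sqrt) (auto simp: sum_nonneg intro!: sum_mono)
  then show ?thesis by (simp add: real_sqrt_mult)
qed

text \<open>
  The weights \<open>sqrt (Im g\<^sub>i Im g'\<^sub>i)\<close> make the linearised equation a contraction: by the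
  imaginary part of the equation, \<open>-Im g\<close> is a fixed point of an affine map with the
  nonnegative kernel \<open>|M\<^sub>i\<^sub>j|\<^sup>2\<close>.
\<close>

lemma dyson_stability:
  fixes S :: "real^'n^'n" and \<Lambda> \<Lambda>' g g' :: "complex^'n"
  assumes Y: "hermitian_mat Y" and S: "\<And>i j. 0 \<le> S $ i $ j"
    and m: "0 < m" "\<And>i. m \<le> Im (\<Lambda> $ i)" and m': "0 < m'" "\<And>i. m' \<le> Im (\<Lambda>' $ i)"
    and g: "\<And>i. g $ i = matrix_inv (dyson S Y \<Lambda> g) $ i $ i" "\<And>i. Im (g $ i) < 0"
    and g': "\<And>i. g' $ i = matrix_inv (dyson S Y \<Lambda>' g') $ i $ i" "\<And>i. Im (g' $ i) < 0"
    and e: "\<And>i. norm (\<Lambda> $ i - \<Lambda>' $ i) \<le> e"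
  shows "norm (g $ i - g' $ i) \<le> e / (m * m')"
proof -
  define w where "w = (\<chi> i. \<Lambda> $ i - (\<Sum>j\<in>UNIV. complex_of_real (S $ i $ j) * g $ j))"
  define w' where "w' = (\<chi> i. \<Lambda>' $ i - (\<Sum>j\<in>UNIV. complex_of_real (S $ i $ j) * g' $ j))"
  define M where "M = matrix_inv (dyson S Y \<Lambda> g)"
  define M' where "M' = matrix_inv (dyson S Y \<Lambda>' g')"
  define a where "a i = - Im (g $ i)" for i
  define a' where "a' i = - Im (g' $ i)" for i
  have a: "0 < a i" "0 < a' i" for i using g(2) g'(2) by (auto simp: a_def a'_def)
  define s where "s i = (\<Sum>j\<in>UNIV. S $ i $ j * a j)" for i
  define s' where "s' i = (\<Sum>j\<in>UNIV. S $ i $ j * a' j)" for i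
  have s: "0 \<le> s i" "0 \<le> s' i" for i
    using S less_imp_le[OF a(1)] less_imp_le[OF a(2)]
    by (auto simp: s_def s'_def intro!: sum_nonneg mult_nonneg_nonneg)
  have w: "m + s i \<le> Im (w $ i)" "m' + s' i \<le> Im (w' $ i)" for i
    unfolding w_def w'_def Im_dyson_shift using m(2)[of i] m'(2)[of i] by (auto simp: s_def s'_def a_def a'_def)
  have wm: "m \<le> Im (w $ i)" "m' \<le> Im (w' $ i)" for i
    using w[of i] s[of i] by linarith+
  have e0: "0 \<le> e" using e norm_ge_zero order_trans by blast
  have DW: "dyson S Y \<Lambda> g = diag_mat w - Y" "dyson S Y \<Lambda>' g' = diag_mat w' - Y"
    by (simp_all add: dyson_def w_def w'_def)
  note inv = dissipative_inverse[OF dissipative_diag_minus_hermitian[OF Y wm(1)] m(1)]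
  note inv' = dissipative_inverse[OF dissipative_diag_minus_hermitian[OF Y wm(2)] m'(1)]
  have row: "a i = (\<Sum>j\<in>UNIV. Im (w $ j) * (norm (M $ i $ j))\<^sup>2)" for i
    using Im_matrix_inv_diag(1)[OF Y DW(1) m(1) wm(1), of i] g(1)[of i] by (simp add: a_def M_def)
  have col: "a' i = (\<Sum>j\<in>UNIV. Im (w' $ j) * (norm (M' $ j $ i))\<^sup>2)" for i
    using Im_matrix_inv_diag(2)[OF Y DW(2) m'(1) wm(2), of i] g'(1)[of i] by (simp add: a'_def M'_def)
  \<comment> \<open>The difference in the weighted metric. The proof looks at an index
    \<open>k\<close> where it is largest.\<close>
  define q where "q i = norm (g $ i - g' $ i) / sqrt (a i * a' i)" for i
  have q: "norm (g $ i - g' $ i) = q i * sqrt (a i * a' i)" for i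
    using a[of i] by (simp add: q_def)
  obtain k where k: "\<And>i. q i \<le> q k"
  proof -
    have "Max (range q) \<in> range q" by (rule Max_in) auto
    then obtain k where "q k = Max (range q)" by (metis imageE)
    then show ?thesis using that[of k] by simp
  qed
  have qk0: "0 \<le> q k" using a[of k] by (simp add: q_def)
  \<comment> \<open>The weighted size of the perturbation: the claim in the weighted metric is
    \<open>q k \<le> d0\<close>.\<close>
  define d0 where "d0 = e / sqrt (m * m')"
  have d0: "0 \<le> d0" "e = d0 * sqrt (m * m')" using e0 m m' by (auto simp: d0_def)
  have "M - M' = M ** (diag_mat w' - diag_mat w) ** M'"
    using matrix_inv_diff[OF inv(2) inv'(1)] by (simp add: M_def M'_def DW)
  then have gdiff: "g $ i - g' $ i = (\<Sum>j\<in>UNIV. M $ i $ j * (w' $ j - w $ j) * M' $ j $ i)" for i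
  proof -
    have "g $ i - g' $ i = (M - M') $ i $ i" by (simp add: g(1)[of i] g'(1)[of i] M_def M'_def)
    also have "\<dots> = (M ** (diag_mat w' - diag_mat w) ** M') $ i $ i"
      using \<open>M - M' = _\<close> by simp
    also have "\<dots> = (\<Sum>j\<in>UNIV. (M ** (diag_mat w' - diag_mat w)) $ i $ j * M' $ j $ i)"
      by (simp add: matrix_matrix_mult_def)
    also have "\<dots> = (\<Sum>j\<in>UNIV. M $ i $ j * (w' $ j - w $ j) * M' $ j $ i)"
    proof (intro sum.cong refl)
      fix j
      have "(M ** (diag_mat w' - diag_mat w)) $ i $ j = (\<Sum>l\<in>UNIV. if l = j then M $ i $ j * (w' $ j - w $ j) else 0)"
        unfolding matrix_matrix_mult_def vec_lambda_beta by (intro sum.cong refl) (auto simp: diag_mat_def)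
      then show "(M ** (diag_mat w' - diag_mat w)) $ i $ j * M' $ j $ i = M $ i $ j * (w' $ j - w $ j) * M' $ j $ i"
        by simp
    qed
    finally show ?thesis .
  qed
  \<comment> \<open>Maximality of \<open>q k\<close> and Cauchy--Schwarz turn the difference of the
    self-energies into the geometric mean of their imaginary parts.\<close>
  have wdiff: "norm (w' $ j - w $ j) \<le> d0 * sqrt (m * m') + q k * sqrt (s j * s' j)" for j
  proof -
    have "w' $ j - w $ j = - (\<Lambda> $ j - \<Lambda>' $ j) + (\<Sum>l\<in>UNIV. complex_of_real (S $ j $ l) * (g $ l - g' $ l))"
      by (simp add: w_def w'_def algebra_simps sum_subtractf)
    also have "norm \<dots> \<le> norm (\<Lambda> $ j - \<Lambda>' $ j) + (\<Sum>l\<in>UNIV. S $ j $ l * norm (g $ l - g' $ l))"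
      using S by (intro order_trans[OF norm_triangle_ineq] add_mono order_trans[OF norm_sum]) (auto simp: norm_mult norm_minus_commute)
    also have "(\<Sum>l\<in>UNIV. S $ j $ l * norm (g $ l - g' $ l)) \<le> (\<Sum>l\<in>UNIV. q k * sqrt ((S $ j $ l * a l) * (S $ j $ l * a' l)))"
    proof (intro sum_mono)
      fix l
      have "sqrt ((S $ j $ l * a l) * (S $ j $ l * a' l)) = sqrt ((S $ j $ l)\<^sup>2 * (a l * a' l))"
        by (simp add: power2_eq_square mult_ac)
      also have "\<dots> = S $ j $ l * sqrt (a l * a' l)" using S by (simp add: real_sqrt_mult)
      finally have "sqrt ((S $ j $ l * a l) * (S $ j $ l * a' l)) = S $ j $ l * sqrt (a l * a' l)" .
      moreover have "S $ j $ l * (q l * sqrt (a l * a' l)) \<le> S $ j $ l * (q k * sqrt (a l * a' l))"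
        using a[of l] S by (intro mult_left_mono mult_right_mono k) simp_all
      ultimately show "S $ j $ l * norm (g $ l - g' $ l) \<le> q k * sqrt ((S $ j $ l * a l) * (S $ j $ l * a' l))"
        unfolding q by (simp add: mult.left_commute)
    qed
    also have "\<dots> \<le> q k * sqrt (s j * s' j)"
      unfolding sum_distrib_left[symmetric] s_def s'_def using S less_imp_le[OF a(1)] less_imp_le[OF a(2)] qk0
      by (intro mult_left_mono sum_sqrt_mult_le) (auto intro!: mult_nonneg_nonneg)
    finally show ?thesis using e[of j] d0(2) by linarith
  qed
  have "q k \<le> d0"
  proof (rule ccontr)
    assume "\<not> q k \<le> d0"
    then have lt: "d0 < q k" by simp
    let ?t = "\<lambda>j. norm (M $ k $ j) * norm (M' $ j $ k)"
    \<comment> \<open>If \<open>d0 < q k\<close>, the perturbation is strictly smaller than what the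
      spectral parameters contribute to the imaginary parts of \<open>w\<close> and
      \<open>w'\<close>.\<close>
    have step: "d0 * sqrt (m * m') + q k * sqrt (s j * s' j) < q k * sqrt (Im (w $ j) * Im (w' $ j))" for j
    proof -
      have "d0 * sqrt (m * m') + q k * sqrt (s j * s' j) < q k * sqrt (m * m') + q k * sqrt (s j * s' j)"
        using lt m(1) m'(1) by simp
      also have "\<dots> = q k * (sqrt (m * m') + sqrt (s j * s' j))" by (simp add: distrib_left)
      also have "\<dots> \<le> q k * sqrt (Im (w $ j) * Im (w' $ j))"
      proof (intro mult_left_mono qk0)
        have "sqrt (m * m') + sqrt (s j * s' j) \<le> sqrt ((m + s j) * (m' + s' j))"
          using m(1) m'(1) s by (intro sqrt_mult_add_le) auto
        also have "\<dots> \<le> sqrt (Im (w $ j) * Im (w' $ j))"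
          using w[of j] m(1) m'(1) s[of j] wm[of j] by (intro real_sqrt_le_mono mult_mono) auto
        finally show "sqrt (m * m') + sqrt (s j * s' j) \<le> sqrt (Im (w $ j) * Im (w' $ j))" .
      qed
      finally show ?thesis .
    qed
    \<comment> \<open>Strictness survives summation only if some weight is nonzero; otherwise
      \<open>g\<close> and \<open>g'\<close> agree at \<open>k\<close> and
      \<open>q k = 0\<close>.\<close>
    have "\<exists>j. ?t j \<noteq> 0"
    proof (rule ccontr)
      assume "\<not> ?thesis"
      then have "\<And>j. M $ k $ j = 0 \<or> M' $ j $ k = 0" by simp
      then have "M $ k $ j * (w' $ j - w $ j) * M' $ j $ k = 0" for j by (metis mult_zero_left mult_zero_right)
      then have "g $ k - g' $ k = 0" by (simp only: gdiff sum.neutral_const)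
      then have "q k = 0" by (simp add: q_def)
      then show False using lt d0 by simp
    qed
    then obtain j0 where j0: "?t j0 \<noteq> 0" ..
    have "norm (g $ k - g' $ k) \<le> (\<Sum>j\<in>UNIV. ?t j * norm (w' $ j - w $ j))"
      unfolding gdiff by (rule order_trans[OF norm_sum]) (simp add: norm_mult mult_ac)
    also have "\<dots> \<le> (\<Sum>j\<in>UNIV. ?t j * (d0 * sqrt (m * m') + q k * sqrt (s j * s' j)))"
      by (intro sum_mono mult_left_mono wdiff) auto
    also have "\<dots> < (\<Sum>j\<in>UNIV. ?t j * (q k * sqrt (Im (w $ j) * Im (w' $ j))))"
    proof (rule sum_strict_mono_ex1)
      show "\<forall>j\<in>UNIV. ?t j * (d0 * sqrt (m * m') + q k * sqrt (s j * s' j)) \<le> ?t j * (q k * sqrt (Im (w $ j) * Im (w' $ j)))"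
        by (intro ballI mult_left_mono less_imp_le[OF step]) simp
      have "0 < ?t j0" using j0 by (simp add: less_le)
      then show "\<exists>j\<in>UNIV. ?t j * (d0 * sqrt (m * m') + q k * sqrt (s j * s' j)) < ?t j * (q k * sqrt (Im (w $ j) * Im (w' $ j)))"
        using mult_strict_left_mono[OF step[of j0]] by blast
    qed simp
    \<comment> \<open>Arranged so that Cauchy--Schwarz with the row identity for \<open>M\<close>
      and the column identity for \<open>M'\<close> returns exactly
      \<open>sqrt (a k * a' k)\<close>, contradicting the strict inequality.\<close>
    also have "\<dots> = q k * (\<Sum>j\<in>UNIV. sqrt ((Im (w $ j) * (norm (M $ k $ j))\<^sup>2) * (Im (w' $ j) * (norm (M' $ j $ k))\<^sup>2)))"
      unfolding sum_distrib_left by (intro sum.cong refl) (simp add: real_sqrt_mult mult_ac)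
    also have "\<dots> \<le> q k * sqrt (a k * a' k)"
      unfolding row col using wm m(1) m'(1) qk0
      by (intro mult_left_mono sum_sqrt_mult_le) (auto intro!: mult_nonneg_nonneg intro: order_trans[OF less_imp_le])
    finally show False using q[of k] by simp
  qed
  then have "q i \<le> d0" using k[of i] by linarith
  \<comment> \<open>Back to the unweighted metric: the weights are at most
    \<open>1 / sqrt (m * m')\<close>, which supplies the second such factor.\<close>
  have ub: "a i \<le> 1 / m" "a' i \<le> 1 / m'"
  proof -
    have "a i \<le> norm (g $ i)" using abs_Im_le_cmod[of "g $ i"] by (simp add: a_def)
    also have "\<dots> \<le> 1 / m"
      unfolding g(1)[of i] DW using norm_entry_le_op_norm inv(3) by (rule order_trans)
    finally show "a i \<le> 1 / m" .
    have "a' i \<le> norm (g' $ i)" using abs_Im_le_cmod[of "g' $ i"] by (simp add: a'_def)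
    also have "\<dots> \<le> 1 / m'"
      unfolding g'(1)[of i] DW using norm_entry_le_op_norm inv'(3) by (rule order_trans)
    finally show "a' i \<le> 1 / m'" .
  qed
  have "norm (g $ i - g' $ i) \<le> d0 * sqrt (1 / m * (1 / m'))"
    unfolding q using \<open>q i \<le> d0\<close> d0(1) ub a[of i] m(1) m'(1)
    by (intro mult_mono real_sqrt_le_mono) (auto intro: less_imp_le)
  also have "sqrt (1 / m * (1 / m')) = 1 / sqrt (m * m')"
    by (simp add: real_sqrt_divide)
  also have "d0 * (1 / sqrt (m * m')) = e / (sqrt (m * m') * sqrt (m * m'))"
    by (simp add: d0_def)
  also have "sqrt (m * m') * sqrt (m * m') = m * m'"
    using m(1) m'(1) by simp
  finally show ?thesis .
qed

subsection \<open>Resolvents of a Gaussian Hermitian matrix\<close>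

lemma has_derivative_quadratic_remainder:
  fixes f :: "'a::real_normed_vector \<Rightarrow> 'b::real_normed_vector"
  assumes "bounded_linear f'" and K: "\<And>y. norm (f y - f x - f' (y - x)) \<le> K * (norm (y - x))\<^sup>2"
  shows "(f has_derivative f') (at x)"
  unfolding has_derivative_iff_norm
proof (intro conjI assms(1))
  have "((\<lambda>y. K * norm (y - x)) \<longlongrightarrow> K * norm (x - x)) (at x)"
    by (intro tendsto_intros)
  then have lim: "((\<lambda>y. K * norm (y - x)) \<longlongrightarrow> 0) (at x)" by simp
  show "((\<lambda>y. norm (f y - f x - f' (y - x)) / norm (y - x)) \<longlongrightarrow> 0) (at x)"
  proof (rule tendsto_sandwich[OF _ _ tendsto_const lim])
    have "norm (f y - f x - f' (y - x)) / norm (y - x) \<le> K * norm (y - x)" if "y \<noteq> x" for y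
      using K[of y] that by (simp add: divide_le_eq power2_eq_square mult.assoc)
    then show "\<forall>\<^sub>F y in at x. norm (f y - f x - f' (y - x)) / norm (y - x) \<le> K * norm (y - x)"
      by (auto simp: eventually_at_filter)
  qed simp
qed

lemma trace_mul_eq: "trace (A ** B) = (\<Sum>i\<in>UNIV. \<Sum>j\<in>UNIV. A $ i $ j * B $ j $ i)"
  by (simp add: trace_def matrix_matrix_mult_def)

lemma trace_mul_commute: "trace (A ** B) = trace (B ** (A :: complex^'n^'n))"
  unfolding trace_mul_eq by (subst sum.swap) (simp add: mult.commute)

lemma trace_diff: "trace (A - B) = trace A - trace (B :: complex^'n^'n)"
  by (simp add: trace_def sum_subtractf)

lemma norm_trace_le: "norm (trace (A :: complex^'n^'n)) \<le> real CARD('n) * op_norm A"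
proof -
  have "norm (trace A) \<le> (\<Sum>i\<in>(UNIV :: 'n set). op_norm A)"
    unfolding trace_def by (rule order_trans[OF norm_sum]) (intro sum_mono norm_entry_le_op_norm)
  then show ?thesis by simp
qed

lemma matrix_mult_scaleR:
  fixes A :: "complex^'n^'m"
  shows "A ** (c *\<^sub>R B) = c *\<^sub>R (A ** B)" "(c *\<^sub>R A) ** B = c *\<^sub>R (A ** B)"
  by (simp_all add: matrix_matrix_mult_def vec_eq_iff scaleR_sum_right)

lemma matrix_mult_add_distribs:
  fixes A :: "complex^'n^'m"
  shows "A ** (B + C) = A ** B + A ** C" "(A + D) ** B = A ** B + D ** B"
  by (simp_all add: matrix_matrix_mult_def vec_eq_iff algebra_simps sum.distrib)

lemma linear_matrix_mult_conj: "linear (\<lambda>X. (A :: complex^'n^'m) ** X ** B)"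
  by (rule linearI) (simp_all add: matrix_mult_add_distribs matrix_mult_scaleR)

lemma linear_trace_mul: "linear (\<lambda>X. trace ((A :: complex^'n^'n) ** X))"
  by (rule linearI) (simp_all add: matrix_mult_add_distribs matrix_mult_scaleR trace_def sum.distrib scaleR_sum_right)

text \<open>
  The sum over \<open>Basis\<close> in \<open>cov_T\<close> is the expectation of \<open>T\<^sub>i\<^sub>j T\<^sub>k\<^sub>l\<close> under the standard Gaussian measure.
\<close>

locale gaussian_resolvent =
  fixes T :: "'a::euclidean_space \<Rightarrow> complex^'n^'n" and S :: "real^'n^'n"
    and Y :: "complex^'n^'n" and z :: complex and \<sigma> :: real
  assumes lin_T: "linear T"
    and herm_T: "\<And>x. hermitian_mat (T x)"
    and cov_T: "\<And>i j k l. (\<Sum>b\<in>Basis. T b $ i $ j * T b $ k $ l)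
      = (if k = j \<and> l = i then complex_of_real (S $ i $ j) else 0)"
    and S_nonneg: "\<And>i j. 0 \<le> S $ i $ j"
    and S_le: "\<And>i j. S $ i $ j \<le> \<sigma>\<^sup>2"
    and \<sigma>_pos: "0 < \<sigma>"
    and herm_Y: "hermitian_mat Y"
    and Im_z: "0 < Im z"
begin

abbreviation "\<eta> \<equiv> Im z"

definition R :: "'a \<Rightarrow> complex^'n^'n"
  where "R x = matrix_inv (mat z - T x - Y)"

lemma dissipative_R: "dissipative \<eta> (mat z - T x - Y)"
proof -
  have "hermitian_mat (T x + Y)"
    using herm_T[of x] herm_Y by (simp add: hermitian_mat_def adj_mat_def vec_eq_iff)
  then have "dissipative \<eta> (diag_mat (\<chi> i. z) - (T x + Y))"
    by (rule dissipative_diag_minus_hermitian) simp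
  moreover have "diag_mat (\<chi> i. z) - (T x + Y) = mat z - T x - Y"
    by (simp add: diag_mat_def mat_def vec_eq_iff)
  ultimately show ?thesis by simp
qed

lemmas R_inv = dissipative_inverse[OF dissipative_R Im_z, folded R_def]

lemma Im_R_diag: "Im (R x $ i $ i) < 0"
proof -
  have "hermitian_mat (T x + Y)"
    using herm_T[of x] herm_Y by (simp add: hermitian_mat_def adj_mat_def vec_eq_iff)
  moreover have "mat z - T x - Y = diag_mat (\<chi> i. z) - (T x + Y)"
    by (simp add: diag_mat_def mat_def vec_eq_iff)
  ultimately show ?thesis
    unfolding R_def by (rule Im_matrix_inv_diag(3)[OF _ _ Im_z]) simp
qed

lemma R_has_derivative: "(R has_derivative (\<lambda>h. R x ** T h ** R x)) (at x)"
proof -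
  obtain K where K: "0 \<le> K" "\<And>h. norm (T h) \<le> norm h * K"
    using bounded_linear.nonneg_bounded[OF linear_conv_bounded_linear[THEN iffD1, OF lin_T]] by blast
  have "linear (\<lambda>h. R x ** T h ** R x)"
    using linear_compose[OF lin_T linear_matrix_mult_conj[of "R x" "R x"]] by (simp add: o_def)
  then have bl: "bounded_linear (\<lambda>h. R x ** T h ** R x)"
    by (simp add: linear_conv_bounded_linear)
  have diff: "R y - R x = R y ** T (y - x) ** R x" for y
  proof -
    have "(mat z - T x - Y) - (mat z - T y - Y) = T (y - x)"
      by (simp add: linear_diff[OF lin_T])
    then show ?thesis
      using matrix_inv_diff[of "mat z - T y - Y" "mat z - T x - Y"] R_inv[of x] R_inv[of y]
      by (simp add: R_def)
  qed
  show ?thesis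
  proof (rule has_derivative_quadratic_remainder[OF bl])
    fix y
    let ?D = "T (y - x)"
    \<comment> \<open>Applying the resolvent identity a second time makes the remainder quadratic in
      \<open>y - x\<close>.\<close>
    have "R y - R x - R x ** ?D ** R x = (R y - R x) ** ?D ** R x"
      by (subst diff) (simp add: matrix_mult_diff_distribs)
    also have "\<dots> = R y ** (?D ** (R x ** (?D ** R x)))"
      by (simp add: diff matrix_mul_assoc)
    also have "norm \<dots> \<le> op_norm (R y) * (op_norm ?D * (op_norm (R x) * (norm ?D * op_norm (R x))))"
      by (intro order_trans[OF norm_mul_left] mult_left_mono norm_mul_right op_norm_nonneg)
    also have "\<dots> \<le> 1 / \<eta> * (norm ?D * (1 / \<eta> * (norm ?D * (1 / \<eta>))))"
      using Im_z by (intro mult_mono R_inv op_norm_le_norm mult_nonneg_nonneg op_norm_nonneg) auto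
    also have "\<dots> \<le> 1 / \<eta> * ((norm (y - x) * K) * (1 / \<eta> * ((norm (y - x) * K) * (1 / \<eta>))))"
      using Im_z K(1) by (intro mult_mono K mult_nonneg_nonneg) auto
    also have "\<dots> = K\<^sup>2 / \<eta> ^ 3 * (norm (y - x))\<^sup>2"
      by (simp add: power2_eq_square power3_eq_cube mult_ac)
    finally show "norm (R y - R x - R x ** ?D ** R x) \<le> K\<^sup>2 / \<eta> ^ 3 * (norm (y - x))\<^sup>2" .
  qed
qed

lemma R_trace_has_derivative:
  "((\<lambda>x. trace (B ** R x)) has_derivative (\<lambda>h. trace (B ** (R x ** T h ** R x)))) (at x)"
  by (rule bounded_linear.has_derivative[OF _ R_has_derivative])
    (simp add: linear_conv_bounded_linear[symmetric] linear_trace_mul)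

lemma R_trace_bound: "norm (trace (B ** R x)) \<le> real CARD('n) * (op_norm B * (1 / \<eta>))"
  by (intro order_trans[OF norm_trace_le] mult_left_mono order_trans[OF op_norm_mul] R_inv op_norm_nonneg) auto

text \<open>Since each \<open>T b\<close> is Hermitian, the conjugate of one trace merely swaps its
  indices, and \<open>cov_T\<close> contracts the resulting fourfold sum.\<close>

lemma sum_trace_T:
  "(\<Sum>b\<in>Basis. (norm (trace (T b ** A)))\<^sup>2) = (\<Sum>i\<in>UNIV. \<Sum>j\<in>UNIV. S $ i $ j * (norm (A $ j $ i))\<^sup>2)"
proof -
  have herm: "cnj (T b $ k $ l) = T b $ l $ k" for b k l
    using herm_T[of b] by (simp add: hermitian_mat_def adj_mat_def vec_eq_iff)
  have "complex_of_real (\<Sum>b\<in>Basis. (norm (trace (T b ** A)))\<^sup>2) = (\<Sum>b\<in>Basis. trace (T b ** A) * cnj (trace (T b ** A)))"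
    by (simp only: of_real_sum complex_norm_square)
  also have "\<dots> = (\<Sum>b\<in>Basis. (\<Sum>i\<in>UNIV. \<Sum>j\<in>UNIV. T b $ i $ j * A $ j $ i)
      * (\<Sum>k\<in>UNIV. \<Sum>l\<in>UNIV. T b $ l $ k * cnj (A $ l $ k)))"
    by (simp add: trace_mul_eq herm)
  also have "\<dots> = (\<Sum>b\<in>Basis. \<Sum>i\<in>UNIV. \<Sum>j\<in>UNIV. \<Sum>k\<in>UNIV. \<Sum>l\<in>UNIV.
      A $ j $ i * cnj (A $ l $ k) * (T b $ i $ j * T b $ l $ k))"
    unfolding sum_distrib_right unfolding sum_distrib_left by (intro sum.cong refl) (simp only: mult_ac)
  also have "\<dots> = (\<Sum>i\<in>UNIV. \<Sum>j\<in>UNIV. \<Sum>k\<in>UNIV. \<Sum>l\<in>UNIV. \<Sum>b\<in>Basis.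
      A $ j $ i * cnj (A $ l $ k) * (T b $ i $ j * T b $ l $ k))"
    by (subst sum.swap, intro sum.cong refl, subst sum.swap, intro sum.cong refl,
        subst sum.swap, intro sum.cong refl, subst sum.swap, rule refl)
  also have "\<dots> = (\<Sum>i\<in>UNIV. \<Sum>j\<in>UNIV. \<Sum>k\<in>UNIV. \<Sum>l\<in>UNIV.
      if l = j then (if k = i then A $ j $ i * cnj (A $ j $ i) * complex_of_real (S $ i $ j) else 0) else 0)"
    unfolding sum_distrib_left[symmetric] cov_T by (intro sum.cong refl) auto
  also have "\<dots> = (\<Sum>i\<in>UNIV. \<Sum>j\<in>UNIV. A $ j $ i * cnj (A $ j $ i) * complex_of_real (S $ i $ j))"
    by simp
  also have "\<dots> = complex_of_real (\<Sum>i\<in>UNIV. \<Sum>j\<in>UNIV. S $ i $ j * (norm (A $ j $ i))\<^sup>2)"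
    by (simp only: of_real_sum of_real_mult complex_norm_square mult_ac)
  finally show ?thesis by (simp only: of_real_eq_iff)
qed

text \<open>Cyclicity of the trace isolates \<open>T b\<close> against
  \<open>R x ** B ** R x\<close>, whose Hilbert--Schmidt norm is at most
  \<open>\<beta> / \<eta>\<^sup>2\<close>.\<close>

lemma R_trace_gradient:
  assumes "norm B \<le> \<beta>"
  shows "(\<Sum>b\<in>Basis. (norm (trace (B ** (R x ** T b ** R x))))\<^sup>2) \<le> (\<sigma> * \<beta> / \<eta>\<^sup>2)\<^sup>2"
proof -
  define A where "A = R x ** B ** R x"
  have "trace (B ** (R x ** T b ** R x)) = trace (T b ** A)" for b
    using trace_mul_commute[of "B ** R x" "T b ** R x"]
      trace_mul_commute[of "B" "R x ** T b ** R x"]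
      trace_mul_commute[of "R x" "T b ** R x ** B"]
    by (simp add: A_def matrix_mul_assoc)
  then have "(\<Sum>b\<in>Basis. (norm (trace (B ** (R x ** T b ** R x))))\<^sup>2)
      = (\<Sum>i\<in>UNIV. \<Sum>j\<in>UNIV. S $ i $ j * (norm (A $ j $ i))\<^sup>2)"
    by (simp add: sum_trace_T)
  also have "\<dots> \<le> (\<Sum>i\<in>UNIV. \<Sum>j\<in>UNIV. \<sigma>\<^sup>2 * (norm (A $ j $ i))\<^sup>2)"
    by (intro sum_mono mult_right_mono S_le) auto
  also have "\<dots> = (\<sigma> * norm A)\<^sup>2"
    unfolding power_mult_distrib norm_mat_power2[of A] sum_distrib_left by (rule sum.swap)
  also have "\<dots> \<le> (\<sigma> * (1 / \<eta> * \<beta> * (1 / \<eta>)))\<^sup>2"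
  proof (intro power_mono mult_left_mono)
    have "norm A \<le> op_norm (R x) * norm B * op_norm (R x)"
      unfolding A_def by (rule order_trans[OF norm_mul_right]) (intro mult_right_mono norm_mul_left op_norm_nonneg)
    also have "\<dots> \<le> 1 / \<eta> * \<beta> * (1 / \<eta>)"
      using Im_z assms order_trans[OF norm_ge_zero assms]
      by (intro mult_mono R_inv mult_nonneg_nonneg op_norm_nonneg) auto
    finally show "norm A \<le> 1 / \<eta> * \<beta> * (1 / \<eta>)" .
  qed (use \<sigma>_pos in auto)
  also have "\<sigma> * (1 / \<eta> * \<beta> * (1 / \<eta>)) = \<sigma> * \<beta> / \<eta>\<^sup>2" by (simp add: power2_eq_square)
  finally show ?thesis .
qed

lemma R_trace_concentration:
  assumes "norm B \<le> \<beta>" "0 < \<beta>"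
  defines "L \<equiv> \<sigma> * \<beta> / \<eta>\<^sup>2"
  shows "(\<integral>x. (norm (trace (B ** R x) - (\<integral>y. trace (B ** R y) \<partial>std_gauss)))\<^sup>2 \<partial>std_gauss) \<le> L\<^sup>2"
    and "0 \<le> s \<Longrightarrow> measure std_gauss {x. norm (trace (B ** R x) - (\<integral>y. trace (B ** R y) \<partial>std_gauss)) \<ge> s}
      \<le> 2 * exp (- s\<^sup>2 / (2 * L\<^sup>2))"
proof -
  have L: "0 < L" using assms \<sigma>_pos Im_z by (simp add: L_def)
  note conc = std_gauss_concentration[OF R_trace_has_derivative R_trace_bound L, unfolded L_def, OF R_trace_gradient[OF assms(1)]]
  show "(\<integral>x. (norm (trace (B ** R x) - (\<integral>y. trace (B ** R y) \<partial>std_gauss)))\<^sup>2 \<partial>std_gauss) \<le> L\<^sup>2"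
    unfolding L_def by (rule conc(1))
  show "0 \<le> s \<Longrightarrow> measure std_gauss {x. norm (trace (B ** R x) - (\<integral>y. trace (B ** R y) \<partial>std_gauss)) \<ge> s}
      \<le> 2 * exp (- s\<^sup>2 / (2 * L\<^sup>2))"
    unfolding L_def by (rule conc(2))
qed

subsection \<open>The expected resolvent\<close>

definition ER :: "complex^'n^'n"
  where "ER = (\<chi> i j. \<integral>x. R x $ i $ j \<partial>std_gauss)"

lemma R_entry_has_derivative: "((\<lambda>x. R x $ i $ j) has_derivative (\<lambda>h. (R x ** T h ** R x) $ i $ j)) (at x)"
  by (intro bounded_linear.has_derivative[OF bounded_linear_vec_nth] R_has_derivative)

lemma R_entry_le: "norm (R x $ i $ j) \<le> 1 / \<eta>"
  using norm_entry_le_op_norm R_inv(3) by (rule order_trans)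

lemma R_entry_measurable [measurable]: "(\<lambda>x. R x $ i $ j) \<in> borel_measurable borel"
  by (rule borel_measurable_has_derivative(1)[OF R_entry_has_derivative])

lemma R_entry_integrable: "integrable std_gauss (\<lambda>x. R x $ i $ j)"
  by (rule std_gauss.integrable_const_bound[OF AE_I2[OF R_entry_le]]) simp

lemma R_entry_mult_integrable: "integrable std_gauss (\<lambda>x. R x $ i $ j * R x $ k $ l)"
proof (rule std_gauss.integrable_const_bound[OF AE_I2])
  show "norm (R x $ i $ j * R x $ k $ l) \<le> 1 / \<eta> * (1 / \<eta>)" for x
    unfolding norm_mult using Im_z by (intro mult_mono R_entry_le) auto
qed simp

lemma trace_ER: "(\<integral>x. trace (B ** R x) \<partial>std_gauss) = trace (B ** ER)"
  unfolding trace_mul_eq ER_def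
  by (simp add: Bochner_Integration.integral_sum R_entry_integrable)

lemma Im_ER_diag: "Im (ER $ i $ i) \<le> 0"
proof -
  have "Im (ER $ i $ i) = (\<integral>x. Im (R x $ i $ i) \<partial>std_gauss)"
    by (simp add: ER_def integral_Im R_entry_integrable)
  also have "\<dots> \<le> (\<integral>x. 0 \<partial>(std_gauss :: 'a measure))"
    by (intro integral_mono integrable_Im R_entry_integrable integrable_zero less_imp_le[OF Im_R_diag])
  finally show ?thesis by simp
qed

definition diag_ER :: "complex^'n" where "diag_ER = (\<chi> i. ER $ i $ i)"

text \<open>The intermediate comparison matrix: its self-energy is built from the true mean
  diagonal, not from a solution of the Dyson equation.\<close>

definition ER_approx :: "complex^'n^'n"
  where "ER_approx = matrix_inv (dyson S Y (\<chi> i. z) diag_ER)"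

lemma dissipative_dyson_ER: "dissipative \<eta> (dyson S Y (\<chi> i. z) diag_ER)"
  by (rule dissipative_dyson[OF herm_Y S_nonneg]) (auto simp: diag_ER_def Im_ER_diag)

lemmas ER_approx_inv = dissipative_inverse[OF dissipative_dyson_ER Im_z, folded ER_approx_def]

definition \<rho> :: "'n \<Rightarrow> 'a \<Rightarrow> complex"
  where "\<rho> i x = (\<Sum>j\<in>UNIV. complex_of_real (S $ i $ j) * R x $ j $ j)"

definition E\<rho> :: "'n \<Rightarrow> complex"
  where "E\<rho> i = (\<Sum>j\<in>UNIV. complex_of_real (S $ i $ j) * ER $ j $ j)"

text \<open>The covariance between the random self-energy \<open>\<rho> i\<close> and a resolvent
  entry, which is what prevents the averaged equation from closing.\<close>

definition err :: "complex^'n^'n"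
  where "err = (\<chi> i l. \<integral>x. (\<rho> i x - E\<rho> i) * R x $ i $ l \<partial>std_gauss)"

lemma \<rho>_measurable [measurable]: "\<rho> i \<in> borel_measurable borel"
  unfolding \<rho>_def[abs_def] by measurable

lemma \<rho>_R_integrable: "integrable std_gauss (\<lambda>x. \<rho> i x * R x $ k $ l)"
  unfolding \<rho>_def sum_distrib_right mult.assoc
  by (intro Bochner_Integration.integrable_sum integrable_mult_right R_entry_mult_integrable)

lemma err_integrable: "integrable std_gauss (\<lambda>x. (\<rho> i x - E\<rho> i) * R x $ k $ l)"
  unfolding left_diff_distrib
  by (intro Bochner_Integration.integrable_diff \<rho>_R_integrable integrable_mult_right R_entry_integrable)

lemma T_entry: "T x $ i $ j = (\<Sum>b\<in>Basis. (x \<bullet> b) *\<^sub>R T b $ i $ j)"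
proof -
  have "T x = T (\<Sum>b\<in>Basis. (x \<bullet> b) *\<^sub>R b)" by (simp only: euclidean_representation)
  also have "\<dots> = (\<Sum>b\<in>Basis. (x \<bullet> b) *\<^sub>R T b)"
    by (simp only: linear_sum[OF lin_T] linear_scale[OF lin_T])
  finally show ?thesis by simp
qed

lemma inner_R_entry_integrable:
  assumes "b \<in> Basis"
  shows "integrable std_gauss (\<lambda>x. (x \<bullet> b) *\<^sub>R R x $ j $ l)"
proof (rule Bochner_Integration.integrable_bound)
  show "integrable std_gauss (\<lambda>x. \<bar>x \<bullet> b\<bar> * (1 / \<eta>))"
    by (intro integrable_mult_left integrable_std_gauss_inner assms)
  have "norm ((x \<bullet> b) *\<^sub>R R x $ j $ l) \<le> \<bar>x \<bullet> b\<bar> * (1 / \<eta>)" for x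
    unfolding norm_scaleR by (intro mult_left_mono R_entry_le) auto
  then show "AE x in std_gauss. norm ((x \<bullet> b) *\<^sub>R R x $ j $ l) \<le> norm (\<bar>x \<bullet> b\<bar> * (1 / \<eta>))"
    using Im_z by (auto intro!: AE_I2 simp: abs_mult)
qed simp

lemma R_stein:
  assumes b: "b \<in> Basis"
  shows "(\<integral>x. (x \<bullet> b) *\<^sub>R R x $ j $ l \<partial>std_gauss) = (\<integral>x. (R x ** T b ** R x) $ j $ l \<partial>std_gauss)"
proof (rule std_gauss_stein[OF b R_entry_has_derivative R_entry_le])
  fix x
  show "norm ((R x ** T b ** R x) $ j $ l) \<le> 1 / \<eta> * op_norm (T b) * (1 / \<eta>)"
    by (rule order_trans[OF norm_entry_le_op_norm]) (intro op_norm_mul3_le R_inv order_refl)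
qed

lemma TR_integrable: "integrable std_gauss (\<lambda>x. T x $ i $ j * R x $ j $ l)"
proof -
  have "T x $ i $ j * R x $ j $ l = (\<Sum>b\<in>Basis. T b $ i $ j * ((x \<bullet> b) *\<^sub>R R x $ j $ l))" for x
    by (subst T_entry) (simp add: sum_distrib_right)
  then show ?thesis
    by (simp only:) (intro Bochner_Integration.integrable_sum integrable_mult_right inner_R_entry_integrable)
qed

lemma RTR_entry: "(R x ** T b ** R x) $ j $ l = (\<Sum>k\<in>UNIV. \<Sum>m\<in>UNIV. R x $ j $ m * T b $ m $ k * R x $ k $ l)"
  by (simp add: matrix_matrix_mult_def sum_distrib_right)

text \<open>Gaussian integration by parts in each coordinate. Of the double sum in
  \<open>R T R\<close>, the covariance \<open>cov_T\<close> keeps the single term with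
  \<open>m = j\<close> and \<open>k = i\<close>.\<close>

lemma expectation_TR:
  "(\<integral>x. T x $ i $ j * R x $ j $ l \<partial>std_gauss) = complex_of_real (S $ i $ j) * (\<integral>x. R x $ j $ j * R x $ i $ l \<partial>std_gauss)"
proof -
  have RTR_int: "integrable std_gauss (\<lambda>x. (R x ** T b ** R x) $ j $ l)" for b
    unfolding RTR_entry
    by (intro Bochner_Integration.integrable_sum)
      (simp add: mult.commute[of "R _ $ j $ _"] mult.assoc R_entry_mult_integrable)
  have "(\<integral>x. T x $ i $ j * R x $ j $ l \<partial>std_gauss)
      = (\<integral>x. (\<Sum>b\<in>Basis. T b $ i $ j * ((x \<bullet> b) *\<^sub>R R x $ j $ l)) \<partial>std_gauss)"
    by (subst T_entry) (simp add: sum_distrib_right)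
  also have "\<dots> = (\<Sum>b\<in>Basis. \<integral>x. T b $ i $ j * ((x \<bullet> b) *\<^sub>R R x $ j $ l) \<partial>std_gauss)"
    by (intro Bochner_Integration.integral_sum integrable_mult_right inner_R_entry_integrable)
  also have "\<dots> = (\<Sum>b\<in>Basis. \<integral>x. T b $ i $ j * (R x ** T b ** R x) $ j $ l \<partial>std_gauss)"
    by (intro sum.cong refl) (simp only: integral_mult_right_zero R_stein)
  also have "\<dots> = (\<integral>x. (\<Sum>b\<in>Basis. T b $ i $ j * (R x ** T b ** R x) $ j $ l) \<partial>std_gauss)"
    by (intro Bochner_Integration.integral_sum[symmetric] integrable_mult_right RTR_int)
  also have "\<dots> = (\<integral>x. complex_of_real (S $ i $ j) * (R x $ j $ j * R x $ i $ l) \<partial>std_gauss)"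
  proof (intro Bochner_Integration.integral_cong refl)
    fix x
    have "(\<Sum>b\<in>Basis. T b $ i $ j * (R x ** T b ** R x) $ j $ l)
        = (\<Sum>b\<in>Basis. \<Sum>k\<in>UNIV. \<Sum>m\<in>UNIV. R x $ j $ m * R x $ k $ l * (T b $ i $ j * T b $ m $ k))"
      unfolding RTR_entry sum_distrib_left by (intro sum.cong refl) (simp only: mult_ac)
    also have "\<dots> = (\<Sum>k\<in>UNIV. \<Sum>m\<in>UNIV. \<Sum>b\<in>Basis. R x $ j $ m * R x $ k $ l * (T b $ i $ j * T b $ m $ k))"
      by (subst sum.swap, intro sum.cong refl, rule sum.swap)
    also have "\<dots> = (\<Sum>k\<in>UNIV. \<Sum>m\<in>UNIV. if m = j then (if k = i then R x $ j $ j * R x $ i $ l * complex_of_real (S $ i $ j) else 0) else 0)"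
      unfolding sum_distrib_left[symmetric] cov_T by (intro sum.cong refl) auto
    also have "\<dots> = complex_of_real (S $ i $ j) * (R x $ j $ j * R x $ i $ l)" by simp
    finally show "(\<Sum>b\<in>Basis. T b $ i $ j * (R x ** T b ** R x) $ j $ l)
      = complex_of_real (S $ i $ j) * (R x $ j $ j * R x $ i $ l)" .
  qed
  finally show ?thesis by simp
qed

text \<open>The mean of \<open>(mat z - T x - Y) ** R x = mat 1\<close>: integration by parts turns
  the \<open>T\<close> term into the mean of \<open>\<rho> i * R\<close>, which splits into the
  product of the means and the covariance.\<close>

lemma master_equation: "dyson S Y (\<chi> i. z) diag_ER ** ER = mat 1 + err"
proof -
  have "(dyson S Y (\<chi> i. z) diag_ER ** ER) $ i $ l = (mat 1 + err) $ i $ l" for i l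
  proof -
    have pt: "z * R x $ i $ l - (\<Sum>j\<in>UNIV. T x $ i $ j * R x $ j $ l) - (\<Sum>j\<in>UNIV. Y $ i $ j * R x $ j $ l)
        = (mat 1 :: complex^'n^'n) $ i $ l" for x
    proof -
      have "(\<Sum>j\<in>UNIV. (mat z :: complex^'n^'n) $ i $ j * R x $ j $ l) = (\<Sum>j\<in>UNIV. if j = i then z * R x $ i $ l else 0)"
        by (intro sum.cong refl) (auto simp: mat_def)
      then have "((mat z - T x - Y) ** R x) $ i $ l = z * R x $ i $ l - (\<Sum>j\<in>UNIV. T x $ i $ j * R x $ j $ l) - (\<Sum>j\<in>UNIV. Y $ i $ j * R x $ j $ l)"
        by (simp add: matrix_matrix_mult_def left_diff_distrib sum_subtractf)
      then show ?thesis by (simp add: R_inv)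
    qed
    have "(mat 1 :: complex^'n^'n) $ i $ l = (\<integral>x. (mat 1 :: complex^'n^'n) $ i $ l \<partial>(std_gauss :: 'a measure))" by simp
    also have "\<dots> = (\<integral>x. z * R x $ i $ l - (\<Sum>j\<in>UNIV. T x $ i $ j * R x $ j $ l) - (\<Sum>j\<in>UNIV. Y $ i $ j * R x $ j $ l) \<partial>std_gauss)"
      by (simp only: pt)
    also have "\<dots> = z * ER $ i $ l - (\<Sum>j\<in>UNIV. \<integral>x. T x $ i $ j * R x $ j $ l \<partial>std_gauss) - (\<Sum>j\<in>UNIV. Y $ i $ j * ER $ j $ l)"
      by (simp add: Bochner_Integration.integral_diff Bochner_Integration.integral_sum Bochner_Integration.integrable_diff
          Bochner_Integration.integrable_sum R_entry_integrable TR_integrable ER_def)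
    also have "(\<Sum>j\<in>UNIV. \<integral>x. T x $ i $ j * R x $ j $ l \<partial>std_gauss) = (\<integral>x. \<rho> i x * R x $ i $ l \<partial>std_gauss)"
      by (simp add: expectation_TR \<rho>_def sum_distrib_right mult.assoc Bochner_Integration.integral_sum R_entry_mult_integrable)
    also have "\<dots> = err $ i $ l + E\<rho> i * ER $ i $ l"
      by (simp add: err_def ER_def left_diff_distrib Bochner_Integration.integral_diff \<rho>_R_integrable R_entry_integrable)
    finally have "(z - E\<rho> i) * ER $ i $ l - (\<Sum>j\<in>UNIV. Y $ i $ j * ER $ j $ l) = (mat 1 + err) $ i $ l"
      by (simp add: algebra_simps)
    moreover have "(dyson S Y (\<chi> i. z) diag_ER ** ER) $ i $ l = (z - E\<rho> i) * ER $ i $ l - (\<Sum>j\<in>UNIV. Y $ i $ j * ER $ j $ l)"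
    proof -
      have "(\<Sum>j\<in>UNIV. diag_mat (\<chi> i. z - E\<rho> i) $ i $ j * ER $ j $ l) = (\<Sum>j\<in>UNIV. if j = i then (z - E\<rho> i) * ER $ i $ l else 0)"
        by (intro sum.cong refl) (auto simp: diag_mat_def)
      then show ?thesis
        by (simp add: matrix_matrix_mult_def dyson_def left_diff_distrib sum_subtractf diag_ER_def E\<rho>_def)
    qed
    ultimately show ?thesis by simp
  qed
  then show ?thesis by (simp add: vec_eq_iff)
qed

end

text \<open>Brings an entry of the compression into the form covered by the trace concentration
  bound.\<close>

lemma compress_entry:
  fixes U :: "complex^'k^'n"
  shows "(adj_mat U ** A ** U) $ a $ b = trace ((\<chi> i j. U $ i $ b * cnj (U $ j $ a)) ** A)"
  unfolding trace_mul_eq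
  by (simp add: matrix_matrix_mult_def adj_mat_def sum_distrib_right sum_distrib_left mult_ac)

lemma norm_column_isometry:
  fixes U :: "complex^'k^'n"
  assumes "adj_mat U ** U = mat 1"
  shows "(\<Sum>i\<in>UNIV. (norm (U $ i $ a))\<^sup>2) = 1"
proof -
  have "complex_of_real (\<Sum>i\<in>UNIV. (norm (U $ i $ a))\<^sup>2) = (adj_mat U ** U) $ a $ a"
    by (simp only: of_real_sum complex_norm_square) (simp add: matrix_matrix_mult_def adj_mat_def mult.commute)
  also have "\<dots> = complex_of_real 1" by (simp add: assms mat_def)
  finally show ?thesis by (simp only: of_real_eq_iff)
qed

section \<open>From the expected resolvent to the solution of the Dyson equation\<close>

context gaussian_resolvent
begin

text \<open>Bounds the standard deviation of each \<open>\<rho> i\<close>, a trace against a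
  diagonal matrix of Hilbert--Schmidt norm at most \<open>sqrt N * \<sigma>\<^sup>2\<close>.\<close>

definition \<tau> :: real where "\<tau> = sqrt (real CARD('n)) * \<sigma> ^ 3 / \<eta>\<^sup>2"

lemma \<tau>_pos: "0 < \<tau>" using \<sigma>_pos Im_z by (simp add: \<tau>_def)

lemma trace_diag_mul: "trace (diag_mat v ** A) = (\<Sum>j\<in>UNIV. v $ j * A $ j $ j)"
proof -
  have "(\<Sum>j\<in>UNIV. diag_mat v $ i $ j * A $ j $ i) = (\<Sum>j\<in>UNIV. if j = i then v $ i * A $ i $ i else 0)" for i
    by (intro sum.cong refl) (auto simp: diag_mat_def)
  then show ?thesis unfolding trace_mul_eq by simp
qed

lemma \<rho>_variance: "(\<integral>x. (norm (\<rho> i x - E\<rho> i))\<^sup>2 \<partial>std_gauss) \<le> \<tau>\<^sup>2"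
proof -
  define D where "D = diag_mat (\<chi> j. complex_of_real (S $ i $ j))"
  have "(norm D)\<^sup>2 = (\<Sum>a\<in>UNIV. \<Sum>b\<in>UNIV. if b = a then (S $ i $ a)\<^sup>2 else 0)"
    unfolding norm_mat_power2 by (intro sum.cong refl) (auto simp: D_def diag_mat_def)
  also have "\<dots> = (\<Sum>a\<in>UNIV. (S $ i $ a)\<^sup>2)" by simp
  also have "\<dots> \<le> (\<Sum>a\<in>(UNIV :: 'n set). (\<sigma>\<^sup>2)\<^sup>2)"
    by (intro sum_mono power_mono S_le S_nonneg)
  also have "\<dots> = (sqrt (real CARD('n)) * \<sigma>\<^sup>2)\<^sup>2" by (simp add: power_mult_distrib)
  finally have D: "norm D \<le> sqrt (real CARD('n)) * \<sigma>\<^sup>2"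
    by (rule power2_le_imp_le) simp
  have "\<rho> i x = trace (D ** R x)" for x by (simp add: D_def trace_diag_mul \<rho>_def)
  moreover have "E\<rho> i = (\<integral>x. trace (D ** R x) \<partial>std_gauss)"
    unfolding trace_ER by (simp add: D_def trace_diag_mul E\<rho>_def)
  ultimately have "(\<integral>x. (norm (\<rho> i x - E\<rho> i))\<^sup>2 \<partial>std_gauss) \<le> (\<sigma> * (sqrt (real CARD('n)) * \<sigma>\<^sup>2) / \<eta>\<^sup>2)\<^sup>2"
    using R_trace_concentration(1)[OF D] \<sigma>_pos by simp
  also have "\<sigma> * (sqrt (real CARD('n)) * \<sigma>\<^sup>2) / \<eta>\<^sup>2 = \<tau>"
    by (simp add: \<tau>_def power2_eq_square power3_eq_cube mult_ac)
  finally show ?thesis .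
qed

text \<open>In the quadratic form the whole vector \<open>R x *v v\<close> is kept together and
  bounded by \<open>norm v / \<eta>\<close>; only the variances of the \<open>\<rho> i\<close>,
  weighted by the entries of \<open>u\<close>, are summed. This avoids any loss in the
  dimension.\<close>

lemma op_norm_err: "op_norm err \<le> \<tau> / \<eta>"
proof (rule op_norm_cdotI)
  show "0 \<le> \<tau> / \<eta>" using \<tau>_pos Im_z by simp
  fix u v
  show "norm (cdot u (err *v v)) \<le> \<tau> / \<eta> * norm u * norm v"
  proof (cases "u = 0 \<or> v = 0")
    case True
    then show ?thesis by (auto simp: cdot_def)
  next
    case False
    \<comment> \<open>The weight in the inequality
      \<open>p * q \<le> p^2 / (2 * s) + s / 2 * q^2\<close> that balances its two terms after
      integration.\<close>
    define s where "s = norm u * \<tau> * \<eta> / norm v"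
    have s: "0 < s" using False \<tau>_pos Im_z by (simp add: s_def)
    define \<Delta> where "\<Delta> i x = \<rho> i x - E\<rho> i" for i x
    have [measurable]: "\<Delta> i \<in> borel_measurable borel" for i unfolding \<Delta>_def[abs_def] by measurable
    have \<Delta>_int: "integrable std_gauss (\<lambda>x. (norm (\<Delta> i x))\<^sup>2)" for i
    proof (rule std_gauss.integrable_const_bound[OF AE_I2])
      fix x
      have "norm (\<rho> i x) \<le> (\<Sum>j\<in>UNIV. norm (complex_of_real (S $ i $ j)) * (1 / \<eta>))"
        unfolding \<rho>_def by (rule order_trans[OF norm_sum]) (auto simp only: norm_mult intro!: sum_mono mult_left_mono R_entry_le norm_ge_zero)
      then have "norm (\<Delta> i x) \<le> (\<Sum>j\<in>UNIV. norm (complex_of_real (S $ i $ j)) * (1 / \<eta>)) + norm (E\<rho> i)"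
        unfolding \<Delta>_def by (intro order_trans[OF norm_triangle_ineq4] add_right_mono)
      then show "norm ((norm (\<Delta> i x))\<^sup>2) \<le> ((\<Sum>j\<in>UNIV. norm (complex_of_real (S $ i $ j)) * (1 / \<eta>)) + norm (E\<rho> i))\<^sup>2"
        by (simp add: power_mono)
    qed simp
    have eq: "cdot u (err *v v) = (\<integral>x. (\<Sum>i\<in>UNIV. cnj (u $ i) * (\<Delta> i x * (R x *v v) $ i)) \<partial>std_gauss)"
    proof -
      have int: "integrable std_gauss (\<lambda>x. v $ l * (\<Delta> i x * R x $ i $ l))" for i l
        unfolding \<Delta>_def by (intro integrable_mult_right err_integrable)
      have "cnj (u $ i) * (\<Delta> i x * (R x *v v) $ i) = (\<Sum>l\<in>UNIV. cnj (u $ i) * (v $ l * (\<Delta> i x * R x $ i $ l)))" for i x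
        by (simp add: matrix_vector_mult_def sum_distrib_left mult_ac)
      then have "(\<integral>x. (\<Sum>i\<in>UNIV. cnj (u $ i) * (\<Delta> i x * (R x *v v) $ i)) \<partial>std_gauss)
          = (\<integral>x. (\<Sum>i\<in>UNIV. \<Sum>l\<in>UNIV. cnj (u $ i) * (v $ l * (\<Delta> i x * R x $ i $ l))) \<partial>std_gauss)"
        by simp
      also have "\<dots> = (\<Sum>i\<in>UNIV. \<integral>x. (\<Sum>l\<in>UNIV. cnj (u $ i) * (v $ l * (\<Delta> i x * R x $ i $ l))) \<partial>std_gauss)"
        by (intro Bochner_Integration.integral_sum Bochner_Integration.integrable_sum integrable_mult_right[OF int])
      also have "\<dots> = (\<Sum>i\<in>UNIV. \<Sum>l\<in>UNIV. \<integral>x. cnj (u $ i) * (v $ l * (\<Delta> i x * R x $ i $ l)) \<partial>std_gauss)"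
        by (intro sum.cong refl Bochner_Integration.integral_sum integrable_mult_right[OF int])
      also have "\<dots> = (\<Sum>i\<in>UNIV. \<Sum>l\<in>UNIV. cnj (u $ i) * (v $ l * err $ i $ l))"
        by (simp add: err_def \<Delta>_def)
      also have "\<dots> = cdot u (err *v v)"
        by (simp add: cdot_def matrix_vector_mult_def sum_distrib_left mult_ac)
      finally show ?thesis ..
    qed
    let ?b = "\<lambda>x. (\<Sum>i\<in>UNIV. (norm (u $ i))\<^sup>2 / (2 * s) * (norm (\<Delta> i x))\<^sup>2) + s / 2 * (norm v / \<eta>)\<^sup>2"
    have pt: "norm (\<Sum>i\<in>UNIV. cnj (u $ i) * (\<Delta> i x * (R x *v v) $ i)) \<le> ?b x" for x
    proof -
      have am: "p * q \<le> p\<^sup>2 / (2 * s) + s / 2 * q\<^sup>2" for p q :: real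
      proof -
        have "0 \<le> (p - s * q)\<^sup>2 / (2 * s)" using s by simp
        also have "(p - s * q)\<^sup>2 / (2 * s) = p\<^sup>2 / (2 * s) + s / 2 * q\<^sup>2 - p * q"
          using s by (simp add: power2_diff field_simps power2_eq_square)
        finally show ?thesis by simp
      qed
      have "norm (\<Sum>i\<in>UNIV. cnj (u $ i) * (\<Delta> i x * (R x *v v) $ i))
          \<le> (\<Sum>i\<in>UNIV. (norm (u $ i) * norm (\<Delta> i x)) * norm ((R x *v v) $ i))"
        by (rule order_trans[OF norm_sum]) (simp add: norm_mult mult.assoc)
      also have "\<dots> \<le> (\<Sum>i\<in>UNIV. (norm (u $ i) * norm (\<Delta> i x))\<^sup>2 / (2 * s) + s / 2 * (norm ((R x *v v) $ i))\<^sup>2)"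
        by (intro sum_mono am)
      also have "\<dots> = (\<Sum>i\<in>UNIV. (norm (u $ i))\<^sup>2 / (2 * s) * (norm (\<Delta> i x))\<^sup>2) + s / 2 * (norm (R x *v v))\<^sup>2"
        unfolding norm_vec_power2[of "R x *v v"] sum_distrib_left sum.distrib
        by (simp add: power_mult_distrib)
      also have "\<dots> \<le> ?b x"
      proof (intro add_left_mono mult_left_mono power_mono)
        have "norm (R x *v v) \<le> 1 / \<eta> * norm v"
          by (rule order_trans[OF op_norm_mv]) (intro mult_right_mono R_inv norm_ge_zero)
        then show "norm (R x *v v) \<le> norm v / \<eta>" by simp
      qed (use s in auto)
      finally show ?thesis .
    qed
    have b_int: "integrable std_gauss ?b"
      by (intro Bochner_Integration.integrable_add Bochner_Integration.integrable_sum integrable_mult_right \<Delta>_int) simp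
    have "norm (cdot u (err *v v)) \<le> (\<integral>x. ?b x \<partial>std_gauss)"
      unfolding eq
    proof (rule order_trans[OF integral_norm_bound], rule integral_mono'[OF b_int pt])
      fix x show "0 \<le> ?b x" using s by (intro add_nonneg_nonneg sum_nonneg) auto
    qed
    also have "\<dots> = (\<Sum>i\<in>UNIV. (norm (u $ i))\<^sup>2 / (2 * s) * (\<integral>x. (norm (\<Delta> i x))\<^sup>2 \<partial>std_gauss)) + s / 2 * (norm v / \<eta>)\<^sup>2"
      by (subst Bochner_Integration.integral_add)
        (auto simp: Bochner_Integration.integral_sum \<Delta>_int simp del: times_divide_eq_left)
    also have "\<dots> \<le> (\<Sum>i\<in>UNIV. (norm (u $ i))\<^sup>2 / (2 * s) * \<tau>\<^sup>2) + s / 2 * (norm v / \<eta>)\<^sup>2"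
      unfolding \<Delta>_def using s by (intro add_right_mono sum_mono mult_left_mono \<rho>_variance) auto
    also have "\<dots> = (norm u)\<^sup>2 / (2 * s) * \<tau>\<^sup>2 + s / 2 * (norm v / \<eta>)\<^sup>2"
      by (simp add: norm_vec_power2[of u] sum_distrib_right sum_divide_distrib)
    also have "\<dots> = \<tau> / \<eta> * norm u * norm v"
      using False \<tau>_pos Im_z by (simp add: s_def field_simps power2_eq_square)
    finally show ?thesis .
  qed
qed

text \<open>Multiplying the averaged equation by \<open>ER_approx\<close> identifies the difference
  as \<open>ER_approx ** err\<close>.\<close>

lemma ER_approx_error: "op_norm (ER - ER_approx) \<le> \<tau> / \<eta>\<^sup>2"
proof -
  have "ER = ER_approx ** (dyson S Y (\<chi> i. z) diag_ER ** ER)"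
    by (simp add: matrix_mul_assoc ER_approx_inv)
  also have "\<dots> = ER_approx + ER_approx ** err"
    by (simp add: master_equation matrix_mult_add_distribs)
  finally have "ER - ER_approx = ER_approx ** err" by simp
  then have "op_norm (ER - ER_approx) \<le> op_norm ER_approx * op_norm err"
    by (simp add: op_norm_mul)
  also have "\<dots> \<le> 1 / \<eta> * (\<tau> / \<eta>)"
    using Im_z by (intro mult_mono ER_approx_inv op_norm_err op_norm_nonneg) auto
  finally show ?thesis by (simp add: power2_eq_square)
qed

lemma norm_S_sum_le:
  assumes "\<And>j. norm (f j) \<le> c"
  shows "norm (\<Sum>j\<in>UNIV. complex_of_real (S $ i $ j) * f j) \<le> real CARD('n) * \<sigma>\<^sup>2 * c"
proof -
  have "norm (\<Sum>j\<in>UNIV. complex_of_real (S $ i $ j) * f j) \<le> (\<Sum>j\<in>(UNIV :: 'n set). \<sigma>\<^sup>2 * c)"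
  proof (rule order_trans[OF norm_sum], rule sum_mono)
    fix j
    have "norm (complex_of_real (S $ i $ j) * f j) = S $ i $ j * norm (f j)"
      using S_nonneg by (simp add: norm_mult)
    also have "\<dots> \<le> \<sigma>\<^sup>2 * c" using S_nonneg by (intro mult_mono S_le assms) auto
    finally show "norm (complex_of_real (S $ i $ j) * f j) \<le> \<sigma>\<^sup>2 * c" .
  qed
  then show ?thesis by (simp add: mult.assoc)
qed

text \<open>
  The diagonal of \<open>ER_approx\<close> solves the Dyson equation exactly, at the spectral parameter
  \<open>z\<close> shifted by the image under \<open>S\<close> of the error.
\<close>

lemma deterministic_equivalent:
  fixes g :: "complex^'n"
  assumes g: "\<And>i. g $ i = matrix_inv (dyson S Y (\<chi> i. z) g) $ i $ i" "\<And>i. Im (g $ i) < 0"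
    and \<delta>: "0 < \<delta>"
  defines "\<kappa> \<equiv> real CARD('n) * \<sigma>\<^sup>2" and "e \<equiv> \<tau> / \<eta>\<^sup>2"
  assumes small: "\<kappa> * e \<le> (1 - \<delta>) * \<eta>"
  shows "op_norm (ER - matrix_inv (dyson S Y (\<chi> i. z) g)) \<le> e + \<kappa> / \<eta>\<^sup>2 * (e + \<kappa> * e / (\<delta> * \<eta>\<^sup>2))"
proof -
  define h where "h = (\<chi> i. ER_approx $ i $ i)"
  define r where "r j = ER $ j $ j - h $ j" for j
  \<comment> \<open>Chosen so that the self-energy of \<open>h\<close> at \<open>\<Lambda>\<close>
    reproduces that of \<open>diag_ER\<close> at \<open>z\<close>.\<close>
  define \<Lambda> where "\<Lambda> = (\<chi> i. z - (\<Sum>j\<in>UNIV. complex_of_real (S $ i $ j) * r j))"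
  have e0: "0 \<le> e" "0 \<le> \<kappa>" using \<tau>_pos by (auto simp: e_def \<kappa>_def)
  have r: "norm (r j) \<le> e" for j
    using norm_entry_le_op_norm[of "ER - ER_approx" j j] ER_approx_error by (simp add: r_def h_def e_def)
  have shift: "norm (\<Sum>j\<in>UNIV. complex_of_real (S $ i $ j) * r j) \<le> \<kappa> * e" for i
    unfolding \<kappa>_def by (rule norm_S_sum_le) (rule r)
  \<comment> \<open>The assumption \<open>small\<close> serves here: the shift may consume at most
    the fraction \<open>1 - \<delta>\<close> of the imaginary part.\<close>
  have Im_\<Lambda>: "\<delta> * \<eta> \<le> Im (\<Lambda> $ i)" for i
  proof -
    have "Im (\<Sum>j\<in>UNIV. complex_of_real (S $ i $ j) * r j) \<le> (1 - \<delta>) * \<eta>"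
      using abs_Im_le_cmod[of "\<Sum>j\<in>UNIV. complex_of_real (S $ i $ j) * r j"] shift[of i] small by linarith
    then show ?thesis unfolding \<Lambda>_def vec_lambda_beta minus_complex.simps by (simp add: algebra_simps)
  qed
  have dyson_h: "dyson S Y \<Lambda> h = dyson S Y (\<chi> i. z) diag_ER"
    unfolding dyson_def by (simp add: \<Lambda>_def r_def diag_ER_def sum_subtractf right_diff_distrib)
  have gh: "norm (g $ i - h $ i) \<le> \<kappa> * e / (\<eta> * (\<delta> * \<eta>))" for i
  proof (rule dyson_stability[OF herm_Y S_nonneg Im_z _ _ Im_\<Lambda> g])
    show "h $ i = matrix_inv (dyson S Y \<Lambda> h) $ i $ i" for i
      unfolding dyson_h by (simp add: h_def ER_approx_def)
    show "Im (h $ i) < 0" for i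
      using Im_dyson_inv_diag[OF herm_Y S_nonneg _ Im_z, of diag_ER "\<chi> i. z"]
      by (simp add: h_def ER_approx_def diag_ER_def Im_ER_diag)
    show "norm ((\<chi> i. z) $ i - \<Lambda> $ i) \<le> \<kappa> * e" for i
      using shift[of i] by (simp add: \<Lambda>_def)
  qed (use \<delta> Im_z in auto)
  let ?\<beta> = "e + \<kappa> * e / (\<delta> * \<eta>\<^sup>2)"
  have diff: "norm (ER $ j $ j - g $ j) \<le> ?\<beta>" for j
  proof -
    have "ER $ j $ j - g $ j = r j - (g $ j - h $ j)" by (simp add: r_def)
    also have "norm \<dots> \<le> e + \<kappa> * e / (\<eta> * (\<delta> * \<eta>))"
      by (rule order_trans[OF norm_triangle_ineq4 add_mono[OF r gh]])
    finally show ?thesis by (simp add: power2_eq_square mult_ac)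
  qed
  define Q where "Q = matrix_inv (dyson S Y (\<chi> i. z) g)"
  have dis: "dissipative \<eta> (dyson S Y (\<chi> i. z) g)"
    by (rule dissipative_dyson[OF herm_Y S_nonneg]) (auto intro: less_imp_le g(2))
  note Q_inv = dissipative_inverse[OF dis Im_z, folded Q_def]
  \<comment> \<open>Stability controls only diagonals. The resolvent identity lifts this to the full
    matrices, since the two Dyson matrices differ by \<open>diag_mat D\<close>.\<close>
  define D where "D = (\<chi> i. \<Sum>j\<in>UNIV. complex_of_real (S $ i $ j) * (ER $ j $ j - g $ j))"
  have "dyson S Y (\<chi> i. z) g - dyson S Y (\<chi> i. z) diag_ER = diag_mat D"
    by (simp add: dyson_def D_def diag_ER_def diag_mat_def vec_eq_iff right_diff_distrib sum_subtractf)
  then have "ER_approx - Q = ER_approx ** diag_mat D ** Q"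
    using matrix_inv_diff[OF ER_approx_inv(2)[unfolded ER_approx_def] Q_inv(1)[unfolded Q_def]]
    by (simp add: ER_approx_def Q_def)
  moreover have "op_norm (ER_approx ** diag_mat D ** Q) \<le> 1 / \<eta> * (\<kappa> * ?\<beta>) * (1 / \<eta>)"
  proof (intro op_norm_mul3_le ER_approx_inv Q_inv op_norm_diag_mat)
    show "norm (D $ i) \<le> \<kappa> * ?\<beta>" for i
      unfolding D_def \<kappa>_def vec_lambda_beta by (rule norm_S_sum_le) (use diff in \<open>simp add: \<kappa>_def\<close>)
  qed
  ultimately have "op_norm (ER_approx - Q) \<le> \<kappa> / \<eta>\<^sup>2 * ?\<beta>" by (simp add: power2_eq_square)
  moreover have "op_norm (ER - Q) \<le> op_norm (ER - ER_approx) + op_norm (ER_approx - Q)"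
    using op_norm_add[of "ER - ER_approx" "ER_approx - Q"] by simp
  ultimately show ?thesis using ER_approx_error unfolding Q_def e_def by linarith
qed

text \<open>If every entry of the centred compression is below \<open>s\<close>, its
  Hilbert--Schmidt norm is below \<open>k * s\<close>. A union bound over the \<open>k^2\<close>
  pairs of columns covers the complement, and compression does not increase the deterministic
  error.\<close>

lemma compressed_resolvent_concentration:
  fixes U :: "complex^'k^'n"
  assumes U: "adj_mat U ** U = mat 1" and s: "0 \<le> s" and Q: "op_norm (ER - Q) \<le> c"
  shows "measure std_gauss {x. real CARD('k) * s + c \<le> op_norm (adj_mat U ** (R x - Q) ** U)}
    \<le> 2 * (real CARD('k))\<^sup>2 * exp (- s\<^sup>2 / (2 * (\<sigma> / \<eta>\<^sup>2)\<^sup>2))"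
proof -
  define B where "B p = (\<chi> i j. U $ i $ snd p * cnj (U $ j $ fst p))" for p :: "'k \<times> 'k"
  define E where "E p = {x. s \<le> norm (trace (B p ** R x) - (\<integral>y. trace (B p ** R y) \<partial>std_gauss))}" for p
  have "norm (B p) \<le> 1" for p
  proof -
    have "(norm (B p))\<^sup>2 = (\<Sum>i\<in>UNIV. (norm (U $ i $ snd p))\<^sup>2) * (\<Sum>j\<in>UNIV. (norm (U $ j $ fst p))\<^sup>2)"
      unfolding norm_mat_power2 sum_distrib_right unfolding sum_distrib_left
      by (simp add: B_def norm_mult power_mult_distrib)
    then have "(norm (B p))\<^sup>2 = 1" by (simp add: norm_column_isometry[OF U])
    then show ?thesis using norm_ge_zero[of "B p"] by (auto simp: power2_eq_1_iff)
  qed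
  then have tail: "measure std_gauss (E p) \<le> 2 * exp (- s\<^sup>2 / (2 * (\<sigma> / \<eta>\<^sup>2)\<^sup>2))" for p
    unfolding E_def using R_trace_concentration(2)[of "B p" 1, OF _ _ s] by simp
  have [measurable]: "(\<lambda>x. trace (B p ** R x)) \<in> borel_measurable borel" for p
    by (rule borel_measurable_has_derivative(1)[OF R_trace_has_derivative])
  have Em: "E p \<in> sets std_gauss" for p
    unfolding E_def by simp
  have sub: "{x. real CARD('k) * s + c \<le> op_norm (adj_mat U ** (R x - Q) ** U)} \<subseteq> (\<Union>p\<in>UNIV. E p)"
  proof (rule subsetI, rule ccontr)
    fix x
    assume "x \<in> {x. real CARD('k) * s + c \<le> op_norm (adj_mat U ** (R x - Q) ** U)}"
      and nE: "x \<notin> (\<Union>p\<in>UNIV. E p)"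
    then have large: "real CARD('k) * s + c \<le> op_norm (adj_mat U ** (R x - Q) ** U)" by simp
    define V where "V = adj_mat U ** (R x - ER) ** U"
    have ent: "norm (V $ a $ b) < s" for a b
      using nE unfolding V_def compress_entry E_def
      by (auto simp: B_def trace_ER matrix_mult_diff_distribs trace_diff not_le dest!: spec[of _ "(a, b)"])
    then have s0: "0 < s" using norm_ge_zero le_less_trans by blast
    have "(norm V)\<^sup>2 < (\<Sum>a\<in>(UNIV :: 'k set). \<Sum>b\<in>(UNIV :: 'k set). s\<^sup>2)"
      unfolding norm_mat_power2 by (intro sum_strict_mono power_strict_mono ent) auto
    also have "\<dots> = (real CARD('k) * s)\<^sup>2" by (simp add: power2_eq_square)
    finally have "norm V < real CARD('k) * s"
      by (rule power_less_imp_less_base) (use s in simp)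
    then have "op_norm V < real CARD('k) * s" using op_norm_le_norm[of V] by linarith
    moreover have "adj_mat U ** (R x - Q) ** U = V + adj_mat U ** (ER - Q) ** U"
      by (simp add: V_def matrix_mult_diff_distribs)
    then have "op_norm (adj_mat U ** (R x - Q) ** U) \<le> op_norm V + op_norm (ER - Q)"
      using op_norm_add[of V "adj_mat U ** (ER - Q) ** U"] op_norm_compress[OF U, of "ER - Q"] by simp
    ultimately show False using large Q by linarith
  qed
  have "measure std_gauss {x. real CARD('k) * s + c \<le> op_norm (adj_mat U ** (R x - Q) ** U)}
      \<le> measure std_gauss (\<Union>p\<in>UNIV. E p)"
    using sub Em by (intro std_gauss.finite_measure_mono) auto
  also have "\<dots> \<le> (\<Sum>p\<in>UNIV. measure std_gauss (E p))"
    using Em by (intro std_gauss.finite_measure_subadditive_finite) auto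
  also have "\<dots> \<le> (\<Sum>p\<in>(UNIV :: ('k \<times> 'k) set). 2 * exp (- s\<^sup>2 / (2 * (\<sigma> / \<eta>\<^sup>2)\<^sup>2)))"
    by (intro sum_mono tail)
  also have "\<dots> = 2 * (real CARD('k))\<^sup>2 * exp (- s\<^sup>2 / (2 * (\<sigma> / \<eta>\<^sup>2)\<^sup>2))"
    by (simp add: power2_eq_square)
  finally show ?thesis .
qed

end

text \<open>Needed to transport the event from the Gaussian space to the given probability
  space.\<close>

lemma (in gaussian_resolvent) compressed_resolvent_measurable:
  "{x. c \<le> op_norm (adj_mat U ** (R x - Q) ** U)} \<in> sets borel"
proof -
  have "continuous_on UNIV R"
    using R_has_derivative by (auto intro!: continuous_at_imp_continuous_on has_derivative_continuous)
  then have c1: "continuous_on UNIV (\<lambda>x. R x - Q)" by (intro continuous_intros)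
  have c2: "continuous_on UNIV (\<lambda>X. adj_mat U ** X ** U)"
    using linear_matrix_mult_conj[of "adj_mat U" U]
    by (intro linear_continuous_on) (simp add: linear_conv_bounded_linear)
  have "continuous_on UNIV (\<lambda>x. adj_mat U ** (R x - Q) ** U)"
    by (rule continuous_on_compose2[OF c2 c1]) simp
  then have "continuous_on UNIV (\<lambda>x. op_norm (adj_mat U ** (R x - Q) ** U))"
    by (rule continuous_on_compose2[OF continuous_on_op_norm[of UNIV]]) simp
  then have "closed {x. c \<le> op_norm (adj_mat U ** (R x - Q) ** U)}"
    by (intro closed_Collect_le continuous_on_const)
  then show ?thesis by simp
qed

subsection \<open>The GUE with variance profile as an image of the standard Gaussian\<close>

lemma bij_betw_axis_axis:
  "bij_betw (\<lambda>(p, q). axis p (axis q 1)) UNIV (Basis :: (real^'n^'m) set)"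
  unfolding bij_betw_def
proof
  show "inj (\<lambda>(p, q). axis p (axis q 1) :: real^'n^'m)"
    by (auto simp: inj_on_def axis_eq_axis)
  show "range (\<lambda>(p, q). axis p (axis q 1)) = (Basis :: (real^'n^'m) set)"
    by (auto simp: Basis_vec_def image_iff)
qed

lemma sum_Basis_mat:
  "(\<Sum>b\<in>(Basis :: (real^'n^'m) set). f b) = (\<Sum>p\<in>UNIV. \<Sum>q\<in>UNIV. f (axis p (axis q 1)))"
  using sum.reindex_bij_betw[OF bij_betw_axis_axis, of f]
  by (simp add: sum.cartesian_product split_beta flip: UNIV_Times_UNIV)

text \<open>The real degrees of freedom are packed into one real matrix: for \<open>j < i\<close>,
  position \<open>(i, j)\<close> holds the real part and \<open>(j, i)\<close> the imaginary part of
  the same complex entry. Division by \<open>sqrt 2\<close> gives each part variance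
  \<open>1/2\<close>.\<close>

definition gue_map :: "((real, 'n::{finite,linorder}) vec, 'n) vec \<Rightarrow> ((real, 'n) vec, 'n) vec \<Rightarrow> ((complex, 'n) vec, 'n) vec"
  where "gue_map \<Gamma> x = (\<chi> i j. complex_of_real (sqrt (\<Gamma> $ i $ j / real CARD('n))) *
    (if i = j then complex_of_real (x $ i $ i)
     else if j < i then Complex (x $ i $ j) (x $ j $ i) / complex_of_real (sqrt 2)
     else Complex (x $ j $ i) (- x $ i $ j) / complex_of_real (sqrt 2)))"

lemma linear_gue_map: "linear (gue_map \<Gamma>)"
  by (rule linearI)
    (auto simp: gue_map_def vec_eq_iff complex_eq_iff algebra_simps add_divide_distrib diff_divide_distrib)

lemma hermitian_gue_map:
  assumes "transpose \<Gamma> = \<Gamma>"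
  shows "hermitian_mat (gue_map \<Gamma> x)"
proof -
  have "\<Gamma> $ j $ i = \<Gamma> $ i $ j" for i j
    using assms by (metis transpose_def vec_lambda_beta)
  then show ?thesis
    by (auto simp: hermitian_mat_def adj_mat_def gue_map_def vec_eq_iff complex_eq_iff not_less)
qed

text \<open>Off the diagonal, the square of a standard complex Gaussian has mean
  \<open>1/2 - 1/2 = 0\<close>, while its squared modulus has mean 1; hence only the transposed
  position correlates.\<close>

lemma gue_map_cov:
  fixes \<Gamma> :: "((real, 'n::{finite,linorder}) vec, 'n) vec"
  assumes sym: "transpose \<Gamma> = \<Gamma>" and nonneg: "\<And>i j. 0 \<le> \<Gamma> $ i $ j"
  shows "(\<Sum>b\<in>Basis. gue_map \<Gamma> b $ i $ j * gue_map \<Gamma> b $ k $ l) =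
    (if k = j \<and> l = i then complex_of_real (\<Gamma> $ i $ j / real CARD('n)) else 0)"
proof -
  define \<xi> :: "'n \<Rightarrow> 'n \<Rightarrow> ((real, 'n) vec, 'n) vec \<Rightarrow> complex" where
    "\<xi> i j x = (if i = j then complex_of_real (x $ i $ i)
     else if j < i then Complex (x $ i $ j) (x $ j $ i) / complex_of_real (sqrt 2)
     else Complex (x $ j $ i) (- x $ i $ j) / complex_of_real (sqrt 2))" for i j x
  define r where "r i j = complex_of_real (sqrt (\<Gamma> $ i $ j / real CARD('n)))" for i j
  have entry: "gue_map \<Gamma> x $ i $ j = r i j * \<xi> i j x" for i j x
    by (simp add: gue_map_def r_def \<xi>_def)
  have \<Gamma>sym: "\<Gamma> $ j $ i = \<Gamma> $ i $ j" for i j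
    using sym by (metis transpose_def vec_lambda_beta)
  have ax: "(axis p (axis q 1) :: ((real, 'n) vec, 'n) vec) $ i $ j = (if p = i then if q = j then 1 else 0 else 0)" for p q i j
    by (auto simp: axis_def)
  have s2: "complex_of_real (sqrt 2) * complex_of_real (sqrt 2) = 2"
    by (simp flip: of_real_mult)
  have single: "(\<Sum>p\<in>UNIV. \<Sum>q\<in>UNIV. (if p = a then if q = b then 1 else 0 else 0) * c p q) = c a b"
    for a b :: 'n and c :: "'n \<Rightarrow> 'n \<Rightarrow> complex"
  proof -
    have "(\<Sum>q\<in>UNIV. (if q = b then 1 else 0) * c a q) = (\<Sum>q\<in>UNIV. if q = b then c a q else 0)"
      by (intro sum.cong refl) auto
    then have "(\<Sum>q\<in>UNIV. (if p = a then if q = b then 1 else 0 else 0) * c p q) = (if p = a then c a b else 0)" for p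
      by (cases "p = a") simp_all
    then show ?thesis by simp
  qed
  \<comment> \<open>Contraction with an arbitrary array \<open>c\<close>, later taken to be the
    coefficients of the second entry; at most two unit matrices contribute.\<close>
  have pair: "(\<Sum>p\<in>UNIV. \<Sum>q\<in>UNIV. \<xi> i j (axis p (axis q 1)) * c p q) =
      (if i = j then c i i
       else if j < i then (c i j + \<i> * c j i) / complex_of_real (sqrt 2)
       else (c j i - \<i> * c i j) / complex_of_real (sqrt 2))" for c :: "'n \<Rightarrow> 'n \<Rightarrow> complex"
  proof -
    let ?I = "\<lambda>a b p q. (if p = a then if q = b then 1 else 0 else 0) :: complex"
    have eq: "\<xi> i j (axis p (axis q 1)) = (if i = j then ?I i i p q
       else if j < i then (?I i j p q + \<i> * ?I j i p q) / complex_of_real (sqrt 2)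
       else (?I j i p q - \<i> * ?I i j p q) / complex_of_real (sqrt 2))" for p q
      unfolding \<xi>_def ax by (auto simp: complex_eq_iff)
    consider "i = j" | "i \<noteq> j" "j < i" | "i \<noteq> j" "\<not> j < i" by blast
    then show ?thesis
    proof cases
      case 1
      then show ?thesis unfolding eq using single[of i i c] by simp
    next
      case 2
      then have "(\<Sum>p\<in>UNIV. \<Sum>q\<in>UNIV. \<xi> i j (axis p (axis q 1)) * c p q)
          = (\<Sum>p\<in>UNIV. \<Sum>q\<in>UNIV. (?I i j p q * c p q + \<i> * (?I j i p q * c p q)) / complex_of_real (sqrt 2))"
        unfolding eq by (intro sum.cong refl) (simp add: algebra_simps)
      also have "\<dots> = ((\<Sum>p\<in>UNIV. \<Sum>q\<in>UNIV. ?I i j p q * c p q) + \<i> * (\<Sum>p\<in>UNIV. \<Sum>q\<in>UNIV. ?I j i p q * c p q)) / complex_of_real (sqrt 2)"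
        by (simp only: sum_divide_distrib[symmetric] sum.distrib sum_distrib_left[symmetric])
      finally show ?thesis unfolding single using 2 by simp
    next
      case 3
      then have "(\<Sum>p\<in>UNIV. \<Sum>q\<in>UNIV. \<xi> i j (axis p (axis q 1)) * c p q)
          = (\<Sum>p\<in>UNIV. \<Sum>q\<in>UNIV. (?I j i p q * c p q - \<i> * (?I i j p q * c p q)) / complex_of_real (sqrt 2))"
        unfolding eq by (intro sum.cong refl) (simp add: algebra_simps)
      also have "\<dots> = ((\<Sum>p\<in>UNIV. \<Sum>q\<in>UNIV. ?I j i p q * c p q) - \<i> * (\<Sum>p\<in>UNIV. \<Sum>q\<in>UNIV. ?I i j p q * c p q)) / complex_of_real (sqrt 2)"
        by (simp only: sum_divide_distrib[symmetric] sum_subtractf sum_distrib_left[symmetric])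
      finally show ?thesis unfolding single using 3 by simp
    qed
  qed
  have main: "(\<Sum>p\<in>UNIV. \<Sum>q\<in>UNIV. \<xi> i j (axis p (axis q 1)) * \<xi> k l (axis p (axis q 1)))
      = (if k = j \<and> l = i then 1 else 0)"
    unfolding pair unfolding \<xi>_def ax
    by (auto simp: complex_eq_iff not_less Re_divide_of_real Im_divide_of_real real_div_sqrt)
  have "(\<Sum>b\<in>Basis. gue_map \<Gamma> b $ i $ j * gue_map \<Gamma> b $ k $ l)
      = r i j * r k l * (\<Sum>p\<in>UNIV. \<Sum>q\<in>UNIV. \<xi> i j (axis p (axis q 1)) * \<xi> k l (axis p (axis q 1)))"
    unfolding entry sum_Basis_mat sum_distrib_left by (intro sum.cong refl) (simp only: mult_ac)
  also have "\<dots> = (if k = j \<and> l = i then complex_of_real (\<Gamma> $ i $ j / real CARD('n)) else 0)"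
  proof -
    have "r i j * r j i = complex_of_real (\<Gamma> $ i $ j / real CARD('n))"
      unfolding r_def \<Gamma>sym[of j i] of_real_mult[symmetric] using nonneg by simp
    then show ?thesis unfolding main by auto
  qed
  finally show ?thesis .
qed

text \<open>Unpacks the entries into the coordinates expected by \<open>gue_map\<close>; the factor
  \<open>sqrt 2\<close> normalises every coordinate to variance 1.\<close>

definition gue_coords :: "('n::{finite,linorder} \<Rightarrow> 'n \<Rightarrow> 'w \<Rightarrow> complex) \<Rightarrow> 'w \<Rightarrow> ((real, 'n) vec, 'n) vec"
  where "gue_coords x \<omega> = (\<chi> i j. if i = j then Re (x i i \<omega>)
    else if j < i then sqrt 2 * Re (x i j \<omega>) else sqrt 2 * Im (x j i \<omega>))"

lemma gue_map_coords:
  fixes \<Gamma> :: "((real, 'n::{finite,linorder}) vec, 'n) vec"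
  assumes "gue_entries M x" "\<omega> \<in> space M"
  shows "gue_map \<Gamma> (gue_coords x \<omega>) $ i $ j =
    complex_of_real (sqrt (\<Gamma> $ i $ j)) * x i j \<omega> / complex_of_real (sqrt (real CARD('n)))"
proof -
  have c: "x i j \<omega> = cnj (x j i \<omega>)" for i j
    using assms unfolding gue_entries_def by blast
  have "Im (x i i \<omega>) = 0" for i using c[of i i] by (simp add: complex_eq_iff)
  then show ?thesis
    using c[of i j]
    by (auto simp: gue_map_def gue_coords_def complex_eq_iff real_sqrt_divide not_less)
qed

text \<open>Independence is given per complex entry with \<open>i \<ge> j\<close>, so the two real
  coordinates of one entry must be grouped together.\<close>

lemma prod_pairs:
  fixes f :: "'n::{finite,linorder} \<Rightarrow> 'n \<Rightarrow> 'b::comm_monoid_mult"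
  shows "(\<Prod>p\<in>UNIV. \<Prod>q\<in>UNIV. f p q) = (\<Prod>(i, j)\<in>{(i, j). i \<ge> j}. if i = j then f i i else f i j * f j i)"
proof -
  let ?L = "{(i, j). j < (i :: 'n)}" and ?D = "{(i, j). j = (i :: 'n)}" and ?G = "{(i, j). i < (j :: 'n)}"
  let ?f = "\<lambda>(p, q). f p q"
  have "(\<Prod>p\<in>UNIV. \<Prod>q\<in>UNIV. f p q) = prod ?f UNIV"
    by (simp add: prod.cartesian_product flip: UNIV_Times_UNIV)
  also have "(UNIV :: ('n \<times> 'n) set) = ?D \<union> (?L \<union> ?G)" by auto
  also have "prod ?f \<dots> = prod ?f ?D * (prod ?f ?L * prod ?f ?G)"
    by (subst prod.union_disjoint; (subst prod.union_disjoint)?) auto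
  also have "prod ?f ?G = (\<Prod>(i, j)\<in>?L. f j i)"
    by (rule prod.reindex_bij_witness[of _ prod.swap prod.swap]) auto
  also have "prod ?f ?L * (\<Prod>(i, j)\<in>?L. f j i) = (\<Prod>(i, j)\<in>?L. if i = j then f i i else f i j * f j i)"
    unfolding prod.distrib[symmetric] by (intro prod.cong) auto
  also have "prod ?f ?D = (\<Prod>(i, j)\<in>?D. if i = j then f i i else f i j * f j i)"
    by (intro prod.cong) auto
  also have "\<dots> * (\<Prod>(i, j)\<in>?L. if i = j then f i i else f i j * f j i)
      = (\<Prod>(i, j)\<in>?D \<union> ?L. if i = j then f i i else f i j * f j i)"
    by (subst prod.union_disjoint) auto
  also have "?D \<union> ?L = {(i, j). i \<ge> j}" by auto
  finally show ?thesis .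
qed

lemma std_gauss_eqI:
  fixes N :: "'a::euclidean_space measure"
  assumes sets: "sets N = sets borel"
    and box: "\<And>l u :: 'a. emeasure N (box l u) =
      (\<Prod>b\<in>Basis. \<integral>\<^sup>+t. ennreal (std_normal_density t) * indicator {l \<bullet> b<..<u \<bullet> b} t \<partial>lborel)"
  shows "std_gauss = N"
proof (rule measure_eqI_generator_eq)
  let ?E = "range (\<lambda>(a, b). box a b :: 'a set)"
  show "Int_stable ?E" by (auto simp: Int_stable_def box_Int_box)
  show "?E \<subseteq> Pow UNIV" "sets std_gauss = sigma_sets UNIV ?E" "sets N = sigma_sets UNIV ?E"
    by (simp_all add: borel_eq_box sets)
  let ?A = "\<lambda>n::nat. box (- (real n *\<^sub>R One)) (real n *\<^sub>R One) :: 'a set"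
  show "range ?A \<subseteq> ?E" "(\<Union>i. ?A i) = UNIV" unfolding UN_box_eq_UNIV by auto
  show "emeasure std_gauss (?A i) \<noteq> \<infinity>" for i by simp
  show "emeasure std_gauss X = emeasure N X" if "X \<in> ?E" for X
  proof -
    from that obtain l u where X: "X = box l u" by auto
    have "X = {x. \<forall>b\<in>Basis. x \<bullet> b \<in> {l \<bullet> b<..<u \<bullet> b}}" by (auto simp: X box_def)
    then show ?thesis
      using emeasure_std_gauss_inter[of "\<lambda>b. {l \<bullet> b<..<u \<bullet> b}"] box[of l u] by (simp add: X)
  qed
qed

text \<open>Two layers of independence make the probability of a box a product over coordinates:
  between the entries with \<open>i \<ge> j\<close>, and between real and imaginary part inside an
  off-diagonal entry.\<close>

lemma (in prob_space) gue_coords_law: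
  fixes x :: "'n::{finite,linorder} \<Rightarrow> 'n \<Rightarrow> 'a \<Rightarrow> complex"
  assumes x: "gue_entries M x"
  shows "gue_coords x \<in> borel_measurable M" "distr M borel (gue_coords x) = std_gauss"
proof -
  let ?L = "{(i, j). i \<ge> (j :: 'n)}"
  have indep: "indep_vars (\<lambda>_. borel) (\<lambda>(i, j). x i j) ?L"
    and diag: "distributed M lborel (\<lambda>\<omega>. Re (x i i \<omega>)) std_normal_density"
    and offi: "i \<noteq> j \<Longrightarrow> indep_var borel (\<lambda>\<omega>. Re (x i j \<omega>)) borel (\<lambda>\<omega>. Im (x i j \<omega>))"
    and offd: "i \<noteq> j \<Longrightarrow> distributed M lborel (\<lambda>\<omega>. Re (x i j \<omega>)) (normal_density 0 (sqrt (1/2)))"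
      "i \<noteq> j \<Longrightarrow> distributed M lborel (\<lambda>\<omega>. Im (x i j \<omega>)) (normal_density 0 (sqrt (1/2)))" for i j
    using x unfolding gue_entries_def by blast+
  have scale: "distributed M lborel (\<lambda>\<omega>. sqrt 2 * V \<omega>) std_normal_density"
    if "distributed M lborel V (normal_density 0 (sqrt (1/2)))" for V
    using normal_density_affine[OF that, of "sqrt 2" 0] by (simp flip: real_sqrt_mult)
  have coord: "distributed M lborel (\<lambda>\<omega>. gue_coords x \<omega> $ p $ q) std_normal_density" for p q
  proof -
    consider "p = q" | "p \<noteq> q" "q < p" | "p \<noteq> q" "\<not> q < p" by blast
    then show ?thesis
      by cases (use diag scale[OF offd(1)] scale[OF offd(2)] in \<open>auto simp: gue_coords_def\<close>)
  qed
  then have cm [measurable]: "(\<lambda>\<omega>. gue_coords x \<omega> $ p $ q) \<in> borel_measurable M" for p q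
    using distributed_measurable by fastforce
  show meas [measurable]: "gue_coords x \<in> borel_measurable M"
  proof (rule borel_measurable_euclidean_space[THEN iffD2], rule ballI)
    fix b :: "((real, 'n) vec, 'n) vec" assume "b \<in> Basis"
    then obtain p q where "b = axis p (axis q 1)" by (auto simp: Basis_vec_def)
    then show "(\<lambda>\<omega>. gue_coords x \<omega> \<bullet> b) \<in> borel_measurable M"
      by (simp add: inner_axis)
  qed
  have "std_gauss = distr M borel (gue_coords x)"
  proof (rule std_gauss_eqI)
    fix l u :: "((real, 'n) vec, 'n) vec"
    define J where "J p q = {l $ p $ q<..<u $ p $ q}" for p q
    \<comment> \<open>The condition that the box imposes on the single entry \<open>x i j\<close>,
      \<open>i \<ge> j\<close>, collecting both coordinates made from it.\<close>
    define A where "A = (\<lambda>(i :: 'n, j). if i = j then {z. Re z \<in> J i i}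
      else {z. sqrt 2 * Re z \<in> J i j \<and> sqrt 2 * Im z \<in> J j i})"
    define P where "P p q = prob {\<omega> \<in> space M. gue_coords x \<omega> $ p $ q \<in> J p q}" for p q
    have Jm [measurable]: "J p q \<in> sets borel" for p q by (simp add: J_def)
    have Am: "A ij \<in> sets borel" for ij
    proof -
      have "{z \<in> space borel. Re z \<in> J i i} \<in> sets borel"
        "{z \<in> space borel. sqrt 2 * Re z \<in> J i j \<and> sqrt 2 * Im z \<in> J j i} \<in> sets borel" for i j
        by measurable
      then show ?thesis by (simp add: A_def split_beta)
    qed
    have "emeasure (distr M borel (gue_coords x)) (box l u) = emeasure M (gue_coords x -` box l u \<inter> space M)"
      by (intro emeasure_distr) auto
    also have "gue_coords x -` box l u \<inter> space M = (\<Inter>ij\<in>?L. (\<lambda>(i, j). x i j) ij -` A ij \<inter> space M)"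
    proof -
      have "gue_coords x \<omega> \<in> box l u \<longleftrightarrow> (\<forall>p q. gue_coords x \<omega> $ p $ q \<in> J p q)" for \<omega>
        by (simp add: mem_box_cart J_def interval_cbox_cart box_def Basis_vec_def inner_axis)
      also have "\<dots> \<omega> \<longleftrightarrow> (\<forall>i j. i \<ge> j \<longrightarrow> x i j \<omega> \<in> A (i, j))" for \<omega>
      proof
        assume *: "\<forall>p q. gue_coords x \<omega> $ p $ q \<in> J p q"
        show "\<forall>i j. i \<ge> j \<longrightarrow> x i j \<omega> \<in> A (i, j)"
        proof (intro allI impI)
          fix i j :: 'n assume "j \<le> i"
          then show "x i j \<omega> \<in> A (i, j)"
            using *[rule_format, of i j] *[rule_format, of j i] by (auto simp: A_def gue_coords_def split: if_splits)
        qed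
      next
        assume *: "\<forall>i j. i \<ge> j \<longrightarrow> x i j \<omega> \<in> A (i, j)"
        show "\<forall>p q. gue_coords x \<omega> $ p $ q \<in> J p q"
        proof (intro allI)
          fix p q :: 'n
          show "gue_coords x \<omega> $ p $ q \<in> J p q"
            using *[rule_format, of q p] *[rule_format, of p q] by (auto simp: A_def gue_coords_def split: if_splits)
        qed
      qed
      finally have "gue_coords x \<omega> \<in> box l u \<longleftrightarrow> (\<forall>i j. i \<ge> j \<longrightarrow> x i j \<omega> \<in> A (i, j))" for \<omega> .
      moreover have "?L \<noteq> {}" by auto
      ultimately show ?thesis by auto
    qed
    also have "emeasure M \<dots> = ennreal (\<Prod>ij\<in>?L. prob ((\<lambda>(i, j). x i j) ij -` A ij \<inter> space M))"
      unfolding emeasure_eq_measure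
      by (subst indep_varsD[OF indep]) (use Am in auto)
    also have "(\<Prod>ij\<in>?L. prob ((\<lambda>(i, j). x i j) ij -` A ij \<inter> space M)) =
        (\<Prod>(i, j)\<in>?L. if i = j then P i i else P i j * P j i)"
    proof (intro prod.cong refl, clarify)
      fix i j :: 'n assume ij: "j \<le> i"
      show "prob (x i j -` A (i, j) \<inter> space M) = (if i = j then P i i else P i j * P j i)"
      proof (cases "i = j")
        case True
        then show ?thesis by (simp add: P_def A_def gue_coords_def) (rule arg_cong[where f = prob], auto)
      next
        case False
        have m: "{t. sqrt 2 * t \<in> J p q} \<in> sets borel" for p q
        proof -
          have "{t \<in> space borel. sqrt 2 * t \<in> J p q} \<in> sets borel" by measurable
          then show ?thesis by simp
        qed
        have "prob ((\<lambda>\<omega>. (Re (x i j \<omega>), Im (x i j \<omega>))) -` ({t. sqrt 2 * t \<in> J i j} \<times> {t. sqrt 2 * t \<in> J j i}) \<inter> space M)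
          = prob ((\<lambda>\<omega>. Re (x i j \<omega>)) -` {t. sqrt 2 * t \<in> J i j} \<inter> space M) * prob ((\<lambda>\<omega>. Im (x i j \<omega>)) -` {t. sqrt 2 * t \<in> J j i} \<inter> space M)"
          by (rule indep_varD[OF offi[OF False] m m])
        moreover have "x i j -` A (i, j) \<inter> space M = (\<lambda>\<omega>. (Re (x i j \<omega>), Im (x i j \<omega>))) -` ({t. sqrt 2 * t \<in> J i j} \<times> {t. sqrt 2 * t \<in> J j i}) \<inter> space M"
          using False by (auto simp: A_def)
        moreover have "(\<lambda>\<omega>. Re (x i j \<omega>)) -` {t. sqrt 2 * t \<in> J i j} \<inter> space M = {\<omega> \<in> space M. gue_coords x \<omega> $ i $ j \<in> J i j}"
          "(\<lambda>\<omega>. Im (x i j \<omega>)) -` {t. sqrt 2 * t \<in> J j i} \<inter> space M = {\<omega> \<in> space M. gue_coords x \<omega> $ j $ i \<in> J j i}"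
          using False ij by (auto simp: gue_coords_def)
        ultimately show ?thesis using False by (simp add: P_def)
      qed
    qed
    also have "\<dots> = (\<Prod>p\<in>UNIV. \<Prod>q\<in>UNIV. P p q)" by (rule prod_pairs[symmetric])
    also have "ennreal \<dots> = (\<Prod>p\<in>UNIV. \<Prod>q\<in>UNIV. ennreal (P p q))"
      by (simp add: prod_ennreal P_def prod_nonneg)
    also have "\<dots> = (\<Prod>p\<in>UNIV. \<Prod>q\<in>UNIV. \<integral>\<^sup>+t. ennreal (std_normal_density t) * indicator (J p q) t \<partial>lborel)"
    proof (intro prod.cong refl)
      fix p q
      have "ennreal (P p q) = emeasure M ((\<lambda>\<omega>. gue_coords x \<omega> $ p $ q) -` J p q \<inter> space M)"
        unfolding P_def emeasure_eq_measure by (intro arg_cong[where f = ennreal] arg_cong[where f = prob]) auto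
      also have "\<dots> = (\<integral>\<^sup>+t. ennreal (std_normal_density t) * indicator (J p q) t \<partial>lborel)"
        by (rule distributed_emeasure[OF coord]) simp
      finally show "ennreal (P p q) = (\<integral>\<^sup>+t. ennreal (std_normal_density t) * indicator (J p q) t \<partial>lborel)" .
    qed
    also have "\<dots> = (\<Prod>b\<in>Basis. \<integral>\<^sup>+t. ennreal (std_normal_density t) * indicator {l \<bullet> b<..<u \<bullet> b} t \<partial>lborel)"
      using prod.reindex_bij_betw[OF bij_betw_axis_axis, of "\<lambda>b. \<integral>\<^sup>+t. ennreal (std_normal_density t) * indicator {l \<bullet> b<..<u \<bullet> b} t \<partial>lborel"]
      by (simp add: prod.cartesian_product split_beta J_def inner_axis flip: UNIV_Times_UNIV)
    finally show "emeasure (distr M borel (gue_coords x)) (box l u) =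
      (\<Prod>b\<in>Basis. \<integral>\<^sup>+t. ennreal (std_normal_density t) * indicator {l \<bullet> b<..<u \<bullet> b} t \<partial>lborel)" .
  qed simp
  then show "distr M borel (gue_coords x) = std_gauss" ..
qed

lemma gamma_max_bound:
  fixes \<Gamma> :: "real^'n^'n"
  assumes "\<And>i j. 0 \<le> \<Gamma> $ i $ j"
  shows "\<Gamma> $ i $ j \<le> (gamma_max \<Gamma>)\<^sup>2"
proof -
  have "{\<Gamma> $ i $ j | i j. True} = (\<lambda>(i, j). \<Gamma> $ i $ j) ` UNIV" by auto
  then have fin: "finite {\<Gamma> $ i $ j | i j. True}" by simp
  then have "\<Gamma> $ i $ j \<le> Max {\<Gamma> $ i $ j | i j. True}" by (intro Max_ge) auto
  then show ?thesis
    unfolding gamma_max_def using order_trans[OF assms[of i j]] by (subst real_sqrt_pow2) auto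
qed

subsection \<open>The deterministic equivalent\<close>

theorem corollary1p4:
  fixes M :: "'w measure"
    and \<Gamma> :: "((real, 'n::{finite,linorder}) vec, 'n) vec"
    and X :: "'w \<Rightarrow> ((complex, 'n) vec, 'n) vec"
    and Y Z :: "((complex, 'n) vec, 'n) vec"
    and U :: "((complex, 'k::finite) vec, 'n) vec"
    and \<Theta> :: "((complex, 'k) vec, 'k) vec"
    and G :: "((complex, 'n) vec, 'n) vec \<Rightarrow> ((complex, 'n) vec, 'n) vec"
    and z :: complex
    and \<delta> d :: real
  assumes "prob_space M"
    and "transpose \<Gamma> = \<Gamma>" and "\<And>i j. \<Gamma> $ i $ j \<ge> 0"
    and "gamma_max \<Gamma> > 0"
    and "gue_variance_profile M \<Gamma> X"
    and "hermitian_mat Y"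
    and "diagonal_matrix \<Theta>" and "\<And>i. \<Theta> $ i $ i \<in> \<real> - {0}"
    and "adj_mat U ** U = mat 1"
    and "Z = U ** \<Theta> ** adj_mat U"
    and "hermitian_mat Z" and "rank Z = CARD('k)"
    and "is_G_box \<Gamma> Y G"
    and "0 < \<delta>" and "\<delta> < 1"
    and "Im z > 0"
    and "Im z \<ge> gamma_max \<Gamma> * (2 / (real CARD('n) * (1 - \<delta>))) powr (1/5)"
    and "d > 0"
  shows "measure M {\<omega> \<in> space M.
           op_norm (beta_k (X \<omega>) Y U \<Theta> z - beta_box_k \<Gamma> G Y U \<Theta> z)
             \<ge> op_norm \<Theta> * eps_bar CARD('n) CARD('k) (gamma_max \<Gamma>) \<delta> z d}
         \<le> 4 * (real CARD('k))^2 * real CARD('n) powr (- d)"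
proof -
  interpret M: prob_space M by fact
  define n where "n = real CARD('n)"
  define k where "k = real CARD('k)"
  define \<gamma> where "\<gamma> = gamma_max \<Gamma>"
  define S where "S = (\<chi> i j. \<Gamma> $ i $ j / n)"
  \<comment> \<open>\<open>\<sigma>\<^sup>2\<close> is then the largest entry of \<open>S\<close>,
    and \<open>N * \<sigma>\<^sup>2\<close> is \<open>\<gamma>\<^sup>2\<close>.\<close>
  define \<sigma> where "\<sigma> = \<gamma> / sqrt n"
  have n: "1 \<le> n" by (simp add: n_def Suc_leI)
  have \<gamma>: "0 < \<gamma>" using assms(4) by (simp add: \<gamma>_def)
  obtain x where x: "gue_entries M x"
    and X: "\<And>\<omega> i j. \<omega> \<in> space M \<Longrightarrow> X \<omega> $ i $ j =
              complex_of_real (sqrt (\<Gamma> $ i $ j)) * x i j \<omega> / complex_of_real (sqrt (real CARD('n)))"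
    using assms(5) unfolding gue_variance_profile_def by blast
  interpret gaussian_resolvent "gue_map \<Gamma>" S Y z \<sigma>
  proof (rule gaussian_resolvent.intro)
    show "linear (gue_map \<Gamma>)" by (rule linear_gue_map)
    show "hermitian_mat (gue_map \<Gamma> x)" for x by (rule hermitian_gue_map[OF assms(2)])
    show "(\<Sum>b\<in>Basis. gue_map \<Gamma> b $ i $ j * gue_map \<Gamma> b $ k $ l)
      = (if k = j \<and> l = i then complex_of_real (S $ i $ j) else 0)" for i j k l
      by (simp only: gue_map_cov[OF assms(2,3)] S_def n_def vec_lambda_beta)
    show "0 \<le> S $ i $ j" for i j using assms(3) n by (simp add: S_def)
    show "S $ i $ j \<le> \<sigma>\<^sup>2" for i j
      using gamma_max_bound[OF assms(3), of i j] n
      by (simp add: S_def \<sigma>_def \<gamma>_def power_divide divide_right_mono)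
  qed (use n \<gamma> assms in \<open>auto simp: \<sigma>_def\<close>)
  have map_coords: "gue_map \<Gamma> (gue_coords x \<omega>) = X \<omega>" if "\<omega> \<in> space M" for \<omega>
    using gue_map_coords[OF x that] X[OF that] by (simp add: vec_eq_iff)

  define g where "g = (\<chi> i. G (mat z) $ i $ i)"
  define Q where "Q = matrix_inv (dyson S Y (\<chi> i. z) g)"
  \<comment> \<open>Makes the fixed-point equation for \<open>G\<close> at \<open>mat z\<close> a
    Dyson equation with constant spectral vector.\<close>
  have Omega: "Omega_box \<Gamma> G (mat z) - Y = dyson S Y (\<chi> i. z) g"
    by (simp add: Omega_box_def R_map_def dyson_def diag_mat_def mat_def vec_eq_iff S_def n_def g_def)
  have z_up: "mat z \<in> diag_upper"
    using Im_z by (simp add: diag_upper_def diagonal_matrix_def mat_def)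
  then have "G (mat z) \<in> diag_lower" and fix_pt: "G (mat z) = diag_part Q"
    using assms(13) unfolding is_G_box_def Q_def Omega[symmetric] by auto
  then have g_neg: "Im (g $ i) < 0" for i by (simp add: g_def diag_lower_def)
  have g_fix: "g $ i = matrix_inv (dyson S Y (\<chi> i. z) g) $ i $ i" for i
  proof -
    have "G (mat z) $ i $ i = Q $ i $ i"
      by (subst fix_pt) (simp add: diag_part_def diag_mat_def)
    then show ?thesis unfolding Q_def[symmetric] by (simp add: g_def)
  qed

  define e where "e = \<gamma> ^ 3 / (n * \<eta> ^ 4)"
  have sqrt_n: "sqrt n * sqrt n = n" "0 < sqrt n" using n by auto
  have \<tau>_eq: "\<tau> / \<eta>\<^sup>2 = e"
    unfolding \<tau>_def n_def[symmetric] unfolding e_def \<sigma>_def using sqrt_n n Im_z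
    by (simp add: power_divide field_simps power2_eq_square power3_eq_cube power4_eq_xxxx)
  have \<kappa>_eq: "real CARD('n) * \<sigma>\<^sup>2 = \<gamma>\<^sup>2"
    unfolding \<sigma>_def n_def[symmetric] using n by (simp add: power_divide)
  \<comment> \<open>The fifth power of the lower bound on \<open>Im z\<close>:
    \<open>\<gamma>\<^sup>2 * e\<close> contains \<open>\<gamma> ^ 5 / \<eta> ^ 4\<close>, which
    explains the exponent \<open>1/5\<close>. A factor 2 is left over.\<close>
  have small: "\<gamma>\<^sup>2 * e \<le> (1 - \<delta>) * \<eta>"
  proof -
    define t where "t = 2 / (n * (1 - \<delta>))"
    have t: "0 < t" using n assms(15) by (simp add: t_def)
    have "(t powr (1/5)) ^ 5 = t" using t by (simp add: powr_power)
    then have "\<gamma> ^ 5 * t = (\<gamma> * t powr (1/5)) ^ 5" by (simp add: power_mult_distrib)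
    also have "\<dots> \<le> \<eta> ^ 5"
      using assms(17) \<gamma> by (intro power_mono) (auto simp: \<gamma>_def t_def n_def)
    finally have "2 * \<gamma> ^ 5 \<le> \<eta> ^ 5 * (n * (1 - \<delta>))"
      using n assms(15) by (simp add: t_def field_simps)
    moreover have "0 < \<gamma> ^ 5" using \<gamma> by simp
    ultimately have "\<gamma> ^ 5 \<le> (1 - \<delta>) * \<eta> * (n * \<eta> ^ 4)"
      by (simp add: eval_nat_numeral mult_ac)
    then have "\<gamma> ^ 5 / (n * \<eta> ^ 4) \<le> (1 - \<delta>) * \<eta>"
      using n Im_z by (simp add: divide_le_eq)
    then show ?thesis by (simp add: e_def power_add[symmetric])
  qed
  define c where "c = e + \<gamma>\<^sup>2 / \<eta>\<^sup>2 * (e + \<gamma>\<^sup>2 * e / (\<delta> * \<eta>\<^sup>2))"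
  have det: "op_norm (ER - Q) \<le> c"
    using deterministic_equivalent[OF g_fix g_neg assms(14)] small
    unfolding \<tau>_eq \<kappa>_eq Q_def c_def by blast

  \<comment> \<open>Solves \<open>s\<^sup>2 / (2 * L\<^sup>2) = d * ln n\<close> with
    \<open>L = \<sigma> / \<eta>\<^sup>2\<close>, so that the Gaussian tail equals
    \<open>N powr (- d)\<close>.\<close>
  define s where "s = sqrt 2 * \<gamma> * sqrt (d * ln n) / (\<eta>\<^sup>2 * sqrt n)"
  have dn: "0 \<le> d * ln n" using n assms(18) by simp
  have s: "0 \<le> s" using \<gamma> dn n by (simp add: s_def)
  have "s\<^sup>2 / (2 * (\<sigma> / \<eta>\<^sup>2)\<^sup>2) = d * ln n"
    using \<gamma> dn n Im_z by (simp add: s_def \<sigma>_def power_divide power_mult_distrib)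
  then have exp_eq: "exp (- s\<^sup>2 / (2 * (\<sigma> / \<eta>\<^sup>2)\<^sup>2)) = n powr (- d)"
    using n by (simp add: powr_def)
  have eps: "k * s + c \<le> eps_bar CARD('n) CARD('k) \<gamma> \<delta> z d"
  proof -
    have e0: "0 \<le> e" using \<gamma> n Im_z by (simp add: e_def)
    then have c0: "0 \<le> c" using assms(14) by (simp add: c_def)
    have "n powr (-1/2) = n powr - (1/2)" by simp
    also have "\<dots> = 1 / sqrt n"
      using n by (subst powr_minus, subst powr_half_sqrt) (simp_all add: inverse_eq_divide)
    finally have "n powr (-1/2) = 1 / sqrt n" .
    then have "sqrt 2 * k * \<gamma> * (sqrt (d * ln n) / \<bar>Im z\<bar>^2) * n powr (-1/2) = k * s"
      by (simp add: s_def)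
    \<comment> \<open>The deterministic terms of \<open>eps_bar\<close> are exactly twice the bound
      obtained; only \<open>c \<le> 2 * c\<close> is used.\<close>
    moreover have "2 * \<gamma>^3 / (n * (Im z)^4) + (1 + \<gamma>^2 / (\<delta> * \<bar>Im z\<bar>^2)) * (2 * \<gamma>^5 / (n * (Im z)^6)) = 2 * c"
    proof -
      have "2 * \<gamma>^5 / (n * (Im z)^6) = 2 * (\<gamma>\<^sup>2 / \<eta>\<^sup>2 * e)"
        by (simp add: e_def power_add[symmetric])
      moreover have "2 * \<gamma>^3 / (n * (Im z)^4) = 2 * e" by (simp add: e_def)
      moreover have "\<gamma>\<^sup>2 * e / (\<delta> * \<eta>\<^sup>2) = \<gamma>\<^sup>2 / (\<delta> * \<eta>\<^sup>2) * e" by simp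
      moreover have "2 * e + (1 + q) * (2 * (p * e)) = 2 * (e + p * (e + q * e))" for p q
        by (simp add: algebra_simps)
      ultimately show ?thesis by (simp only: c_def power2_abs)
    qed
    ultimately show ?thesis
      using c0 unfolding eps_bar_def n_def[symmetric] k_def[symmetric] by linarith
  qed

  define B where "B = {x. k * s + c \<le> op_norm (adj_mat U ** (R x - Q) ** U)}"
  have Bm: "B \<in> sets borel" unfolding B_def by (rule compressed_resolvent_measurable)
  \<comment> \<open>Allows \<open>op_norm \<Theta>\<close> to be cancelled; a diagonal entry exists
    since index types are nonempty.\<close>
  have \<Theta>_pos: "0 < op_norm \<Theta>"
  proof -
    obtain i :: 'k where True by blast
    have "0 < norm (\<Theta> $ i $ i)" using assms(8)[of i] by simp
    then show ?thesis using norm_entry_le_op_norm[of \<Theta> i i] by linarith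
  qed
  have sub: "{\<omega> \<in> space M. op_norm (beta_k (X \<omega>) Y U \<Theta> z - beta_box_k \<Gamma> G Y U \<Theta> z)
      \<ge> op_norm \<Theta> * eps_bar CARD('n) CARD('k) \<gamma> \<delta> z d} \<subseteq> gue_coords x -` B \<inter> space M"
  proof (rule subsetI)
    fix \<omega> assume "\<omega> \<in> {\<omega> \<in> space M. op_norm (beta_k (X \<omega>) Y U \<Theta> z - beta_box_k \<Gamma> G Y U \<Theta> z)
      \<ge> op_norm \<Theta> * eps_bar CARD('n) CARD('k) \<gamma> \<delta> z d}"
    then have \<omega>: "\<omega> \<in> space M"
      and ge: "op_norm \<Theta> * eps_bar CARD('n) CARD('k) \<gamma> \<delta> z d
        \<le> op_norm (beta_k (X \<omega>) Y U \<Theta> z - beta_box_k \<Gamma> G Y U \<Theta> z)" by auto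
    let ?V = "adj_mat U ** (R (gue_coords x \<omega>) - Q) ** U"
    have "beta_k (X \<omega>) Y U \<Theta> z - beta_box_k \<Gamma> G Y U \<Theta> z = - (?V ** \<Theta>)"
      unfolding beta_k_def beta_box_k_def Omega Q_def[symmetric]
      by (simp add: R_def map_coords[OF \<omega>] matrix_mult_diff_distribs)
    then have "op_norm (beta_k (X \<omega>) Y U \<Theta> z - beta_box_k \<Gamma> G Y U \<Theta> z) \<le> op_norm ?V * op_norm \<Theta>"
      by (simp add: op_norm_uminus op_norm_mul)
    with ge have "op_norm \<Theta> * eps_bar CARD('n) CARD('k) \<gamma> \<delta> z d \<le> op_norm \<Theta> * op_norm ?V"
      by (simp add: mult.commute)
    then have "eps_bar CARD('n) CARD('k) \<gamma> \<delta> z d \<le> op_norm ?V"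
      using \<Theta>_pos by simp
    then show "\<omega> \<in> gue_coords x -` B \<inter> space M" using eps \<omega> by (simp add: B_def)
  qed
  have gm: "gue_coords x \<in> borel_measurable M" and law: "distr M borel (gue_coords x) = std_gauss"
    using M.gue_coords_law[OF x] by auto
  have "measure M {\<omega> \<in> space M. op_norm (beta_k (X \<omega>) Y U \<Theta> z - beta_box_k \<Gamma> G Y U \<Theta> z)
      \<ge> op_norm \<Theta> * eps_bar CARD('n) CARD('k) \<gamma> \<delta> z d} \<le> measure M (gue_coords x -` B \<inter> space M)"
    using sub measurable_sets[OF gm Bm] by (rule M.finite_measure_mono)
  also have "\<dots> = measure std_gauss B"
    unfolding law[symmetric] by (rule measure_distr[OF gm, symmetric]) (use Bm in simp)
  also have "\<dots> \<le> 2 * k\<^sup>2 * n powr (- d)"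
    using compressed_resolvent_concentration[OF assms(9) s det] unfolding exp_eq B_def k_def .
  \<comment> \<open>Bounding the complex modulus directly costs 2 per entry; the constant 4 is what
    separate bounds for real and imaginary parts would give.\<close>
  also have "\<dots> \<le> 4 * k\<^sup>2 * n powr (- d)" by (intro mult_right_mono) auto
  finally show ?thesis unfolding \<gamma>_def k_def n_def .
qed

end
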